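(* Let $\alpha,\beta$ be integers different from $1$ with $v_2(\alpha-1)=v_2(\beta-1)=m\ge 3$, and let $\ell=v_2(\alpha-\beta)$ satisfy $m<\ell<2m$, $\ell\le 2m-3$ and $2\ell+2\le 3m$. Then $|G_2|=2^{2m+3\ell}$, the nilpotency class of $G_2$ is $5$, $o(a)=o(b)=2^{\ell+m}$ and $o(c)=2^{2\ell-m+1}$.
   Context: $G(\alpha,\beta)=\langle A,B\mid A^{[A,B]}=A^{\alpha},\ B^{[B,A]}=B^{\beta}\rangle$ with $[x,y]=x^{-1}y^{-1}xy$, $y^x=x^{-1}yx$, and $C=[A,B]$. The group $G(\alpha,\beta)$ is finite and nilpotent, hence the direct product of its Sylow subgroups; $G_2$ denotes its Sylow $2$-subgroup and $a,b,c$ denote the images of $A,B,C$ under the canonical projection $G(\alpha,\beta)\to G_2$. $v_2$ is the $2$-adic valuation and $o(x)$ the order of $x$. *)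

theory Defs
  imports "HOL-Algebra.Algebra" "HOL-Computational_Algebra.Computational_Algebra"
begin

text \<open>Letters: (g, e) with g = False for A, g = True for B; e = True means inverse letter.\<close>
type_synonym letter = "bool \<times> bool"
type_synonym word = "letter list"

definition inv_letter :: "letter \<Rightarrow> letter" where
  "inv_letter l = (fst l, \<not> snd l)"

definition winv :: "word \<Rightarrow> word" where
  "winv w = rev (map inv_letter w)"

definition wpow :: "letter \<Rightarrow> int \<Rightarrow> word" where
  "wpow l k = (if k \<ge> 0 then replicate (nat k) l else replicate (nat (- k)) (inv_letter l))"

definition LA :: letter where "LA = (False, False)"
definition LB :: letter where "LB = (True, False)"

definition wcomm :: "word \<Rightarrow> word \<Rightarrow> word" where
  "wcomm x y = winv x @ winv y @ x @ y"

definition rel1 :: "int \<Rightarrow> word" where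
  "rel1 \<alpha> = winv (wcomm [LA] [LB]) @ [LA] @ wcomm [LA] [LB] @ wpow LA (- \<alpha>)"

definition rel2 :: "int \<Rightarrow> word" where
  "rel2 \<beta> = winv (wcomm [LB] [LA]) @ [LB] @ wcomm [LB] [LA] @ wpow LB (- \<beta>)"

inductive wrel :: "int \<Rightarrow> int \<Rightarrow> word \<Rightarrow> word \<Rightarrow> bool" for \<alpha> \<beta> where
  refl: "wrel \<alpha> \<beta> w w"
| sym: "wrel \<alpha> \<beta> u v \<Longrightarrow> wrel \<alpha> \<beta> v u"
| trans: "wrel \<alpha> \<beta> u v \<Longrightarrow> wrel \<alpha> \<beta> v w \<Longrightarrow> wrel \<alpha> \<beta> u w"
| ctx: "wrel \<alpha> \<beta> u v \<Longrightarrow> wrel \<alpha> \<beta> (x @ u @ y) (x @ v @ y)"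
| cancel: "wrel \<alpha> \<beta> [l, inv_letter l] []"
| r1: "wrel \<alpha> \<beta> (rel1 \<alpha>) []"
| r2: "wrel \<alpha> \<beta> (rel2 \<beta>) []"

definition wclass :: "int \<Rightarrow> int \<Rightarrow> word \<Rightarrow> word set" where
  "wclass \<alpha> \<beta> w = {v. wrel \<alpha> \<beta> w v}"

definition wmult :: "int \<Rightarrow> int \<Rightarrow> word set \<Rightarrow> word set \<Rightarrow> word set" where
  "wmult \<alpha> \<beta> S T = {v. \<exists>s\<in>S. \<exists>t\<in>T. wrel \<alpha> \<beta> (s @ t) v}"

definition Gpres :: "int \<Rightarrow> int \<Rightarrow> word set monoid" where
  "Gpres \<alpha> \<beta> = \<lparr> carrier = range (wclass \<alpha> \<beta>),
     monoid.mult = wmult \<alpha> \<beta>,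
     monoid.one = wclass \<alpha> \<beta> [] \<rparr>"

definition Aelt :: "int \<Rightarrow> int \<Rightarrow> word set" where "Aelt \<alpha> \<beta> = wclass \<alpha> \<beta> [LA]"
definition Belt :: "int \<Rightarrow> int \<Rightarrow> word set" where "Belt \<alpha> \<beta> = wclass \<alpha> \<beta> [LB]"
definition Celt :: "int \<Rightarrow> int \<Rightarrow> word set" where
  "Celt \<alpha> \<beta> = wclass \<alpha> \<beta> (wcomm [LA] [LB])"

definition syl2 :: "('a, 'b) monoid_scheme \<Rightarrow> 'a set" where
  "syl2 G = {x \<in> carrier G. \<exists>k::nat. x [^]\<^bsub>G\<^esub> ((2::nat) ^ k) = \<one>\<^bsub>G\<^esub>}"

definition oddpart_set :: "('a, 'b) monoid_scheme \<Rightarrow> 'a set" where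
  "oddpart_set G = {x \<in> carrier G. \<exists>k::nat. odd k \<and> x [^]\<^bsub>G\<^esub> k = \<one>\<^bsub>G\<^esub>}"

text \<open>Canonical projection onto the Sylow 2-factor: the 2-component u of x = u v
  (u a 2-element, v an element of odd order, u v = v u).\<close>
definition proj2 :: "('a, 'b) monoid_scheme \<Rightarrow> 'a \<Rightarrow> 'a" where
  "proj2 G x = (THE u. u \<in> syl2 G \<and> (\<exists>v \<in> oddpart_set G.
       x = u \<otimes>\<^bsub>G\<^esub> v \<and> u \<otimes>\<^bsub>G\<^esub> v = v \<otimes>\<^bsub>G\<^esub> u))"

text \<open>Lower central series: lcs G 0 = G (gamma_1), lcs G (n+1) = [lcs G n, G].\<close>
primrec lcs :: "('a, 'b) monoid_scheme \<Rightarrow> nat \<Rightarrow> 'a set" where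
  "lcs G 0 = carrier G"
| "lcs G (Suc n) = generate G {inv\<^bsub>G\<^esub> x \<otimes>\<^bsub>G\<^esub> inv\<^bsub>G\<^esub> y \<otimes>\<^bsub>G\<^esub> x \<otimes>\<^bsub>G\<^esub> y | x y.
      x \<in> lcs G n \<and> y \<in> carrier G}"

definition nilpotency_class :: "('a, 'b) monoid_scheme \<Rightarrow> nat" where
  "nilpotency_class G = (LEAST c. lcs G c = {\<one>\<^bsub>G\<^esub>})"

end

theory Submission
  imports Defs "HOL-Number_Theory.Residues"
begin

text \<open>
  Write \<open>C = [A, B]\<close>. The conjugate of \<open>A\<close> by \<open>B ^ \<beta> = C B C\<^sup>-\<^sup>1\<close> can be computed in two ways, which gives a relation
  \<open>C ^ p A ^ y = B ^ h C ^ q\<close>. It forces \<open>A\<close> and \<open>B\<close> to have finite order; and in every nontrivial quotient some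
  nontrivial power of \<open>A\<close>, \<open>B\<close> or \<open>C\<close> is central, so that the group is nilpotent and splits into its 2-part
  \<open>P = \<langle>a, b\<rangle>\<close> and its odd part.

  In \<open>P\<close> the same relation and its consequences, read 2-adically, give \<open>a ^ (2 ^ (l + m)) = b ^ (2 ^ (l + m)) = 1\<close>,
  make \<open>a ^ (2 ^ (2 * m - 1))\<close> and \<open>b ^ (2 ^ (2 * m - 1))\<close> central and put \<open>c ^ (2 ^ l)\<close> into the group they generate.
  Hence every element of \<open>P\<close> is \<open>a ^ i c ^ k b ^ j\<close> with \<open>i, j < 2 ^ (l + m)\<close> and \<open>k < 2 ^ l\<close>. These elements are
  distinct because the expected action on the cosets of \<open>\<langle>a\<rangle>\<close> can be written down explicitly, and likewise, by
  the symmetry exchanging \<open>A\<close> and \<open>B\<close>, the one on the cosets of \<open>\<langle>b\<rangle>\<close>.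
\<close>

section \<open>Powers and conjugation\<close>

text \<open>The hypotheses enter as valuations. \<open>l \<le> 2 * m - 3\<close> says
  \<open>3 * (m - 1) \<ge> l + m\<close>: cubes of \<open>h\<close> vanish, so the model is
  polynomial in its coordinates. \<open>2 * l + 2 \<le> 3 * m\<close> says
  \<open>4 * m - 2 - l \<ge> l + m\<close>: it makes the determinant of two relations between
  \<open>a ^ (2 ^ (l + m))\<close> and \<open>b ^ (2 ^ (l + m))\<close> odd, and lets the model
  forget multiples of \<open>2 ^ (2 * m - 1)\<close> in the exponent of \<open>c\<close>.
  \<open>m < l\<close> gives \<open>2 * m < l + m\<close>, so that a commutator of weight five
  survives. The exponent \<open>2 * m - 1\<close> is the valuation of \<open>hex x (nat x)\<close>
  when \<open>x - 1\<close> has valuation \<open>m\<close>; raising it to \<open>l + m\<close> takes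
  \<open>l - m + 1\<close> squarings of \<open>c ^ (2 ^ l)\<close>, whence the order of
  \<open>c\<close>. Finiteness is not known at the start: only \<open>A\<close>, \<open>B\<close>
  and \<open>C\<close> are seen to have finite order. So the nilpotency is bounded by the finite set
  of their powers, and the 2-part is reached through idempotent exponents. At the end, central
  powers of \<open>a\<close> act trivially on the cosets of \<open>\<langle>a\<rangle>\<close>, so
  the order of \<open>a\<close> has to come from the mirrored presentation.\<close>

text \<open>Groups as a type class: the computations with powers and conjugates below are done without
  carriers, and reach a group of HOL-Algebra (or a quotient of it) through its Cayley embedding.\<close>

class grp = monoid_mult +
  fixes ginv :: "'a \<Rightarrow> 'a"
  assumes ginv_left [simp]: "ginv x * x = 1"
begin

lemma ginv_cancel_left [simp]: "ginv x * (x * y) = y"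
  by (simp flip: mult_assoc)

lemma ginv_right [simp]: "x * ginv x = 1"
  by (metis ginv_cancel_left ginv_left)

lemma ginv_cancel_right [simp]: "x * (ginv x * y) = y"
  by (simp flip: mult_assoc)

lemma grp_left_cancel [simp]: "x * y = x * z \<longleftrightarrow> y = z"
  by (metis ginv_cancel_left)

lemma grp_right_cancel [simp]: "y * x = z * x \<longleftrightarrow> y = z"
  by (metis mult_assoc ginv_right mult_1_right)

lemma ginv_unique: "x * y = 1 \<Longrightarrow> ginv x = y"
  by (metis ginv_cancel_left mult_1_right)

lemma ginv_ginv [simp]: "ginv (ginv x) = x"
  by (rule ginv_unique) simp

lemma ginv_one [simp]: "ginv 1 = 1"
  by (rule ginv_unique) simp

lemma ginv_mult [simp]: "ginv (x * y) = ginv y * ginv x"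
  by (rule ginv_unique) (simp add: mult_assoc)

lemma grp_solve_left: "x * y = z \<longleftrightarrow> y = ginv x * z"
  by (metis ginv_cancel_left ginv_cancel_right)

lemma grp_solve_right: "x * y = z \<longleftrightarrow> x = z * ginv y"
  by (metis mult_assoc ginv_left ginv_right mult_1_right)

end

definition zp :: "'a::grp \<Rightarrow> int \<Rightarrow> 'a" where
  "zp x k = (if k \<ge> 0 then x ^ nat k else ginv x ^ nat (- k))"

definition cj :: "'a::grp \<Rightarrow> 'a \<Rightarrow> 'a" where
  "cj x g = ginv g * x * g"

lemma zp_0 [simp]: "zp x 0 = 1" and zp_1 [simp]: "zp x 1 = x"
  by (simp_all add: zp_def)

lemma zp_of_nat: "zp x (int n) = x ^ n"
  by (simp add: zp_def)

lemma zp_minus1 [simp]: "zp x (-1) = ginv x"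
  by (simp add: zp_def)

lemma zp_one [simp]: "zp 1 k = (1::'a::grp)"
  by (simp add: zp_def)

lemma power_ginv: "ginv x ^ n = ginv (x ^ n)" for x :: "'a::grp"
proof (induction n)
  case (Suc n)
  then show ?case by (metis ginv_mult power_Suc power_Suc2)
qed simp

lemma zp_Suc: "zp x (k + 1) = zp x k * x"
proof (cases "k \<ge> 0")
  case True
  then show ?thesis by (simp add: zp_def nat_add_distrib power_commutes)
next
  case False
  define n where "n = nat (- k - 1)"
  have k: "k = - int n - 1" using False by (simp add: n_def)
  have "nat (- k) = Suc n" using k by simp
  then have "zp x k * x = ginv x ^ n * ginv x * x"
    using False by (simp add: zp_def power_commutes)
  moreover have "zp x (k + 1) = ginv x ^ n"
    using k by (simp add: zp_def)
  ultimately show ?thesis by (simp add: mult.assoc)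
qed

lemma zp_add: "zp x (j + k) = zp x j * zp x k"
proof (induction k rule: int_induct[where k = 0])
  case base
  then show ?case by simp
next
  case (step1 i)
  then show ?case using zp_Suc[of x "j + i"] zp_Suc[of x i]
    by (simp add: add.assoc mult.assoc)
next
  case (step2 i)
  have "zp x (j + (i - 1)) * x = zp x (j + i)"
    using zp_Suc[of x "j + (i - 1)"] by simp
  moreover have "zp x (i - 1) * x = zp x i"
    using zp_Suc[of x "i - 1"] by simp
  ultimately show ?case using step2 by (metis grp_right_cancel mult.assoc)
qed

lemma zp_minus: "zp x (- k) = ginv (zp x k)"
  by (rule ginv_unique[symmetric]) (simp flip: zp_add)

lemma zp_diff: "zp x (j - k) = zp x j * ginv (zp x k)"
  using zp_add[of x j "-k"] by (simp add: zp_minus)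

lemma zp_mult: "zp x (j * k) = zp (zp x j) k"
proof (induction k rule: int_induct[where k = 0])
  case base
  then show ?case by simp
next
  case (step1 i)
  then show ?case by (simp add: zp_add distrib_left)
next
  case (step2 i)
  then show ?case by (simp add: zp_diff right_diff_distrib)
qed

lemma zp_commute: "zp x j * zp x k = zp x k * zp x j"
  by (metis add.commute zp_add)

lemma cj_mult: "cj (x * y) g = cj x g * cj y g"
  by (simp add: cj_def mult.assoc)

lemma cj_one [simp]: "cj 1 g = 1" "cj x 1 = x"
  by (simp_all add: cj_def)

lemma cj_ginv: "cj (ginv x) g = ginv (cj x g)"
  by (simp add: cj_def mult.assoc)

lemma cj_cj: "cj (cj x g) h = cj x (g * h)"
  by (simp add: cj_def mult.assoc)

lemma cj_zp: "cj (zp x k) g = zp (cj x g) k"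
proof (induction k rule: int_induct[where k = 0])
  case base
  then show ?case by simp
next
  case (step1 i)
  then show ?case by (simp add: zp_add cj_mult)
next
  case (step2 i)
  then show ?case by (simp add: zp_diff cj_mult cj_ginv)
qed

lemma cj_eq_iff: "cj x g = y \<longleftrightarrow> x * g = g * y"
  by (metis cj_def mult.assoc grp_solve_left)

lemma cj_inj: "cj x g = cj y g \<longleftrightarrow> x = y"
  by (simp add: cj_def mult.assoc)

lemma commute_zp: "x * y = y * x \<Longrightarrow> zp x k * y = y * zp x k"
  by (metis cj_eq_iff cj_zp)

lemma commute_zp2: "x * y = y * x \<Longrightarrow> zp x j * zp y k = zp y k * zp x j"
  by (metis commute_zp)

lemma zp_mult_distrib:
  assumes "x * y = y * x"
  shows "zp (x * y) k = zp x k * zp y k"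
proof -
  have step: "zp x i * zp y i * (x * y) = zp x (i + 1) * zp y (i + 1)" for i
  proof -
    have "zp y i * x = x * zp y i" using assms commute_zp by metis
    then have "zp x i * zp y i * (x * y) = zp x i * x * (zp y i * y)"
      by (metis mult.assoc)
    then show ?thesis by (simp add: zp_add)
  qed
  show ?thesis
  proof (induction k rule: int_induct[where k = 0])
    case base
    then show ?case by simp
  next
    case (step1 i)
    then show ?case using step[of i] by (simp add: zp_add[of "x * y"])
  next
    case (step2 i)
    have "zp (x * y) (i - 1) * (x * y) = zp (x * y) i"
      using zp_Suc[of "x * y" "i - 1"] by simp
    then show ?case using step[of "i - 1"] step2 by (metis diff_add_cancel grp_right_cancel)
  qed
qed

lemma cj_zp_zp:
  assumes "cj x g = zp x a"
  shows "cj (zp x k) (g ^ n) = zp x (k * a ^ n)"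
proof (induction n)
  case 0
  then show ?case by simp
next
  case (Suc n)
  have "cj (zp x k) (g ^ Suc n) = cj (zp x (k * a ^ n)) g"
    using Suc by (metis cj_cj power_Suc2)
  also have "\<dots> = zp x (k * a ^ Suc n)"
    using assms by (metis cj_zp zp_mult mult.commute power_Suc mult.assoc)
  finally show ?case .
qed

lemma power_swap:
  assumes "cj x g = zp x a"
  shows "zp x k * g ^ n = g ^ n * zp x (k * a ^ n)"
  using cj_zp_zp[OF assms] by (simp add: cj_eq_iff)

section \<open>Relations between powers and finiteness of the orders\<close>

definition gc :: "'a::grp \<Rightarrow> 'a \<Rightarrow> 'a" where
  "gc x y = ginv x * ginv y * x * y"

text \<open>Stated for a pair of elements and not for the presented group: it is applied to the
  images in the quotients by the upper central series, and to the 2-components and odd components of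
  the generators.\<close>

definition mac :: "int \<Rightarrow> int \<Rightarrow> 'a::grp \<Rightarrow> 'a \<Rightarrow> bool" where
  "mac \<alpha> \<beta> A B \<longleftrightarrow> cj A (gc A B) = zp A \<alpha> \<and> cj B (gc B A) = zp B \<beta>"

definition geo :: "int \<Rightarrow> nat \<Rightarrow> int" where
  "geo x n = (\<Sum>i<n. x ^ i)"

text \<open>The exponent that measures the failure of \<open>[A\<^sup>k, B] = C\<^sup>k\<close>, see \<open>mac_comm_powA\<close>.\<close>

definition hex :: "int \<Rightarrow> nat \<Rightarrow> int" where
  "hex x n = int n * x ^ n - x * geo x n"

lemma geo_Suc: "geo x (Suc n) = geo x n + x ^ n"
  by (simp add: geo_def)

lemma geo_Suc': "geo x (Suc n) = 1 + x * geo x n"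
  unfolding geo_def by (subst sum.lessThan_Suc_shift) (simp add: sum_distrib_left)

lemma geo_0 [simp]: "geo x 0 = 0"
  by (simp add: geo_def)

lemma geo_mult: "(x - 1) * geo x n = x ^ n - 1"
  by (induction n) (simp_all add: geo_Suc algebra_simps)

lemma ginv_gc: "ginv (gc x y) = gc y x"
  by (simp add: gc_def mult.assoc)

lemma mac_sym: "mac \<alpha> \<beta> A B \<Longrightarrow> mac \<beta> \<alpha> B A"
  by (simp add: mac_def)

lemma cj_gc: "cj x y = x * gc x y"
  by (simp add: cj_def gc_def mult.assoc)

lemma gc_eq_one_iff: "gc x y = 1 \<longleftrightarrow> x * y = y * x"
  by (metis cj_eq_iff cj_gc mult_1_right grp_left_cancel)

lemma commute_power: "x * y = y * x \<Longrightarrow> x ^ n * y = y * x ^ n" for x :: "'a::grp"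
  by (metis power_commuting_commutes)

lemma commute_ginv: "x * y = y * x \<Longrightarrow> ginv x * y = y * ginv x" for x :: "'a::grp"
  by (metis commute_zp zp_minus1)

lemma commute_mult: "x * z = z * x \<Longrightarrow> y * z = z * y \<Longrightarrow> x * y * z = z * (x * y)" for x :: "'a::grp"
  by (metis mult.assoc)

lemma commute_gc: "x * z = z * x \<Longrightarrow> y * z = z * y \<Longrightarrow> gc x y * z = z * gc x y"
  unfolding gc_def by (intro commute_mult commute_ginv)

text \<open>\<open>B\<close> conjugates \<open>A\<close> to \<open>A * C\<close>, so the left side
  is a power of \<open>A * C\<close>. Each \<open>A\<close> that moves to the right past a
  \<open>C\<close> has its exponent multiplied by \<open>\<alpha>\<close>; the collected exponents
  add up to \<open>\<alpha> + ... + \<alpha> ^ k\<close>.\<close>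

lemma mac_pow_cj:
  assumes "mac \<alpha> \<beta> A B"
  shows "cj (A ^ k) B = gc A B ^ k * zp A (\<alpha> * geo \<alpha> k)"
proof -
  define C where "C = gc A B"
  have c: "cj A C = zp A \<alpha>" using assms by (simp add: mac_def C_def)
  have AC: "A * C = C * zp A \<alpha>" using c by (simp add: cj_eq_iff)
  have "(A * C) ^ k = C ^ k * zp A (\<alpha> * geo \<alpha> k)"
  proof (induction k)
    case (Suc k)
    have "(A * C) ^ Suc k = C ^ k * (zp A (\<alpha> * geo \<alpha> k) * C) * zp A \<alpha>"
      using Suc AC by (simp add: power_Suc2 mult.assoc del: power_Suc)
    also have "zp A (\<alpha> * geo \<alpha> k) * C = C * zp A (\<alpha> * geo \<alpha> k * \<alpha>)"
      using power_swap[OF c, of _ 1] by simp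
    finally have "(A * C) ^ Suc k = C ^ Suc k * zp A (\<alpha> * geo \<alpha> k * \<alpha> + \<alpha>)"
      by (simp add: power_Suc2 mult.assoc zp_add del: power_Suc)
    then show ?case by (simp add: geo_Suc' algebra_simps)
  qed simp
  moreover have "cj (A ^ k) B = (A * C) ^ k"
    using cj_zp[of A "int k" B] by (simp add: zp_of_nat cj_gc C_def)
  ultimately show ?thesis by (simp add: C_def)
qed

lemma mac_swapA:
  assumes "mac \<alpha> \<beta> A B"
  shows "zp A k * gc A B ^ n = gc A B ^ n * zp A (k * \<alpha> ^ n)"
  using assms by (intro power_swap) (simp add: mac_def)

text \<open>The second relation is about \<open>gc B A\<close>, the inverse of
  \<open>gc A B\<close>. Hence powers of \<open>B\<close> collect on the left of \<open>C\<close>,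
  whereas those of \<open>A\<close> collect on the right, and neither move needs an inverse of
  \<open>\<alpha>\<close> or \<open>\<beta>\<close>.\<close>

lemma mac_swapB:
  assumes "mac \<alpha> \<beta> A B"
  shows "gc A B ^ n * zp B k = zp B (k * \<beta> ^ n) * gc A B ^ n"
proof -
  have "zp B k * gc B A ^ n = gc B A ^ n * zp B (k * \<beta> ^ n)"
    using mac_swapA[OF mac_sym[OF assms]] .
  moreover have "gc B A ^ n = ginv (gc A B ^ n)"
    by (simp add: ginv_gc flip: power_ginv)
  ultimately have e: "zp B k * ginv (gc A B ^ n) = ginv (gc A B ^ n) * zp B (k * \<beta> ^ n)"
    by simp
  have "gc A B ^ n * zp B k = gc A B ^ n * (zp B k * ginv (gc A B ^ n)) * gc A B ^ n"
    by (simp add: mult.assoc)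
  also have "\<dots> = zp B (k * \<beta> ^ n) * gc A B ^ n"
    by (simp add: e mult.assoc)
  finally show ?thesis .
qed

lemma mac_comm_powA:
  assumes "mac \<alpha> \<beta> A B"
  shows "gc (A ^ k) B = gc A B ^ k * zp A (- hex \<alpha> k)"
proof -
  have "A ^ k * gc (A ^ k) B = gc A B ^ k * zp A (\<alpha> * geo \<alpha> k)"
    using mac_pow_cj[OF assms] by (simp add: cj_gc)
  then have "gc (A ^ k) B = zp A (- int k) * (gc A B ^ k * zp A (\<alpha> * geo \<alpha> k))"
    by (metis zp_of_nat zp_minus ginv_cancel_left)
  also have "\<dots> = gc A B ^ k * (zp A (- int k * \<alpha> ^ k) * zp A (\<alpha> * geo \<alpha> k))"
    by (metis mac_swapA[OF assms] mult.assoc)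
  finally show ?thesis
    by (simp add: hex_def flip: zp_add)
qed

lemma mac_comm_powB:
  assumes "mac \<alpha> \<beta> A B"
  shows "gc A (B ^ k) = zp B (hex \<beta> k) * gc A B ^ k"
proof -
  have "gc (B ^ k) A = gc B A ^ k * zp B (- hex \<beta> k)"
    using mac_comm_powA[OF mac_sym[OF assms]] .
  then have "ginv (gc (B ^ k) A) = ginv (zp B (- hex \<beta> k)) * ginv (gc B A ^ k)"
    by simp
  then show ?thesis
    by (simp add: ginv_gc flip: zp_minus power_ginv)
qed

text \<open>The basic relation: evaluate the conjugate of \<open>A\<close> by \<open>B ^ (\<beta> ^ e) = C ^ e * B * C ^ - e\<close> in two ways.\<close>

lemma mac_key:
  assumes mac: "mac \<alpha> \<beta> A B" and p: "int \<kappa> = \<alpha> ^ e" and q: "int k = \<beta> ^ e"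
  shows "gc A B ^ (\<kappa> + e) * zp A (\<alpha> * geo \<alpha> \<kappa> - \<alpha> ^ (\<kappa> + e)) = zp B (hex \<beta> k) * gc A B ^ (k + e)"
proof -
  define C where "C = gc A B"
  have "C ^ e * zp B 1 = zp B (\<beta> ^ e) * C ^ e"
    using mac_swapB[OF mac, of e 1] by (simp add: C_def)
  then have "zp B (\<beta> ^ e) = C ^ e * B * ginv (C ^ e)"
    by (metis grp_solve_right zp_1)
  then have Bk: "B ^ k = C ^ e * B * ginv (C ^ e)"
    by (simp flip: q add: zp_of_nat)
  have "cj A (C ^ e) = zp A (\<alpha> ^ e)"
    using mac_swapA[OF mac, of 1 e] by (simp add: cj_eq_iff C_def)
  then have "cj A (C ^ e) = A ^ \<kappa>"
    by (simp flip: p add: zp_of_nat)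
  then have "cj A (B ^ k) = cj (cj (A ^ \<kappa>) B) (ginv (C ^ e))"
    by (simp add: Bk flip: cj_cj)
  also have "\<dots> = C ^ e * (C ^ \<kappa> * zp A (\<alpha> * geo \<alpha> \<kappa>)) * ginv (C ^ e)"
    unfolding mac_pow_cj[OF mac] C_def by (simp add: cj_def)
  finally have "A * gc A (B ^ k) * C ^ e = C ^ e * (C ^ \<kappa> * zp A (\<alpha> * geo \<alpha> \<kappa>))"
    by (simp add: cj_gc grp_solve_right)
  then have "A * (zp B (hex \<beta> k) * C ^ (k + e)) = C ^ (\<kappa> + e) * zp A (\<alpha> * geo \<alpha> \<kappa>)"
    by (simp add: mac_comm_powB[OF mac, folded C_def] power_add mult.assoc add.commute[of \<kappa>])
  then have "zp B (hex \<beta> k) * C ^ (k + e) = zp A (-1) * C ^ (\<kappa> + e) * zp A (\<alpha> * geo \<alpha> \<kappa>)"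
    by (simp add: mult.assoc grp_solve_left)
  also have "zp A (-1) * C ^ (\<kappa> + e) = C ^ (\<kappa> + e) * zp A (- (\<alpha> ^ (\<kappa> + e)))"
    using mac_swapA[OF mac, of "-1" "\<kappa> + e"] by (simp add: C_def del: zp_minus1)
  finally show ?thesis
    by (simp add: C_def mult.assoc flip: zp_add)
qed

text \<open>Comparing the relation \<open>C ^ p * A ^ y = B ^ h * C ^ q\<close> with its conjugate by \<open>C\<close> eliminates \<open>C\<close>: a power
  of \<open>A\<close> equals a power of \<open>B\<close>, which is then central.\<close>

lemma mac_central_torsion:
  assumes mac: "mac \<alpha> \<beta> A B" and eq: "gc A B ^ p * zp A y = zp B h * gc A B ^ q"
  shows "zp A (y * (\<alpha> - 1)\<^sup>2) = 1" "zp B (h * (\<beta> - 1)\<^sup>2) = 1"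
proof -
  define C where "C = gc A B"
  note eq = eq[folded C_def]
  note sA = mac_swapA[OF mac, folded C_def] and sB = mac_swapB[OF mac, folded C_def]
  define Q where "Q = q + 1"
  \<comment> \<open>The relation is multiplied by \<open>C\<close> on the right here and on the left
    in \<open>2\<close>. Both results contain the same powers of \<open>C\<close>, so their quotient
    shows a power of \<open>A\<close> as a conjugate of a power of \<open>B\<close>.\<close>
  have 1: "C ^ (p + 1) * zp A (y * \<alpha>) = zp B h * C ^ Q"
  proof -
    have "C ^ (p + 1) * zp A (y * \<alpha>) = C ^ p * (C ^ 1 * zp A (y * \<alpha> ^ 1))"
      by (simp add: power_Suc2 mult.assoc del: power_Suc)
    also have "\<dots> = zp B h * C ^ q * C"
      by (simp only: sA[symmetric]) (simp flip: eq add: mult.assoc)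
    finally show ?thesis by (simp add: Q_def power_Suc2 mult.assoc del: power_Suc)
  qed
  have 2: "C ^ (p + 1) * zp A y = zp B (h * \<beta>) * C ^ Q"
  proof -
    have "C ^ (p + 1) * zp A y = C * (zp B h * C ^ q)"
      by (simp add: mult.assoc flip: eq)
    also have "\<dots> = zp B (h * \<beta>) * C * C ^ q"
      using sB[of 1 h] by (simp flip: mult.assoc)
    finally show ?thesis by (simp add: Q_def mult.assoc)
  qed
  have "zp A (y * (\<alpha> - 1)) = ginv (C ^ (p + 1) * zp A y) * (C ^ (p + 1) * zp A (y * \<alpha>))"
    by (simp add: right_diff_distrib zp_diff mult.assoc) (metis zp_minus zp_commute)
  also have "\<dots> = ginv (C ^ Q) * (ginv (zp B (h * \<beta>)) * zp B h) * C ^ Q"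
    by (simp only: 1 2 ginv_mult mult.assoc)
  also have "ginv (zp B (h * \<beta>)) * zp B h = zp B (- (h * (\<beta> - 1)))"
    by (simp add: algebra_simps flip: zp_minus zp_add)
  finally have W: "cj (zp B (- (h * (\<beta> - 1)))) (C ^ Q) = zp A (y * (\<alpha> - 1))"
    by (simp add: cj_def)
  define W where "W = zp B (- (h * (\<beta> - 1)))"
  have WB: "W * B = B * W"
    by (simp add: W_def commute_zp)
  \<comment> \<open>After conjugation by \<open>C ^ Q\<close> both \<open>W\<close> and
    \<open>A\<close> become powers of \<open>A\<close>, which commute; hence so do \<open>W\<close>
    and \<open>A\<close>. Being a power of \<open>B\<close> as well, \<open>W\<close> is
    central.\<close>
  have "cj A (C ^ Q) = zp A (\<alpha> ^ Q)"
    using sA[of 1 Q] by (simp add: cj_eq_iff)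
  then have "cj (W * A) (C ^ Q) = cj (A * W) (C ^ Q)"
    by (simp add: cj_mult W[folded W_def] zp_commute)
  then have WA: "W * A = A * W"
    by (simp add: cj_inj)
  have CW: "C * W = W * C"
    using commute_gc[of A W B] WA WB by (simp add: C_def)
  then have "W * C ^ Q = C ^ Q * W"
    by (metis commute_power)
  then have W2: "W = zp A (y * (\<alpha> - 1))"
    using W[folded W_def] by (metis cj_eq_iff grp_left_cancel)
  \<comment> \<open>\<open>C\<close> fixes the central element \<open>W\<close>, but also raises it,
    a power of \<open>A\<close>, to the power \<open>\<alpha>\<close>: this is the second factor
    \<open>\<alpha> - 1\<close>.\<close>
  have "zp A (y * (\<alpha> - 1)) * C ^ 1 = C ^ 1 * zp A (y * (\<alpha> - 1) * \<alpha> ^ 1)"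
    by (rule sA)
  then have "W = zp A (y * (\<alpha> - 1) * \<alpha>)"
    using CW W2 by (metis grp_left_cancel power_one_right)
  then have "zp A (y * (\<alpha> - 1) * \<alpha> - y * (\<alpha> - 1)) = 1"
    using W2 by (simp add: zp_diff)
  then show "zp A (y * (\<alpha> - 1)\<^sup>2) = 1"
    by (simp add: algebra_simps power2_eq_square)
  have "C ^ 1 * zp B (- (h * (\<beta> - 1))) = zp B (- (h * (\<beta> - 1)) * \<beta> ^ 1) * C ^ 1"
    by (rule sB)
  then have "W = zp B (- (h * (\<beta> - 1)) * \<beta>)"
    using CW unfolding W_def by (metis grp_right_cancel power_one_right)
  then have "zp B (- (h * (\<beta> - 1)) - - (h * (\<beta> - 1)) * \<beta>) = 1"
    unfolding W_def zp_diff by simp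
  then show "zp B (h * (\<beta> - 1)\<^sup>2) = 1"
    by (simp add: algebra_simps power2_eq_square)
qed

text \<open>A congruence modulo \<open>x ^ 2\<close> is enough to see, for either sign of
  \<open>x\<close>, that the torsion exponents in \<open>mac_finite_order\<close> are
  nonzero.\<close>

lemma geo_mod_square: "2 \<le> n \<Longrightarrow> \<exists>c. x * geo x n = x + x\<^sup>2 * c"
proof -
  assume "2 \<le> n"
  then obtain k where "n = Suc (Suc k)" by (metis Suc_le_D numeral_2_eq_2 Suc_le_mono)
  then have "x * geo x n = x + x\<^sup>2 * (1 + x * geo x k)"
    by (simp add: geo_Suc' algebra_simps power2_eq_square)
  then show ?thesis by blast
qed

lemma square_times_unit: "\<bar>x\<bar> \<ge> 2 \<Longrightarrow> x + x\<^sup>2 * c \<noteq> (0::int)"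
proof
  assume a: "\<bar>x\<bar> \<ge> 2" and "x + x\<^sup>2 * c = 0"
  then have "x * (1 + x * c) = 0" by (simp add: algebra_simps power2_eq_square)
  then have "x * (- c) = 1" using a by auto
  then have "x dvd 1" by (metis dvd_triv_left)
  then show False using a by auto
qed

lemma zp_finite_order: "zp x k = 1 \<Longrightarrow> k \<noteq> 0 \<Longrightarrow> x ^ nat \<bar>k\<bar> = 1"
  by (metis abs_ge_zero abs_if ginv_one int_nat_eq nat_0_le zp_minus zp_of_nat)

lemma mac_finite_order:
  assumes mac: "mac \<alpha> \<beta> A B" and a: "\<bar>\<alpha>\<bar> \<ge> 2" and b: "\<bar>\<beta>\<bar> \<ge> 2"
  obtains n where "n > 0" "A ^ n = 1" "B ^ n = 1"
proof -
  \<comment> \<open>\<open>e = 2\<close> rather than \<open>e = 1\<close>, since \<open>\<alpha>\<close> and \<open>\<beta>\<close> may be negative\<close>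
  define \<kappa> where "\<kappa> = nat (\<alpha>\<^sup>2)"
  define k where "k = nat (\<beta>\<^sup>2)"
  have \<kappa>: "int \<kappa> = \<alpha>\<^sup>2" and k: "int k = \<beta>\<^sup>2" by (simp_all add: \<kappa>_def k_def)
  define y where "y = \<alpha> * geo \<alpha> \<kappa> - \<alpha> ^ (\<kappa> + 2)"
  have sq: "2\<^sup>2 \<le> \<bar>z\<bar>\<^sup>2" if "2 \<le> \<bar>z\<bar>" for z :: int
    using that by (intro power_mono) auto
  have "2 \<le> \<kappa>" "2 \<le> k"
    using sq[OF a] sq[OF b] \<kappa> k by auto
  then obtain c d where c: "\<alpha> * geo \<alpha> \<kappa> = \<alpha> + \<alpha>\<^sup>2 * c" and d: "\<beta> * geo \<beta> k = \<beta> + \<beta>\<^sup>2 * d"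
    using geo_mod_square by metis
  have "y = \<alpha> + \<alpha>\<^sup>2 * (c - \<alpha> ^ \<kappa>)"
    by (simp add: y_def c power_add algebra_simps power2_eq_square)
  then have "y \<noteq> 0" using square_times_unit[OF a] by metis
  have "hex \<beta> k = - (\<beta> + \<beta>\<^sup>2 * (d - \<beta> ^ k))"
    by (simp add: hex_def d k power_add algebra_simps power2_eq_square)
  then have "hex \<beta> k \<noteq> 0" using square_times_unit[OF b] by (metis neg_equal_0_iff_equal)
  have t: "zp A (y * (\<alpha> - 1)\<^sup>2) = 1" "zp B (hex \<beta> k * (\<beta> - 1)\<^sup>2) = 1"
    using mac_central_torsion[OF mac mac_key[OF mac \<kappa> k]] by (simp_all add: y_def)
  define i where "i = nat \<bar>y * (\<alpha> - 1)\<^sup>2\<bar>"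
  define j where "j = nat \<bar>hex \<beta> k * (\<beta> - 1)\<^sup>2\<bar>"
  have nz: "y * (\<alpha> - 1)\<^sup>2 \<noteq> 0" "hex \<beta> k * (\<beta> - 1)\<^sup>2 \<noteq> 0"
    using \<open>y \<noteq> 0\<close> \<open>hex \<beta> k \<noteq> 0\<close> a b by auto
  have "A ^ i = 1" "B ^ j = 1" unfolding i_def j_def
    using zp_finite_order[OF t(1) nz(1)] zp_finite_order[OF t(2) nz(2)] by auto
  then have "A ^ (i * j) = 1" "B ^ (i * j) = 1"
    by (metis power_mult power_one mult.commute)+
  moreover have "i * j > 0" using nz by (simp add: i_def j_def)
  ultimately show thesis using that by blast
qed

section \<open>Divisibility of geometric sums\<close>

lemma geo_add: "geo x (m + n) = geo x m + x ^ m * geo x n"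
  by (induction n) (simp_all add: geo_Suc algebra_simps power_add)

lemma geo_times: "geo x (m * n) = geo x m * geo (x ^ m) n"
proof (induction n)
  case (Suc n)
  have "geo x (m * Suc n) = geo x (m * n) + x ^ (m * n) * geo x m"
    using geo_add[of x "m * n" m] by (simp add: add.commute)
  then show ?case using Suc by (simp add: geo_Suc algebra_simps power_mult)
qed simp

lemma dvd_power_minus_one: "(d::int) dvd x - 1 \<Longrightarrow> d dvd x ^ n - 1"
  by (metis dvd_mult2 geo_mult)

lemma dvd_geo_diff: "d dvd x - 1 \<Longrightarrow> d dvd geo x n - int n"
proof (induction n)
  case (Suc n)
  have "geo x (Suc n) - int (Suc n) = (geo x n - int n) + (x ^ n - 1)"
    by (simp add: geo_Suc)
  then show ?case using Suc dvd_power_minus_one by (metis dvd_add)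
qed simp

text \<open>Lifting the exponent: by \<open>geo_times\<close> every factor \<open>p\<close> of
  \<open>r\<close> splits off a factor of the form \<open>geo y p\<close>, which is congruent to
  \<open>p\<close>, hence to 0, modulo \<open>p\<close>.\<close>

lemma prime_power_dvd_geo:
  assumes "int p dvd x - 1" "p ^ e dvd r"
  shows "int (p ^ e) dvd geo x r"
  using assms
proof (induction e arbitrary: x r)
  case (Suc e)
  then obtain c where "r = p ^ Suc e * c" by (elim dvdE)
  then have r: "r = p * (p ^ e * c)" by (simp add: mult.assoc)
  define s where "s = p ^ e * c"
  have s: "p ^ e dvd s" and r: "r = p * s" by (simp_all add: s_def r)
  have "int p dvd geo x p"
    using dvd_geo_diff[OF Suc.prems(1), of p] by (metis diff_add_cancel dvd_add dvd_refl)
  moreover have "int (p ^ e) dvd geo (x ^ p) s"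
    using Suc.IH[OF dvd_power_minus_one[OF Suc.prems(1)] s] .
  ultimately show ?case
    unfolding r geo_times by (simp add: mult_dvd_mono)
qed simp

lemma prime_power_dvd_power_minus_one:
  assumes "int p dvd x - 1" "p ^ e dvd r"
  shows "int (p ^ Suc e) dvd x ^ r - 1"
  using mult_dvd_mono[OF assms(1) prime_power_dvd_geo[OF assms]] by (simp add: geo_mult)

lemma dvd_power_mod_square: "d dvd x - 1 \<Longrightarrow> (d::int)\<^sup>2 dvd x ^ n - 1 - int n * (x - 1)"
proof (induction n)
  case (Suc n)
  have "x ^ Suc n - 1 - int (Suc n) * (x - 1)
      = (x ^ n - 1 - int n * (x - 1)) + (x ^ n - 1) * (x - 1)"
    by (simp add: algebra_simps)
  moreover have "d\<^sup>2 dvd (x ^ n - 1) * (x - 1)"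
    using Suc.prems by (simp add: power2_eq_square dvd_power_minus_one mult_dvd_mono)
  ultimately show ?case using Suc by (metis dvd_add)
qed simp

text \<open>Summing \<open>dvd_power_mod_square\<close> over the terms gives the second-order
  coefficient, a triangular number.\<close>

lemma geo_mod_square':
  assumes "d dvd x - 1"
  shows "d\<^sup>2 dvd geo x n - int n - int (n * (n - 1) div 2) * (x - 1)"
proof (induction n)
  case (Suc n)
  have "Suc n * (Suc n - 1) div 2 = n * (n - 1) div 2 + n"
    by (cases n) simp_all
  then have "geo x (Suc n) - int (Suc n) - int (Suc n * (Suc n - 1) div 2) * (x - 1)
    = (geo x n - int n - int (n * (n - 1) div 2) * (x - 1)) + (x ^ n - 1 - int n * (x - 1))"
    by (simp add: geo_Suc algebra_simps)
  then show ?case using Suc dvd_power_mod_square[OF assms, of n] by (metis dvd_add)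
qed simp

text \<open>For odd \<open>p\<close> the triangular number is itself divisible by \<open>p\<close>,
  so the second-order term vanishes modulo \<open>p ^ 2\<close>. For \<open>p = 2\<close> it is 1,
  whence the condition modulo 4.\<close>

lemma geo_prime_mod_square:
  assumes "Factorial_Ring.prime p" "int p dvd x - 1" "p = 2 \<Longrightarrow> 4 dvd x - 1"
  shows "(int p)\<^sup>2 dvd geo x p - int p"
proof (cases "p = 2")
  case True
  then show ?thesis using assms(3) by (simp add: geo_def numeral_2_eq_2)
next
  case False
  then have "odd p" using assms(1) primes_dvd_imp_eq two_is_prime_nat by blast
  then obtain k where k: "p = 2 * k + 1" by (auto elim: oddE)
  have "(int p)\<^sup>2 dvd geo x p - int p - int (p * (p - 1) div 2) * (x - 1)"
    by (rule geo_mod_square'[OF assms(2)])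
  moreover have "p * (p - 1) div 2 = p * k"
    using k by simp
  ultimately have "(int p)\<^sup>2 dvd geo x p - int p - int p * int k * (x - 1)"
    by (metis of_nat_mult)
  moreover have "(int p)\<^sup>2 dvd int p * int k * (x - 1)"
    unfolding power2_eq_square using assms(2) by (intro mult_dvd_mono) auto
  ultimately show ?thesis by (metis diff_add_cancel dvd_add)
qed

lemma prime_power_dvd_geo_diff:
  assumes "Factorial_Ring.prime p" "int p dvd x - 1" "p = 2 \<Longrightarrow> 4 dvd x - 1" "p ^ e dvd r"
  shows "int (p ^ Suc e) dvd geo x r - int r"
  using assms(2-4)
proof (induction e arbitrary: x r)
  case 0
  then show ?case using dvd_geo_diff by simp
next
  case (Suc e)
  then obtain c where "r = p ^ Suc e * c" by (elim dvdE)
  then have r: "r = p * (p ^ e * c)" by (simp add: mult.assoc)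
  define s where "s = p ^ e * c"
  have s: "p ^ e dvd s" and r: "r = p * s" by (simp_all add: s_def r)
  obtain u where u: "geo x p = int p + (int p)\<^sup>2 * u"
    using geo_prime_mod_square[OF assms(1) Suc.prems(1,2)] by (metis dvd_def diff_eq_eq add.commute)
  have "int (p ^ Suc e) dvd geo (x ^ p) s - int s"
    using Suc.IH[OF dvd_power_minus_one[OF Suc.prems(1)] _ s] Suc.prems(2) dvd_power_minus_one by blast
  then obtain v where v: "geo (x ^ p) s = int s + int (p ^ Suc e) * v"
    by (metis dvd_def diff_eq_eq add.commute)
  obtain w where w: "s = p ^ e * w" using s by (auto simp: dvd_def)
  have "geo x r - int r = int (p ^ Suc (Suc e)) * (int w * u + v + int p * u * v)"
    unfolding r geo_times u v by (simp add: w algebra_simps power2_eq_square)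
  then show ?case by simp
qed

text \<open>Both terms of \<open>hex x r\<close> are \<open>r\<close> to first order and cancel.
  This gains one factor \<open>p\<close> over the power that divides \<open>r\<close>, which is what
  makes proper powers of \<open>A\<close> or \<open>B\<close> central in \<open>no_bad_prime\<close>
  and \<open>order_eq_comm_order\<close>.\<close>

lemma prime_power_dvd_hex:
  assumes "Factorial_Ring.prime p" "int p dvd x - 1" "p = 2 \<Longrightarrow> 4 dvd x - 1" "p ^ e dvd r"
  shows "int (p ^ Suc e) dvd hex x r"
proof -
  have "hex x r = int r * (x ^ r - 1) - x * (geo x r - int r) - int r * (x - 1)"
    by (simp add: hex_def algebra_simps)
  moreover have "int (p ^ Suc e) dvd int r * (x - 1)"
    using assms(2,4) by (metis mult_dvd_mono of_nat_dvd_iff power_Suc2 of_nat_mult)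
  ultimately show ?thesis
    using prime_power_dvd_geo_diff[OF assms] prime_power_dvd_power_minus_one[OF assms(2,4)]
    by (simp del: power_Suc of_nat_power)
qed

lemma dvd_if_prime_powers:
  assumes "i > (0::nat)" and "\<And>p e. Factorial_Ring.prime p \<Longrightarrow> p ^ e dvd i \<Longrightarrow> int (p ^ e) dvd N"
  shows "int i dvd N"
proof (cases "N = 0")
  case False
  have "i dvd nat \<bar>N\<bar>"
  proof (rule multiplicity_le_imp_dvd)
    show "i \<noteq> 0" using assms(1) by simp
    fix p :: nat assume p: "Factorial_Ring.prime p"
    have "p ^ multiplicity p i dvd nat \<bar>N\<bar>"
      using assms(2)[OF p multiplicity_dvd] by (simp add: nat_dvd_iff int_dvd_int_iff dvd_abs_iff flip: int_dvd_int_iff)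
    then show "multiplicity p i \<le> multiplicity p (nat \<bar>N\<bar>)"
      using False p by (intro multiplicity_geI) auto
  qed
  then show ?thesis by simp
qed simp

text \<open>\<open>geo x k\<close> is the quotient of \<open>x ^ k - 1\<close> by
  \<open>x - 1\<close>. At primes prime to \<open>x - 1\<close> divisibility is inherited from
  \<open>x ^ k - 1\<close>; at the others it is \<open>prime_power_dvd_geo\<close>.\<close>

lemma dvd_geoI:
  assumes "i > (0::nat)" "int i dvd x ^ k - 1"
    and "\<And>p e. Factorial_Ring.prime p \<Longrightarrow> p ^ e dvd i \<Longrightarrow> int p dvd x - 1 \<Longrightarrow> p ^ e dvd k"
  shows "int i dvd geo x k"
proof (rule dvd_if_prime_powers[OF assms(1)])
  fix p e :: nat assume p: "Factorial_Ring.prime p" "p ^ e dvd i"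
  show "int (p ^ e) dvd geo x k"
  proof (cases "int p dvd x - 1")
    case True
    then show ?thesis using prime_power_dvd_geo assms(3) p by blast
  next
    case False
    then have "coprime (int p) (x - 1)" using p by (simp add: prime_imp_coprime)
    then have "coprime (int (p ^ e)) (x - 1)" by simp
    moreover have "int (p ^ e) dvd (x - 1) * geo x k"
      using assms(2) p(2) by (metis geo_mult dvd_trans int_dvd_int_iff)
    ultimately show ?thesis using coprime_dvd_mult_right_iff by blast
  qed
qed

lemma euler_prime_power:
  assumes "Factorial_Ring.prime p" "coprime x (int p)" "p ^ (e - 1) * (p - 1) dvd r"
  shows "int (p ^ e) dvd x ^ r - 1"
proof (cases "e = 0")
  case False
  obtain k where k: "r = totient (p ^ e) * k"
    using assms False totient_prime_power[OF assms(1), of e] by (auto simp: dvd_def)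
  have p1: "p ^ e > 1"
    using False assms(1) by (metis one_less_power prime_gt_1_nat neq0_conv)
  define y where "y = nat (x mod int (p ^ e))"
  have y: "int y = x mod int (p ^ e)"
  proof -
    have "0 < int (p ^ e)" using p1 by linarith
    then show ?thesis unfolding y_def by (metis int_nat_eq pos_mod_sign)
  qed
  have "coprime x (int (p ^ e))" using assms(2) by simp
  then have "coprime (int y) (int (p ^ e))"
    unfolding y using coprime_mod_left_iff[of "int (p ^ e)" x] p1 by linarith
  then have "coprime y (p ^ e)" by (simp only: coprime_int_iff)
  then have "[y ^ totient (p ^ e) = 1] (mod p ^ e)" by (rule euler_theorem)
  then have "[int y ^ totient (p ^ e) = 1] (mod int (p ^ e))"
    by (metis cong_int_iff of_nat_1 of_nat_power)
  moreover have "[x = int y] (mod int (p ^ e))" by (simp add: y cong_def)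
  ultimately have "[x ^ totient (p ^ e) = 1] (mod int (p ^ e))"
    by (metis cong_pow cong_trans)
  then have "int (p ^ e) dvd x ^ totient (p ^ e) - 1"
    by (simp add: cong_iff_dvd_diff)
  then show ?thesis unfolding k power_mult by (rule dvd_power_minus_one)
qed simp

section \<open>Exact orders of single elements, with integer exponents\<close>

lemma finite_order_exists:
  fixes x :: "'a::grp"
  assumes "x ^ n = 1" "n > 0"
  obtains i where "i > 0" "\<And>k. zp x k = 1 \<longleftrightarrow> int i dvd k"
proof -
  define i where "i = (LEAST i. i > 0 \<and> x ^ i = 1)"
  have i: "i > 0" "x ^ i = 1"
    using LeastI[of "\<lambda>i. i > 0 \<and> x ^ i = 1" n] assms by (auto simp: i_def)
  have "int i dvd k" if "zp x k = 1" for k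
  proof -
    have "zp x (k mod int i) = zp x k * ginv (zp (zp x (int i)) (k div int i))"
      by (simp flip: zp_mult zp_diff add: minus_mult_div_eq_mod)
    also have "\<dots> = 1" using that i by (simp add: zp_of_nat)
    finally have "x ^ nat (k mod int i) = 1"
      using i by (simp add: zp_def)
    moreover have "nat (k mod int i) < i" using i by (simp add: nat_less_iff)
    ultimately have "nat (k mod int i) = 0"
      using not_less_Least[of "nat (k mod int i)" "\<lambda>i. i > 0 \<and> x ^ i = 1"] i_def by auto
    then show ?thesis using i by (metis dvd_eq_mod_eq_0 int_nat_eq nat_0_iff of_nat_0 pos_mod_sign of_nat_0_less_iff order_antisym)
  qed
  moreover have "zp x k = 1" if "int i dvd k" for k
    using that i by (auto simp: dvd_def zp_mult zp_of_nat)
  ultimately show thesis using that i(1) by blast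
qed

lemma zp_eq_iff:
  assumes "\<And>k. zp x k = 1 \<longleftrightarrow> int i dvd k"
  shows "zp x j = zp x k \<longleftrightarrow> int i dvd j - k"
proof -
  have "zp x (j - k) = 1 \<longleftrightarrow> zp x j = zp x k"
    unfolding zp_diff by (metis grp_solve_right ginv_ginv mult_1_left)
  then show ?thesis using assms by simp
qed

section \<open>Nontrivial central powers\<close>

text \<open>As \<open>A ^ i = 1\<close> commutes with \<open>B\<close>, \<open>mac_comm_powA\<close>
  makes \<open>C ^ i\<close> a power of \<open>A\<close>, so it commutes with \<open>A\<close>; but
  it also raises \<open>A\<close> to the power \<open>\<alpha> ^ i\<close>. The resulting congruence
  annihilates \<open>hex \<alpha> i\<close> modulo \<open>i\<close>.\<close>

lemma mac_comm_pow_order: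
  assumes mac: "mac \<alpha> \<beta> A B" and i: "i > 0" "\<And>k. zp A k = 1 \<longleftrightarrow> int i dvd k"
  shows "gc A B ^ i = 1" "int i dvd \<alpha> ^ i - 1"
proof -
  have Ai: "A ^ i = 1" using i(2)[of "int i"] by (simp add: zp_of_nat)
  have "gc (A ^ i) B = 1" unfolding Ai by (simp add: gc_def)
  then have "gc A B ^ i * zp A (- hex \<alpha> i) = 1"
    using mac_comm_powA[OF mac, of i] by simp
  then have Ci: "gc A B ^ i = zp A (hex \<alpha> i)"
    by (metis grp_solve_right mult_1_left zp_minus ginv_ginv)
  have "zp A 1 * gc A B ^ i = gc A B ^ i * zp A (1 * \<alpha> ^ i)"
    by (rule mac_swapA[OF mac])
  then have "zp A 1 = zp A (\<alpha> ^ i)"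
    unfolding Ci by (metis mult_1 zp_commute grp_left_cancel)
  then show d: "int i dvd \<alpha> ^ i - 1"
    using zp_eq_iff[OF i(2)] by metis
  have "int i dvd geo \<alpha> i"
    using i(1) d by (rule dvd_geoI)
  then have "int i dvd hex \<alpha> i" by (simp add: hex_def)
  then show "gc A B ^ i = 1" using Ci i(2) by simp
qed

lemma coprime_if_dvd_power_minus_one:
  assumes "int i dvd x ^ i - 1" "i > 0" "p dvd i"
  shows "coprime x (int p)"
proof (rule coprimeI)
  fix c assume c: "c dvd x" "c dvd int p"
  then have "c dvd x ^ i - 1" using assms by (meson dvd_trans int_dvd_int_iff)
  moreover have "c dvd x ^ i" using c(1) assms(2) by (meson dvd_power dvd_trans)
  ultimately have "c dvd x ^ i - (x ^ i - 1)" by (rule dvd_diff[rotated])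
  then show "is_unit c" by simp
qed

lemma prime_power_dvd_div:
  assumes "Factorial_Ring.prime p" "Factorial_Ring.prime q" "q dvd i" "p ^ e dvd i" "p \<noteq> q"
  shows "p ^ e dvd i div (q::nat)"
proof -
  have "coprime (p ^ e) q" using assms by (simp add: primes_coprime)
  moreover have "p ^ e dvd q * (i div q)" using assms by simp
  ultimately show ?thesis using coprime_dvd_mult_right_iff by blast
qed

lemma prime_power_pred_dvd_div:
  assumes "Factorial_Ring.prime q" "q dvd i" "q ^ e dvd i"
  shows "q ^ (e - 1) dvd i div (q::nat)"
proof (cases e)
  case 0
  then show ?thesis by simp
next
  case (Suc f)
  then have "q * q ^ f dvd q * (i div q)" using assms by simp
  then show ?thesis using Suc assms(1) by (metis diff_Suc_1 dvd_times_left_cancel_iff not_prime_0)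
qed

lemma pred_dvd_fact: "1 < p \<Longrightarrow> p \<le> q \<Longrightarrow> p - 1 dvd (fact (q - 1) :: nat)"
  by (intro dvd_fact) auto

text \<open>The exponent \<open>i div q\<close> has lost a factor \<open>q\<close>, but at every
  prime one factor fewer than in \<open>i\<close> is enough. If \<open>p\<close> divides
  \<open>\<alpha> - 1\<close>, that base supplies it; otherwise Euler's theorem applies, with
  \<open>p - 1\<close> contained in the factorial because \<open>p \<le> q\<close>.\<close>

lemma power_minus_one_dvd_of_bad_bound:
  assumes i: "i > 0" "int i dvd \<alpha> ^ i - 1"
    and q: "Factorial_Ring.prime q" "q dvd i"
    and max: "\<And>p. Factorial_Ring.prime p \<Longrightarrow> p dvd i \<Longrightarrow> \<not> int p dvd \<alpha> - 1 \<Longrightarrow> p \<le> q"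
    and r: "(i div q) * fact (q - 1) dvd r"
  shows "int i dvd \<alpha> ^ r - 1"
proof (rule dvd_if_prime_powers[OF i(1)])
  fix p e :: nat assume p: "Factorial_Ring.prime p" "p ^ e dvd i"
  have ir: "i div q dvd r" using r by (meson dvd_mult_left)
  have pe: "p ^ (e - 1) dvd i div q"
  proof (cases "p = q")
    case True
    then show ?thesis using prime_power_pred_dvd_div p q by metis
  next
    case False
    then have "p ^ e dvd i div q" using prime_power_dvd_div p q by metis
    then show ?thesis by (meson diff_le_self le_imp_power_dvd dvd_trans)
  qed
  show "int (p ^ e) dvd \<alpha> ^ r - 1"
  proof (cases "e = 0 \<or> int p dvd \<alpha> - 1")
    case True
    have "int (p ^ Suc (e - 1)) dvd \<alpha> ^ r - 1" if "e \<noteq> 0"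
      using True that pe ir by (intro prime_power_dvd_power_minus_one) (auto intro: dvd_trans)
    then show ?thesis by (cases "e = 0") auto
  next
    case False
    then have pi: "p dvd i" using p(2) by (meson dvd_power dvd_trans neq0_conv)
    then have "p \<le> q" using max p(1) False by blast
    then have "p - 1 dvd fact (q - 1)"
      using pred_dvd_fact p(1) prime_gt_1_nat by blast
    then have "p ^ (e - 1) * (p - 1) dvd r"
      using pe r by (meson mult_dvd_mono dvd_trans)
    then show ?thesis
      using euler_prime_power[OF p(1) coprime_if_dvd_power_minus_one[OF i(2,1) pi]] by blast
  qed
qed

text \<open>Since \<open>q\<close> does not divide \<open>\<alpha> - 1\<close>, the missing factor
  \<open>q\<close> does not disturb the divisibility of \<open>geo \<alpha> r\<close> by
  \<open>i\<close>. So \<open>hex \<alpha> r\<close> is \<open>r\<close> modulo \<open>i\<close>,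
  the commutator of \<open>A ^ r\<close> and \<open>B\<close> is \<open>C ^ r\<close> times the
  inverse of \<open>A ^ r\<close>, and \<open>C ^ r\<close> commutes with \<open>A\<close>.\<close>

lemma bad_prime_conjugate:
  assumes mac: "mac \<alpha> \<beta> A B" and i: "i > 0" "\<And>k. zp A k = 1 \<longleftrightarrow> int i dvd k"
    and q: "Factorial_Ring.prime q" "q dvd i" "\<not> int q dvd \<alpha> - 1"
    and max: "\<And>p. Factorial_Ring.prime p \<Longrightarrow> p dvd i \<Longrightarrow> \<not> int p dvd \<alpha> - 1 \<Longrightarrow> p \<le> q"
    and r: "(i div q) * fact (q - 1) dvd r"
  shows "cj (A ^ r) B = gc A B ^ r"
proof -
  have d: "int i dvd \<alpha> ^ r - 1"
    using power_minus_one_dvd_of_bad_bound[OF i(1) mac_comm_pow_order(2)[OF mac i] q(1,2) max r] .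
  have ir: "i div q dvd r" using r by (meson dvd_mult_left)
  have "int i dvd geo \<alpha> r"
    using i(1) d
  proof (rule dvd_geoI)
    fix p e :: nat assume p: "Factorial_Ring.prime p" "p ^ e dvd i" "int p dvd \<alpha> - 1"
    then have "p \<noteq> q" using q by auto
    then show "p ^ e dvd r" using prime_power_dvd_div p q ir dvd_trans by metis
  qed
  then have "int i dvd int r * (\<alpha> ^ r - 1) - \<alpha> * geo \<alpha> r"
    using d by simp
  moreover have "hex \<alpha> r - int r = int r * (\<alpha> ^ r - 1) - \<alpha> * geo \<alpha> r"
    by (simp add: hex_def algebra_simps)
  ultimately have "zp A (hex \<alpha> r) = zp A (int r)"
    using zp_eq_iff[OF i(2)] by metis
  then have g: "gc (A ^ r) B = gc A B ^ r * ginv (A ^ r)"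
    using mac_comm_powA[OF mac, of r] by (simp add: zp_minus zp_of_nat)
  have "zp A 1 = zp A (\<alpha> ^ r)"
    using d zp_eq_iff[OF i(2), of "\<alpha> ^ r" 1] by simp
  then have "A * gc A B ^ r = gc A B ^ r * A"
    using mac_swapA[OF mac, of 1 r] by simp
  then have "A ^ r * gc A B ^ r = gc A B ^ r * A ^ r"
    by (rule commute_power)
  then show ?thesis
    by (metis cj_gc g mult.assoc ginv_right mult_1_right)
qed

lemma prime_part:
  assumes "(i::nat) > 0" "Factorial_Ring.prime q"
  obtains v i' where "i = q ^ v * i'" "\<not> q dvd i'"
  by (metis assms multiplicity_decompose' not_prime_unit neq0_conv)

lemma prime_not_dvd_fact: "Factorial_Ring.prime (q::nat) \<Longrightarrow> \<not> q dvd fact (q - 1)"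
  by (metis prime_dvd_fact_iff prime_gt_0_nat diff_less not_le zero_less_one)

text \<open>With \<open>q\<close> maximal among the primes dividing the orders of \<open>A\<close>, \<open>B\<close> but not \<open>\<alpha> - 1\<close>, \<open>\<beta> - 1\<close> respectively, a
  suitable power \<open>E = A ^ r\<close> of order \<open>q\<close> is conjugate under \<open>B\<close> to \<open>C ^ r\<close>, which commutes with \<open>B\<close>. Hence
  \<open>E = C ^ r\<close> commutes with \<open>C\<close>, although \<open>C\<close> acts on \<open>E\<close> by the exponent \<open>\<alpha>\<close>. The factor \<open>(q - 1)!\<close> of \<open>r\<close> is
  prime to \<open>q\<close> and divisible by \<open>p - 1\<close> for every prime \<open>p \<le> q\<close>.\<close>

lemma no_bad_prime:
  assumes mac: "mac \<alpha> \<beta> A B"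
    and i: "i > 0" "\<And>k. zp A k = 1 \<longleftrightarrow> int i dvd k"
    and j: "j > 0" "\<And>k. zp B k = 1 \<longleftrightarrow> int j dvd k"
    and q: "Factorial_Ring.prime q" "q dvd i" "\<not> int q dvd \<alpha> - 1"
    and maxA: "\<And>p. Factorial_Ring.prime p \<Longrightarrow> p dvd i \<Longrightarrow> \<not> int p dvd \<alpha> - 1 \<Longrightarrow> p \<le> q"
    and maxB: "\<And>p. Factorial_Ring.prime p \<Longrightarrow> p dvd j \<Longrightarrow> \<not> int p dvd \<beta> - 1 \<Longrightarrow> p \<le> q"
    and four: "4 dvd \<beta> - 1"
    and ncB: "\<And>k. B ^ k * A = A * B ^ k \<Longrightarrow> B ^ k = 1"
  shows False
proof -
  define C where "C = gc A B"
  have Ci: "C ^ i = 1" and Cj: "C ^ j = 1"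
  proof -
    show "C ^ i = 1" using mac_comm_pow_order(1)[OF mac i] by (simp add: C_def)
    have "gc B A ^ j = 1" using mac_comm_pow_order(1)[OF mac_sym[OF mac] j] .
    then have "ginv (C ^ j) = 1" by (simp add: C_def ginv_gc flip: power_ginv)
    then show "C ^ j = 1" by (metis ginv_ginv ginv_one)
  qed
  have Cd: "C ^ k = 1" if "i dvd k" for k
    using that Ci by (auto simp: dvd_def power_mult)
  have q1: "q > 1" using q(1) by (rule prime_gt_1_nat)
  obtain v i' where v: "i = q ^ v * i'" "\<not> q dvd i'" using prime_part[OF i(1) q(1)] .
  obtain w j' where w: "j = q ^ w * j'" "\<not> q dvd j'" using prime_part[OF j(1) q(1)] .
  have "v > 0" using v q(2) by (cases v) auto
  then obtain v' where v': "v = Suc v'" by (cases v) auto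
  have iq: "i div q = q ^ v' * i'" using v v' q1 by simp
  \<comment> \<open>\<open>r\<close> lacks just one factor \<open>q\<close> of \<open>i\<close> (see
    \<open>nr\<close>); the factor \<open>j'\<close>, the part of \<open>j\<close> prime to
    \<open>q\<close>, lets the same exponent serve for \<open>B\<close>.\<close>
  define r where "r = (i div q) * fact (q - 1) * j'"
  have nr: "\<not> i dvd r * k" if "\<not> q dvd k" for k
  proof
    assume a: "i dvd r * k"
    have "i = (q ^ v' * i') * q" "r * k = (q ^ v' * i') * (fact (q - 1) * j' * k)"
      using v(1) v' iq by (simp_all add: r_def mult_ac)
    then have "(q ^ v' * i') * q dvd (q ^ v' * i') * (fact (q - 1) * j' * k)"
      using a by (simp only:)
    moreover have "q ^ v' * i' \<noteq> 0" using i(1) v v' by auto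
    ultimately have "q dvd fact (q - 1) * j' * k"
      using dvd_times_left_cancel_iff by blast
    then show False
      using prime_not_dvd_fact[OF q(1)] w(2) that prime_dvd_mult_iff[OF q(1)] by blast
  qed
  have EF: "cj (A ^ r) B = C ^ r"
    using bad_prime_conjugate[OF mac i q maxA] by (simp add: r_def C_def)
  \<comment> \<open>Otherwise there is \<open>\<rho>\<close> divisible by \<open>i\<close> but not
    by \<open>j\<close>, so \<open>C ^ \<rho> = 1\<close> and \<open>B ^ \<rho> \<noteq> 1\<close>.
    If \<open>q\<close> does not divide \<open>\<beta> - 1\<close>, then \<open>B ^ \<rho>\<close>
    is conjugate to the inverse of \<open>C ^ \<rho>\<close>; if it does, then
    \<open>B ^ \<rho>\<close> commutes with \<open>A\<close>. Both are impossible.\<close>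
  have wv: "w \<le> v"
  proof (rule ccontr)
    assume "\<not> w \<le> v"
    then obtain w' where w': "w = Suc w'" "v \<le> w'" by (metis not_less_eq_eq Suc_le_D not_le less_eq_Suc_le)
    have jq: "j div q = q ^ w' * j'" using w w' q1 by simp
    have qj: "q dvd j" using w w' by simp
    define \<rho> where "\<rho> = (j div q) * fact (q - 1) * i'"
    have "i dvd q ^ w' * i'" using v(1) w'(2) by (simp add: le_imp_power_dvd mult_dvd_mono)
    then have i\<rho>: "i dvd \<rho>" by (auto simp: \<rho>_def jq intro: dvd_trans)
    have nj: "\<not> j dvd \<rho>"
    proof
      assume a: "j dvd \<rho>"
      have "j = (q ^ w' * j') * q" "\<rho> = (q ^ w' * j') * (fact (q - 1) * i')"
        using w(1) w' jq by (simp_all add: \<rho>_def mult_ac)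
      then have "(q ^ w' * j') * q dvd (q ^ w' * j') * (fact (q - 1) * i')"
        using a by (simp only:)
      moreover have "q ^ w' * j' \<noteq> 0" using j(1) w w' by auto
      ultimately have "q dvd fact (q - 1) * i'"
        using dvd_times_left_cancel_iff by blast
      then show False
        using prime_not_dvd_fact[OF q(1)] v(2) prime_dvd_mult_iff[OF q(1)] by blast
    qed
    have B\<rho>: "B ^ \<rho> \<noteq> 1" using nj j(2)[of "int \<rho>"] by (simp add: zp_of_nat)
    have \<rho>: "(j div q) * fact (q - 1) dvd \<rho>" by (simp add: \<rho>_def)
    show False
    proof (cases "int q dvd \<beta> - 1")
      case False
      have "cj (B ^ \<rho>) A = gc B A ^ \<rho>"
        using bad_prime_conjugate[OF mac_sym[OF mac] j q(1) qj False maxB \<rho>] .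
      also have "\<dots> = ginv (C ^ \<rho>)" by (simp add: C_def ginv_gc flip: power_ginv)
      finally have "cj (B ^ \<rho>) A = 1" using Cd[OF i\<rho>] by simp
      then show False using B\<rho> cj_inj[of "B ^ \<rho>" A 1] by simp
    next
      case True
      have d: "int j dvd \<beta> ^ \<rho> - 1"
        using power_minus_one_dvd_of_bad_bound[OF j(1) mac_comm_pow_order(2)[OF mac_sym[OF mac] j] q(1) qj maxB \<rho>] .
      have "int j dvd hex \<beta> \<rho>"
      proof (rule dvd_if_prime_powers[OF j(1)])
        fix p e :: nat assume p: "Factorial_Ring.prime p" "p ^ e dvd j"
        show "int (p ^ e) dvd hex \<beta> \<rho>"
        proof (cases "p = q")
          case pq: True
          have "q ^ (e - 1) dvd \<rho>"
            using prime_power_pred_dvd_div[OF q(1) qj] p pq \<rho> by (meson dvd_mult_left dvd_trans)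
          then have "int (q ^ Suc (e - 1)) dvd hex \<beta> \<rho>"
            using prime_power_dvd_hex[OF q(1) True] four by blast
          then show ?thesis using pq by (cases e) auto
        next
          case False
          have pr: "p ^ e dvd \<rho>"
            using prime_power_dvd_div[OF p(1) q(1) qj p(2) False] \<rho> by (meson dvd_mult_left dvd_trans)
          have "int (p ^ e) dvd geo \<beta> \<rho>"
          proof (rule dvd_geoI)
            show "0 < p ^ e" using p(1) prime_gt_0_nat by simp
            show "int (p ^ e) dvd \<beta> ^ \<rho> - 1" using d p(2) by (meson dvd_trans int_dvd_int_iff)
            show "p' ^ e' dvd \<rho>" if "p' ^ e' dvd p ^ e" for p' e' using that pr dvd_trans by blast
          qed
          then show ?thesis using pr by (simp add: hex_def flip: int_dvd_int_iff)
        qed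
      qed
      then have "zp B (hex \<beta> \<rho>) = 1" by (simp only: j(2))
      then have "gc A (B ^ \<rho>) = 1"
        using mac_comm_powB[OF mac, of \<rho>] Cd[OF i\<rho>] by (simp add: C_def)
      then have "B ^ \<rho> * A = A * B ^ \<rho>" by (simp add: gc_eq_one_iff)
      then show False using ncB B\<rho> by blast
    qed
  qed
  \<comment> \<open>Here \<open>w \<le> v\<close> is used: \<open>r\<close> contains at least
    \<open>w - 1\<close> factors \<open>q\<close>. The congruence says that \<open>C ^ r\<close>
    commutes with \<open>B\<close>.\<close>
  have "int j dvd \<beta> ^ r - 1"
  proof (rule dvd_if_prime_powers[OF j(1)])
    fix p e :: nat assume p: "Factorial_Ring.prime p" "p ^ e dvd j"
    have pr: "p ^ (e - 1) dvd (if p = q then i div q else j')"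
    proof (cases "p = q")
      case True
      then have "q ^ e dvd q ^ w * j'" using p w by simp
      moreover have "coprime (q ^ e) j'" using w(2) q(1) by (simp add: prime_imp_coprime)
      ultimately have "q ^ e dvd q ^ w" using coprime_dvd_mult_left_iff by blast
      then have "e \<le> w" using q1 by (simp add: power_dvd_imp_le)
      then have "e - 1 \<le> v'" using wv v' by simp
      then show ?thesis using True by (simp add: iq le_imp_power_dvd)
    next
      case False
      have "coprime (p ^ e) (q ^ w)" using False p(1) q(1) by (simp add: primes_coprime)
      then have "p ^ e dvd j'" using p(2) w(1) coprime_dvd_mult_right_iff by blast
      then show ?thesis using False by (simp) (meson diff_le_self le_imp_power_dvd dvd_trans)
    qed
    have "(if p = q then i div q else j') * fact (q - 1) dvd r"
      by (simp add: r_def)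
    then have pr2: "p ^ (e - 1) * k dvd r" if "k dvd fact (q - 1)" for k
      using pr that by (meson dvd_trans mult_dvd_mono)
    show "int (p ^ e) dvd \<beta> ^ r - 1"
    proof (cases "e = 0 \<or> int p dvd \<beta> - 1")
      case True
      have "int (p ^ Suc (e - 1)) dvd \<beta> ^ r - 1" if "e \<noteq> 0"
        using True that pr2[of 1] by (intro prime_power_dvd_power_minus_one) auto
      then show ?thesis by (cases "e = 0") auto
    next
      case False
      then have pj: "p dvd j" using p(2) by (meson dvd_power dvd_trans neq0_conv)
      then have "p \<le> q" using maxB p(1) False by blast
      then have "p ^ (e - 1) * (p - 1) dvd r"
        using pr2 pred_dvd_fact p(1) prime_gt_1_nat by blast
      then show ?thesis
        using euler_prime_power[OF p(1)] coprime_if_dvd_power_minus_one[OF mac_comm_pow_order(2)[OF mac_sym[OF mac] j] j(1) pj] by blast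
    qed
  qed
  then have "zp B (\<beta> ^ r) = zp B 1" using zp_eq_iff[OF j(2)] by metis
  then have "C ^ r * B = B * C ^ r"
    using mac_swapB[OF mac, of r 1] by (simp add: C_def)
  then have "cj (C ^ r) B = C ^ r" by (simp add: cj_eq_iff)
  then have "A ^ r = C ^ r" using EF by (metis cj_inj)
  then have "zp A (int r) * C = C * zp A (int r)"
    by (simp add: zp_of_nat power_commutes)
  moreover have "zp A (int r) * C ^ 1 = C ^ 1 * zp A (int r * \<alpha> ^ 1)"
    unfolding C_def by (rule mac_swapA[OF mac])
  ultimately have "zp A (int r * \<alpha>) = zp A (int r)" by simp
  then have "int i dvd int r * \<alpha> - int r" using zp_eq_iff[OF i(2)] by metis
  then have "int i dvd int r * (\<alpha> - 1)" by (simp add: algebra_simps)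
  then have "i dvd r * nat \<bar>\<alpha> - 1\<bar>"
    by (metis abs_mult abs_of_nat dvd_abs_iff int_dvd_int_iff nat_abs_mult_distrib nat_int of_nat_mult int_nat_eq abs_ge_zero)
  then show False using nr[of "nat \<bar>\<alpha> - 1\<bar>"] q(3) by (metis abs_ge_zero dvd_abs_iff int_dvd_int_iff int_nat_eq)
qed

text \<open>If \<open>n\<close> were a proper divisor of \<open>i\<close>, it would divide
  \<open>i div p\<close> for some prime \<open>p\<close>. Then \<open>C ^ (i div p) = 1\<close>, and
  the extra factor in \<open>prime_power_dvd_hex\<close> makes \<open>i\<close> divide
  \<open>hex \<alpha> (i div p)\<close>, so that \<open>A ^ (i div p)\<close> commutes with
  \<open>B\<close>.\<close>

lemma order_eq_comm_order:
  assumes mac: "mac \<alpha> \<beta> A B"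
    and i: "i > 0" "\<And>k. zp A k = 1 \<longleftrightarrow> int i dvd k"
    and n: "\<And>k. gc A B ^ k = 1 \<longleftrightarrow> n dvd k"
    and good: "\<And>p. Factorial_Ring.prime p \<Longrightarrow> p dvd i \<Longrightarrow> int p dvd \<alpha> - 1"
    and four: "4 dvd \<alpha> - 1"
    and ncA: "\<And>k. A ^ k * B = B * A ^ k \<Longrightarrow> A ^ k = 1"
  shows "n = i"
proof (rule ccontr)
  assume "n \<noteq> i"
  have "n dvd i" using n mac_comm_pow_order(1)[OF mac i] by blast
  then obtain d where d: "i = n * d" by (auto simp: dvd_def)
  then have "d \<noteq> 1" using \<open>n \<noteq> i\<close> by simp
  then obtain p where p: "Factorial_Ring.prime p" "p dvd d" by (metis prime_factor_nat)
  then have pi: "p dvd i" using d by simp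
  have pos: "i div p > 0" "i div p * p = i"
    using pi i(1) by (auto simp: dvd_def)
  have nd: "n dvd i div p" using d p by (auto simp: dvd_def)
  have "int i dvd hex \<alpha> (i div p)"
  proof (rule dvd_if_prime_powers[OF i(1)])
    fix q e :: nat assume q: "Factorial_Ring.prime q" "q ^ e dvd i"
    show "int (q ^ e) dvd hex \<alpha> (i div p)"
    proof (cases e)
      case (Suc f)
      then have qi: "q dvd i" using q(2) by (metis dvd_mult_left power_Suc)
      have "q ^ f dvd i div p"
      proof (cases "q = p")
        case True
        then show ?thesis using prime_power_pred_dvd_div[OF p(1) pi, of e] q Suc by simp
      next
        case False
        then have "q ^ e dvd i div p" using prime_power_dvd_div[OF q(1) p(1) pi q(2)] by simp
        then show ?thesis using Suc by (metis dvd_mult_right power_Suc)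
      qed
      then show ?thesis
        unfolding Suc using prime_power_dvd_hex[OF q(1) good[OF q(1) qi]] four by blast
    qed simp
  qed
  then have "zp A (- hex \<alpha> (i div p)) = 1" by (simp only: i(2) dvd_minus_iff)
  moreover have "gc A B ^ (i div p) = 1" using n nd by blast
  ultimately have "gc (A ^ (i div p)) B = 1"
    using mac_comm_powA[OF mac, of "i div p"] by simp
  then have "A ^ (i div p) = 1" using ncA by (simp add: gc_eq_one_iff)
  then have "i dvd i div p" using i(2)[of "int (i div p)"] by (simp add: zp_of_nat)
  then show False
    using pos p(1) prime_gt_1_nat by (metis dvd_imp_le mult.right_neutral nat_mult_le_cancel1 not_le)
qed

text \<open>If no nontrivial power of \<open>A\<close> or \<open>B\<close> is central, there is no
  bad prime and \<open>A\<close>, \<open>B\<close>, \<open>C\<close> have the same order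
  \<open>n\<close>. For a prime \<open>p\<close> dividing \<open>n\<close>, both
  \<open>\<alpha> ^ (n div p)\<close> and \<open>\<beta> ^ (n div p)\<close> are then 1 modulo
  \<open>n\<close>, so \<open>C ^ (n div p)\<close> is a nontrivial central element.\<close>

theorem mac_central_power:
  assumes mac: "mac \<alpha> \<beta> A B" and fin: "A ^ N = 1" "B ^ N = 1" "N > 0"
    and four: "4 dvd \<alpha> - 1" "4 dvd \<beta> - 1" and nt: "A \<noteq> 1 \<or> B \<noteq> 1"
  shows "\<exists>k. \<exists>x \<in> {A ^ k, B ^ k, gc A B ^ k}. x \<noteq> 1 \<and> x * A = A * x \<and> x * B = B * x"
proof (rule ccontr)
  assume "\<not> ?thesis"
  then have ncA: "\<And>k. A ^ k * B = B * A ^ k \<Longrightarrow> A ^ k = 1"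
    and ncB: "\<And>k. B ^ k * A = A * B ^ k \<Longrightarrow> B ^ k = 1"
    and ncC: "\<And>k. gc A B ^ k * A = A * gc A B ^ k \<Longrightarrow> gc A B ^ k * B = B * gc A B ^ k \<Longrightarrow> gc A B ^ k = 1"
    by (auto simp: power_commutes)
  obtain i where i: "i > 0" "\<And>k. zp A k = 1 \<longleftrightarrow> int i dvd k"
    using finite_order_exists[OF fin(1,3)] by blast
  obtain j where j: "j > 0" "\<And>k. zp B k = 1 \<longleftrightarrow> int j dvd k"
    using finite_order_exists[OF fin(2,3)] by blast
  obtain n where n: "n > 0" "\<And>k. zp (gc A B) k = 1 \<longleftrightarrow> int n dvd k"
    using finite_order_exists[OF mac_comm_pow_order(1)[OF mac i] i(1)] by blast
  have nC: "gc A B ^ k = 1 \<longleftrightarrow> n dvd k" for k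
    using n(2)[of "int k"] by (simp add: zp_of_nat)
  have nC': "gc B A ^ k = 1 \<longleftrightarrow> n dvd k" for k
  proof -
    have "gc B A ^ k = ginv (gc A B ^ k)" by (simp add: ginv_gc flip: power_ginv)
    then show ?thesis using nC by (metis ginv_ginv ginv_one)
  qed
  \<comment> \<open>Both generators are treated in one set, so that a maximal element meets the two
    maximality conditions of \<open>no_bad_prime\<close>, from whichever side it comes.\<close>
  define bad where "bad = {q. Factorial_Ring.prime q \<and>
    (q dvd i \<and> \<not> int q dvd \<alpha> - 1 \<or> q dvd j \<and> \<not> int q dvd \<beta> - 1)}"
  have "bad \<subseteq> {..i + j}"
    using i(1) j(1) by (auto simp: bad_def dest!: dvd_imp_le)
  then have finb: "finite bad" by (rule finite_subset) simp
  have "bad = {}"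
  proof (rule ccontr)
    assume ne: "bad \<noteq> {}"
    define q where "q = Max bad"
    have qb: "q \<in> bad" using Max_in[OF finb ne] by (simp add: q_def)
    have max: "p \<le> q" if "p \<in> bad" for p using Max_ge[OF finb that] by (simp add: q_def)
    from qb consider "Factorial_Ring.prime q" "q dvd i" "\<not> int q dvd \<alpha> - 1"
      | "Factorial_Ring.prime q" "q dvd j" "\<not> int q dvd \<beta> - 1"
      by (auto simp: bad_def)
    then show False
    proof cases
      case 1
      then show False
        using no_bad_prime[OF mac i j 1 _ _ four(2) ncB] max by (auto simp: bad_def)
    next
      case 2
      then show False
        using no_bad_prime[OF mac_sym[OF mac] j i 2 _ _ four(1) ncA] max by (auto simp: bad_def)
    qed
  qed
  then have goodA: "\<And>p. Factorial_Ring.prime p \<Longrightarrow> p dvd i \<Longrightarrow> int p dvd \<alpha> - 1"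
    and goodB: "\<And>p. Factorial_Ring.prime p \<Longrightarrow> p dvd j \<Longrightarrow> int p dvd \<beta> - 1"
    by (auto simp: bad_def)
  have ni: "n = i" using order_eq_comm_order[OF mac i nC goodA four(1) ncA] .
  have nj: "n = j" using order_eq_comm_order[OF mac_sym[OF mac] j nC' goodB four(2) ncB] .
  have "n \<noteq> 1"
  proof
    assume "n = 1"
    then have "zp A 1 = 1" "zp B 1 = 1" using i(2)[of 1] j(2)[of 1] ni nj by simp_all
    then show False using nt by simp
  qed
  then obtain p where p: "Factorial_Ring.prime p" "p dvd n" by (metis prime_factor_nat)
  have dv: "int n dvd x ^ (n div p) - 1" if good: "\<And>p. Factorial_Ring.prime p \<Longrightarrow> p dvd n \<Longrightarrow> int p dvd x - 1" for x
  proof (rule dvd_if_prime_powers[OF n(1)])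
    fix q e :: nat assume q: "Factorial_Ring.prime q" "q ^ e dvd n"
    show "int (q ^ e) dvd x ^ (n div p) - 1"
    proof (cases e)
      case (Suc f)
      then have qn: "q dvd n" using q(2) by (metis dvd_mult_left power_Suc)
      have "q ^ f dvd n div p"
      proof (cases "q = p")
        case True
        then show ?thesis using prime_power_pred_dvd_div[OF p, of e] q Suc by simp
      next
        case False
        then have "q ^ e dvd n div p" using prime_power_dvd_div[OF q(1) p q(2)] by simp
        then show ?thesis using Suc by (metis dvd_mult_right power_Suc)
      qed
      then show ?thesis unfolding Suc
        by (rule prime_power_dvd_power_minus_one[OF good[OF q(1) qn]])
    qed simp
  qed
  let ?C = "gc A B ^ (n div p)"
  have "zp A (\<alpha> ^ (n div p)) = zp A 1" "zp B (\<beta> ^ (n div p)) = zp B 1"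
    using dv[of \<alpha>] dv[of \<beta>] goodA goodB ni nj
      zp_eq_iff[OF i(2), of "\<alpha> ^ (n div p)" 1] zp_eq_iff[OF j(2), of "\<beta> ^ (n div p)" 1] by auto
  then have "?C * A = A * ?C" "?C * B = B * ?C"
    using mac_swapA[OF mac, of 1 "n div p"] mac_swapB[OF mac, of "n div p" 1] by simp_all
  then have "?C = 1" by (rule ncC)
  then have "n dvd n div p" using nC by blast
  moreover have "n div p > 0" "n div p * p = n" using p n(1) by (auto simp: dvd_def)
  ultimately show False
    using p(1) prime_gt_1_nat by (metis dvd_imp_le mult.right_neutral nat_mult_le_cancel1 not_le)
qed

section \<open>2-adic valuations\<close>

text \<open>\<open>tv a x\<close>: the 2-adic valuation of \<open>x\<close> is exactly \<open>a\<close>.\<close>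

definition tv :: "nat \<Rightarrow> int \<Rightarrow> bool" where
  "tv a x \<longleftrightarrow> (\<exists>k. odd k \<and> x = 2 ^ a * k)"

lemma tv_mult: "tv a x \<Longrightarrow> tv b y \<Longrightarrow> tv (a + b) (x * y)"
  unfolding tv_def by (elim exE conjE) (rule_tac x = "k * ka" in exI, simp add: power_add)

lemma tv_mult_odd: "tv a x \<Longrightarrow> odd y \<Longrightarrow> tv a (x * y)"
  unfolding tv_def by (metis even_mult_iff mult.assoc)

lemma tv_uminus: "tv a x \<Longrightarrow> tv a (- x)"
  using tv_mult_odd[of a x "-1"] by simp

lemma tv_add: "tv a x \<Longrightarrow> 2 ^ Suc a dvd y \<Longrightarrow> tv a (x + y)"
proof -
  assume "tv a x" "2 ^ Suc a dvd y"
  then obtain k j where "odd k" "x = 2 ^ a * k" "y = 2 ^ Suc a * j"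
    unfolding tv_def by (auto elim: dvdE)
  then have "odd (k + 2 * j)" "x + y = 2 ^ a * (k + 2 * j)" by (auto simp: algebra_simps)
  then show ?thesis unfolding tv_def by blast
qed

lemma tv_diff: "tv a x \<Longrightarrow> 2 ^ Suc a dvd y \<Longrightarrow> tv a (x - y)"
  using tv_add[of a x "- y"] by simp

lemma tv_cong: "tv a x \<Longrightarrow> 2 ^ Suc a dvd x - y \<Longrightarrow> tv a y"
  using tv_diff[of a x "x - y"] by simp

lemma tv_dvd: "tv a x \<Longrightarrow> b \<le> a \<Longrightarrow> 2 ^ b dvd x"
  unfolding tv_def by (metis dvd_mult2 le_imp_power_dvd)

lemma tv_nonzero: "tv a x \<Longrightarrow> x \<noteq> 0"
  unfolding tv_def by auto

lemma tv_multiplicity: "x \<noteq> 0 \<Longrightarrow> tv (multiplicity 2 x) x"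
  unfolding tv_def by (rule multiplicity_decompose'[of x 2]) auto

lemma odd_inverse_mod:
  assumes "odd (x::int)"
  obtains y where "y > 0" "2 ^ K dvd x * y - 1"
proof -
  have "coprime x (2 ^ K)" using assms by simp
  then obtain y0 where y0: "[x * y0 = 1] (mod 2 ^ K)" using cong_solve_coprime_int by blast
  \<comment> \<open>The shift makes the inverse positive, so that it can be turned into an exponent
    of type \<open>nat\<close>.\<close>
  define y where "y = y0 + 2 ^ K * (\<bar>y0\<bar> + 1)"
  have "[x * y = x * y0] (mod 2 ^ K)"
    by (simp add: y_def cong_iff_dvd_diff algebra_simps)
  then have "2 ^ K dvd x * y - 1" using y0 cong_trans by (metis cong_iff_dvd_diff)
  moreover have "1 * (\<bar>y0\<bar> + 1) \<le> 2 ^ K * (\<bar>y0\<bar> + 1)" by (intro mult_right_mono) auto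
  then have "\<bar>y0\<bar> + 1 \<le> y - y0" unfolding y_def by simp
  then have "y > 0" by linarith
  ultimately show thesis using that by blast
qed

lemma odd_power_eq_one:
  assumes "x ^ (2 ^ K) = 1" "zp x k = 1" "odd k"
  shows "x = (1::'a::grp)"
proof -
  obtain y where y: "2 ^ K dvd k * y - 1" using odd_inverse_mod[OF assms(3)] by blast
  have "zp x (2 ^ K) = 1" using assms(1) zp_of_nat[of x "2 ^ K"] by simp
  then have "zp x (k * y - 1) = 1" using y by (auto simp: dvd_def zp_mult)
  moreover have "zp x (k * y) = 1" using assms(2) by (simp add: zp_mult)
  ultimately have "1 = zp x 1" by (simp add: zp_diff) (metis ginv_ginv ginv_one)
  then show ?thesis by simp
qed

lemma zp_two_power:
  assumes "x ^ (2 ^ K) = (1::'a::grp)" "2 ^ K dvd j - k"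
  shows "zp x j = zp x k"
proof -
  have "zp x (2 ^ K) = 1" using assms(1) zp_of_nat[of x "2 ^ K"] by simp
  then have "zp x (j - k) = 1" using assms(2) by (auto simp: dvd_def zp_mult)
  then show ?thesis unfolding zp_diff by (metis grp_solve_right ginv_ginv mult_1_left)
qed

text \<open>Write \<open>x = 1 + 2 * h\<close> with \<open>h\<close> of valuation
  \<open>m - 1\<close>. In the second-order expansions of \<open>x ^ nat x\<close> and
  \<open>geo x (nat x)\<close> everything cancels modulo \<open>2 ^ (2 * m)\<close> except
  \<open>2 * h ^ 2\<close> times an odd number.\<close>

lemma tv_hex_self:
  assumes "tv m (x - 1)" "m \<ge> 2" "x > 0"
  shows "tv (2 * m - 1) (hex x (nat x))"
proof -
  define k where "k = nat x"
  obtain c where c: "odd c" "x - 1 = 2 ^ m * c" using assms(1) by (auto simp: tv_def)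
  obtain m' where m': "m = Suc m'" using assms(2) by (cases m) auto
  define h where "h = 2 ^ m' * c"
  have s: "x - 1 = 2 * h" using c m' by (simp add: h_def)
  have kx: "int k = x" using assms(3) by (simp add: k_def)
  have "even h" using assms(2) m' by (auto simp: h_def)
  have d: "(2 ^ m)\<^sup>2 dvd x ^ k - 1 - x * (x - 1)"
    using dvd_power_mod_square[of "2 ^ m" x k] c(2) kx by simp
  have "int (k * (k - 1)) = x * (2 * h)"
  proof -
    have "int (k - 1) = x - 1" using kx assms(3) by linarith
    then show ?thesis using kx s by simp
  qed
  then have "int (k * (k - 1) div 2) = x * h" by (simp add: zdiv_int del: of_nat_mult)
  then have g: "(2 ^ m)\<^sup>2 dvd geo x k - x - x * h * (x - 1)"
    using geo_mod_square'[of "2 ^ m" x k] c(2) kx by simp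
  have "hex x k - 2 * (h * h) * (x * (1 - 2 * h)) = x * (x ^ k - 1 - x * (x - 1)) - x * (geo x k - x - x * h * (x - 1))
      + (x + x * x * (x - 1) - x * (x + x * h * (x - 1)) - 2 * (h * h) * (x * (1 - 2 * h)))"
    by (simp add: hex_def kx algebra_simps)
  also have "x + x * x * (x - 1) - x * (x + x * h * (x - 1)) - 2 * (h * h) * (x * (1 - 2 * h)) = 0"
  proof -
    have "x = 1 + 2 * h" using s by simp
    then show ?thesis by (simp add: algebra_simps)
  qed
  finally have "(2 ^ m)\<^sup>2 dvd hex x k - 2 * (h * h) * (x * (1 - 2 * h))"
    using d g by simp
  moreover have "(2::int) ^ Suc (2 * m - 1) = (2 ^ m)\<^sup>2"
  proof -
    have "Suc (2 * m - 1) = m + m" using assms(2) by simp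
    then show ?thesis by (simp only: power_add power2_eq_square)
  qed
  moreover have "tv (2 * m - 1) (2 * (h * h) * (x * (1 - 2 * h)))"
  proof (rule tv_mult_odd)
    have "2 * m - 1 = Suc (m' + m')" using m' by simp
    then have "2 * (h * h) = 2 ^ (2 * m - 1) * (c * c)"
      by (simp only: h_def power_Suc power_add mult_ac)
    then show "tv (2 * m - 1) (2 * (h * h))" using c by (auto simp: tv_def)
    have "x = 1 + 2 * h" using s by simp
    then show "odd (x * (1 - 2 * h))" by simp
  qed
  ultimately have "tv (2 * m - 1) (hex x k)"
    by (metis tv_add add.commute diff_add_cancel)
  then show ?thesis by (simp add: k_def)
qed

text \<open>Refines \<open>prime_power_dvd_geo_diff\<close> at 2 by using all \<open>m\<close>
  factors of \<open>x - 1\<close>; one factor is given away to the division by 2 in the triangular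
  numbers.\<close>

lemma two_power_dvd_geo_diff:
  assumes "m \<ge> 1" "2 ^ m dvd x - 1" "2 ^ e dvd r"
  shows "2 ^ (e + m - 1) dvd geo x r - int r"
  using assms(2,3)
proof (induction e arbitrary: x r)
  case 0
  have "2 ^ (m - 1) dvd x - 1" using 0(1) by (meson diff_le_self le_imp_power_dvd dvd_trans)
  then show ?case using dvd_geo_diff by simp
next
  case (Suc e)
  obtain c where "r = 2 ^ Suc e * c" using Suc.prems(2) by (elim dvdE)
  define s where "s = 2 ^ e * c"
  have r: "r = 2 * s" using \<open>r = _\<close> by (simp add: s_def)
  obtain w where w: "x - 1 = 2 ^ m * w" using Suc.prems(1) by (elim dvdE)
  have g2: "geo x 2 = 2 + 2 ^ m * w" using w by (simp add: geo_def numeral_2_eq_2)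
  have "2 ^ (e + m - 1) dvd geo (x ^ 2) s - int s"
    using Suc.IH[of "x ^ 2" s] dvd_power_minus_one[OF Suc.prems(1)] by (simp add: s_def)
  then obtain v where v: "geo (x ^ 2) s = int s + 2 ^ (e + m - 1) * v"
    by (metis dvd_def diff_eq_eq add.commute)
  have "geo x r - int r = 2 * (2 ^ (e + m - 1) * v) + 2 ^ m * w * int s + 2 ^ m * w * (2 ^ (e + m - 1) * v)"
    unfolding r geo_times g2 v by (simp add: algebra_simps)
  also have "2 * (2 ^ (e + m - 1) * v) = 2 ^ (Suc e + m - 1) * v"
    using assms(1) by (cases m) auto
  finally have eq: "geo x r - int r = 2 ^ (Suc e + m - 1) * v + 2 ^ m * w * int s + 2 ^ m * w * (2 ^ (e + m - 1) * v)" .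
  have "2 ^ (Suc e + m - 1) dvd 2 ^ m * w * int s"
    by (simp add: s_def power_add mult_ac)
  moreover have "(2::int) ^ (Suc e + m - 1) dvd 2 ^ (m + (e + m - 1))"
    using assms(1) by (intro le_imp_power_dvd) linarith
  then have "2 ^ (Suc e + m - 1) dvd 2 ^ m * w * (2 ^ (e + m - 1) * v)"
  proof -
    have "2 ^ m * w * (2 ^ (e + m - 1) * v) = 2 ^ (m + (e + m - 1)) * (w * v)"
      by (simp only: power_add mult_ac)
    then show ?thesis using \<open>2 ^ (Suc e + m - 1) dvd 2 ^ (m + (e + m - 1))\<close> dvd_mult2 by metis
  qed
  ultimately show ?case unfolding eq by simp
qed

lemma tv_geo:
  assumes "4 dvd x - 1" "tv a (int n)"
  shows "tv a (geo x n)"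
proof -
  have "2 ^ a dvd n" using tv_dvd[OF assms(2), of a] by (metis int_dvd_int_iff of_nat_numeral of_nat_power order_refl)
  then have "int (2 ^ Suc a) dvd geo x n - int n"
    using assms(1) dvd_trans[of 2 4 "x - 1"] by (intro prime_power_dvd_geo_diff) auto
  then show ?thesis using tv_add[OF assms(2)] by (metis add.commute diff_add_cancel of_nat_numeral of_nat_power)
qed

lemma tv_power_minus_one:
  assumes "tv m (x - 1)" "m \<ge> 2" "tv a (int n)"
  shows "tv (m + a) (x ^ n - 1)"
proof -
  have "4 dvd x - 1" using tv_dvd[OF assms(1,2)] by simp
  then show ?thesis using tv_mult[OF assms(1) tv_geo[OF _ assms(3), of x]] by (simp add: geo_mult)
qed

lemma two_power_dvd_hex:
  assumes "m \<ge> 1" "2 ^ m dvd x - 1" "2 ^ e dvd r"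
  shows "2 ^ (e + m - 1) dvd hex x r"
proof -
  have "hex x r = int r * (x ^ r - 1) - x * (geo x r - int r) - int r * (x - 1)"
    by (simp add: hex_def algebra_simps)
  moreover have d: "2 ^ (e + m - 1) dvd int r * y" if "2 ^ m dvd y" for y
  proof -
    have "(2::int) ^ e dvd int r" using assms(3) by (metis int_dvd_int_iff of_nat_numeral of_nat_power)
    then have "2 ^ (e + m) dvd int r * y" using that by (simp add: power_add mult_dvd_mono)
    then show ?thesis by (meson diff_le_self le_imp_power_dvd dvd_trans)
  qed
  ultimately show ?thesis
    using two_power_dvd_geo_diff[OF assms] d[OF assms(2)] d[OF dvd_power_minus_one[OF assms(2)]] by simp
qed

text \<open>When the orders are powers of 2, only residues of \<open>\<alpha>\<close> and
  \<open>\<beta>\<close> matter. This allows positive representatives, which can serve as natural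
  exponents.\<close>

lemma mac_cong:
  assumes "mac \<alpha> \<beta> A B" "A ^ (2 ^ K) = 1" "B ^ (2 ^ K) = 1" "2 ^ K dvd \<alpha> - \<alpha>'" "2 ^ K dvd \<beta> - \<beta>'"
  shows "mac \<alpha>' \<beta>' A B"
  using assms zp_two_power[OF assms(2,4)] zp_two_power[OF assms(3,5)] by (simp add: mac_def)

lemma mac_comm_two_power:
  assumes mac: "mac \<alpha> \<beta> A B" and A: "A ^ (2 ^ K) = 1" and "2 dvd \<alpha> - 1"
  shows "gc A B ^ (2 ^ K) = 1"
proof -
  have "int (2 ^ K) dvd geo \<alpha> (2 ^ K)"
    using prime_power_dvd_geo[of 2 \<alpha> K "2 ^ K"] assms(3) by simp
  then have "zp A (- hex \<alpha> (2 ^ K)) = zp A 0"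
    by (intro zp_two_power[OF A]) (simp add: hex_def)
  then show ?thesis
    using mac_comm_powA[OF mac, of "2 ^ K"] A by (simp add: gc_def)
qed

text \<open>This is \<open>mac_key\<close> at \<open>e = 1\<close>, with the power of
  \<open>A\<close> moved to the left of \<open>C\<close>, for which \<open>\<alpha>\<close> is
  inverted modulo \<open>2 ^ K\<close>. The valuations are those of
  \<open>tv_hex_self\<close>.\<close>

lemma mac_two_relation:
  assumes mac: "mac \<alpha> \<beta> A B" and A: "A ^ (2 ^ K) = 1" and B: "B ^ (2 ^ K) = 1"
    and m: "m \<ge> 2" and a: "tv m (\<alpha> - 1)" and b: "tv m (\<beta> - 1)"
    and pos: "0 < \<beta>" "\<beta> < \<alpha>"
  obtains y h where "tv (2 * m - 1) y" "tv (2 * m - 1) h"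
    "zp A y * gc A B ^ nat (\<alpha> - \<beta>) = zp B h"
proof -
  define C where "C = gc A B"
  define \<kappa> where "\<kappa> = nat \<alpha>"
  define k where "k = nat \<beta>"
  define d where "d = nat (\<alpha> - \<beta>)"
  have kd: "\<kappa> = k + d" using pos by (simp add: \<kappa>_def k_def d_def)
  have "even (\<alpha> - 1)" using tv_dvd[OF a, of 1] m by simp
  then have "odd \<alpha>" by simp
  \<comment> \<open>The exponent \<open>Suc K\<close> makes the inverse visibly odd even for
    \<open>K = 0\<close>.\<close>
  obtain \<alpha>'' where \<alpha>'': "2 ^ Suc K dvd \<alpha> * \<alpha>'' - 1" using odd_inverse_mod[OF \<open>odd \<alpha>\<close>] by blast
  have dv: "2 ^ K dvd \<alpha> * \<alpha>'' - 1" using \<alpha>'' by (rule power_le_dvd) simp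
  have "even (\<alpha> * \<alpha>'' - 1)" using \<alpha>'' by (meson dvd_trans dvd_power zero_less_Suc)
  then have "odd \<alpha>''" by auto
  \<comment> \<open>As \<open>\<kappa>\<close> equals \<open>\<alpha>\<close>, the term
    \<open>\<alpha> ^ (\<kappa> + 1)\<close> in \<open>mac_key\<close> is
    \<open>int \<kappa> * \<alpha> ^ \<kappa>\<close>, and the exponent of \<open>A\<close> becomes
    a value of \<open>hex\<close>.\<close>
  have key: "C ^ (\<kappa> + 1) * zp A (- hex \<alpha> \<kappa>) = zp B (hex \<beta> k) * C ^ (k + 1)"
    using mac_key[OF mac, of \<kappa> 1 k] pos by (simp add: C_def \<kappa>_def k_def hex_def)
  define y where "y = - hex \<alpha> \<kappa> * \<alpha>'' ^ (\<kappa> + 1)"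
  have "zp A y * C ^ (\<kappa> + 1) = C ^ (\<kappa> + 1) * zp A (y * \<alpha> ^ (\<kappa> + 1))"
    unfolding C_def by (rule mac_swapA[OF mac])
  also have "zp A (y * \<alpha> ^ (\<kappa> + 1)) = zp A (- hex \<alpha> \<kappa>)"
  proof (rule zp_two_power[OF A])
    have "y * \<alpha> ^ (\<kappa> + 1) - - hex \<alpha> \<kappa> = - hex \<alpha> \<kappa> * ((\<alpha> * \<alpha>'') ^ (\<kappa> + 1) - 1)"
      by (simp add: y_def power_mult_distrib algebra_simps)
    then show "2 ^ K dvd y * \<alpha> ^ (\<kappa> + 1) - - hex \<alpha> \<kappa>"
      using dvd_power_minus_one[OF dv] by (metis dvd_mult)
  qed
  finally have "zp A y * C ^ (\<kappa> + 1) = zp B (hex \<beta> k) * C ^ (k + 1)" using key by simp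
  moreover have "C ^ (\<kappa> + 1) = C ^ d * C ^ (k + 1)" 
  proof -
    have "\<kappa> + 1 = d + (k + 1)" using kd by simp
    then show ?thesis by (simp only: power_add)
  qed
  ultimately have "zp A y * C ^ d = zp B (hex \<beta> k)"
    by (metis grp_right_cancel mult.assoc)
  moreover have "tv (2 * m - 1) y"
    unfolding y_def using tv_hex_self[OF a m] pos \<open>odd \<alpha>''\<close> by (intro tv_mult_odd tv_uminus) (auto simp: \<kappa>_def)
  moreover have "tv (2 * m - 1) (hex \<beta> k)"
    using tv_hex_self[OF b m] pos by (simp add: k_def)
  ultimately show thesis using that by (simp add: C_def d_def)
qed

section \<open>Relations in the 2-part\<close>

text \<open>By \<open>mac_two_relation\<close>, \<open>B ^ h\<close> acts on \<open>A\<close> as \<open>C ^ d\<close> does; this expresses \<open>C ^ h\<close> by powers of \<open>A\<close> and \<open>B\<close>.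
  Powers of the relation itself give a second such expression.\<close>

lemma mac_two_star:
  assumes mac: "mac \<alpha> \<beta> A B" and A: "A ^ (2 ^ K) = 1" and B: "B ^ (2 ^ K) = 1" and K: "2 * m \<le> K"
    and a: "tv m (\<alpha> - 1)" and b: "tv m (\<beta> - 1)" and l: "tv l (\<alpha> - \<beta>)"
    and ml: "2 \<le> m" "m < l" "l < 2 * m" and pos: "0 < \<beta>" "\<beta> < \<alpha>"
  obtains q1 q2 p where "tv (m + l) q1" "tv (4 * m - 2 - l) q2" "tv (4 * m - 2 - l) p"
    "zp A (q1 - q2) = zp B p"
proof -
  define C where "C = gc A B"
  define d where "d = nat (\<alpha> - \<beta>)"
  have d: "int d = \<alpha> - \<beta>" using pos by (simp add: d_def)
  obtain y h where y: "tv (2 * m - 1) y" and h: "tv (2 * m - 1) h" and yh: "zp A y * C ^ d = zp B h"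
    using mac_two_relation[OF mac A B ml(1) a b pos] by (auto simp: C_def d_def)
  have "4 dvd \<alpha> - 1" using tv_dvd[OF a ml(1)] by simp
  have "even (\<alpha> - 1)" using tv_dvd[OF a, of 1] ml(1) by simp
  then have "odd \<alpha>" by simp
  have CK: "C ^ (2 ^ K) = 1" using mac_comm_two_power[OF mac A \<open>even (\<alpha> - 1)\<close>] by (simp add: C_def)
  obtain \<alpha>' where \<alpha>'0: "2 ^ K dvd \<alpha> * \<alpha>' - 1" using odd_inverse_mod[OF \<open>odd \<alpha>\<close>] by blast
  have "4 dvd \<alpha> * \<alpha>' - 1" using power_le_dvd[OF \<alpha>'0, of 2] K ml by simp
  then have "4 dvd (\<alpha> * \<alpha>' - 1) - (\<alpha> - 1) * \<alpha>'" using \<open>4 dvd \<alpha> - 1\<close> by (meson dvd_diff dvd_mult2)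
  moreover have "(\<alpha> * \<alpha>' - 1) - (\<alpha> - 1) * \<alpha>' = \<alpha>' - 1" by (simp add: algebra_simps)
  ultimately have four': "4 dvd \<alpha>' - 1" by simp

  \<comment> \<open>A natural residue of \<open>h\<close>, since \<open>hex\<close> and
    \<open>mac_comm_powB\<close> take natural exponents.\<close>
  define hn where "hn = nat (h mod 2 ^ K)"
  have hn: "int hn = h mod 2 ^ K" by (simp add: hn_def)
  then have hh: "2 ^ K dvd h - int hn" by (simp add: minus_mod_eq_mult_div)
  have hnv: "tv (2 * m - 1) (int hn)"
    using tv_cong[OF h] power_le_dvd[OF hh, of "Suc (2 * m - 1)"] K ml by simp
  have Bh: "zp B h = B ^ hn" using zp_two_power[OF B hh] by (simp add: zp_of_nat)

  have "cj A (B ^ hn) = cj (cj A (zp A y)) (C ^ d)"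
    unfolding Bh[symmetric] yh[symmetric] by (simp only: cj_cj)
  also have "cj A (zp A y) = A" by (metis cj_eq_iff commute_zp)
  also have "cj A (C ^ d) = zp A (\<alpha> ^ d)"
    using mac_swapA[OF mac, of 1 d] by (simp add: C_def cj_eq_iff)
  finally have "A * (zp B (hex \<beta> hn) * C ^ hn) = zp A (\<alpha> ^ d)"
    by (simp add: cj_gc mac_comm_powB[OF mac] C_def)
  then have ii: "zp A (\<alpha> ^ d - 1) = zp B (hex \<beta> hn) * C ^ hn"
    by (metis add.commute diff_add_cancel grp_left_cancel zp_1 zp_add)

  have CN: "C ^ (d * N) = zp A (- (y * geo (\<alpha>' ^ d) N)) * zp B (h * int N)" for N
  proof (induction N)
    case (Suc N)
    have Cd: "C ^ d = zp A (- y) * zp B h"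
      using yh by (simp add: zp_minus grp_solve_left)
    have sw: "C ^ d * zp A z = zp A (z * \<alpha>' ^ d) * C ^ d" for z
    proof -
      have "zp A (z * \<alpha>' ^ d) * C ^ d = C ^ d * zp A (z * \<alpha>' ^ d * \<alpha> ^ d)"
        unfolding C_def by (rule mac_swapA[OF mac])
      also have "zp A (z * \<alpha>' ^ d * \<alpha> ^ d) = zp A z"
      proof (rule zp_two_power[OF A])
        have "z * \<alpha>' ^ d * \<alpha> ^ d - z = z * ((\<alpha> * \<alpha>') ^ d - 1)"
          by (simp add: algebra_simps power_mult_distrib)
        then show "2 ^ K dvd z * \<alpha>' ^ d * \<alpha> ^ d - z"
          using dvd_power_minus_one[OF \<alpha>'0] by (metis dvd_mult)
      qed
      finally show ?thesis by simp
    qed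
    have "C ^ (d * Suc N) = C ^ d * zp A (- (y * geo (\<alpha>' ^ d) N)) * zp B (h * int N)"
      using Suc by (simp add: power_add mult.assoc)
    also have "\<dots> = zp A (- (y * geo (\<alpha>' ^ d) N) * \<alpha>' ^ d) * (zp A (- y) * zp B h) * zp B (h * int N)"
      by (simp only: sw) (simp only: Cd)
    also have "\<dots> = zp A (- (y * geo (\<alpha>' ^ d) N) * \<alpha>' ^ d + - y) * zp B (h + h * int N)"
      by (simp only: zp_add mult.assoc)
    finally show ?case by (simp add: geo_Suc' algebra_simps)
  qed simp

  obtain u where u: "odd u" "\<alpha> - \<beta> = 2 ^ l * u" using l by (auto simp: tv_def)
  obtain z where z: "odd z" "int hn = 2 ^ (2 * m - 1) * z" using hnv by (auto simp: tv_def)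
  have "odd (- u)" using u by simp
  then obtain w where w: "w > 0" "2 ^ Suc K dvd - u * w - 1" using odd_inverse_mod by blast
  have "even (- u * w - 1)" using w(2) by (meson dvd_trans dvd_power zero_less_Suc)
  then have "odd w" by auto
  have "0 \<le> 2 ^ (2 * m - 1) * z" unfolding z(2)[symmetric] by simp
  then have "z \<ge> 0" by (simp add: zero_le_mult_iff)
  moreover have "z \<noteq> 0" using z(1) by auto
  ultimately have "z > 0" by linarith
  \<comment> \<open>Chosen so that \<open>d * N\<close> is \<open>- hn\<close> modulo
    \<open>2 ^ K\<close>: here \<open>d = 2 ^ l * u\<close>,
    \<open>hn = 2 ^ (2 * m - 1) * z\<close>, and \<open>w\<close> inverts \<open>- u\<close>. So
    \<open>C ^ hn\<close> is the inverse of a power given by \<open>CN\<close>.\<close>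
  define N where "N = nat (2 ^ (2 * m - 1 - l) * (z * w))"
  have N: "int N = 2 ^ (2 * m - 1 - l) * (z * w)" using w \<open>z > 0\<close> by (simp add: N_def)
  have tN: "tv (2 * m - 1 - l) (int N)" using N z \<open>odd w\<close> by (auto simp: tv_def)
  have "2 * m - 1 = l + (2 * m - 1 - l)" using ml by simp
  then have "int (hn + d * N) = 2 ^ (2 * m - 1) * z * (1 + u * w)"
    unfolding of_nat_add of_nat_mult d u(2) N z(2) by (simp add: algebra_simps power_add[symmetric])
  moreover have "2 ^ K dvd 1 + u * w"
    using power_le_dvd[OF w(2), of K] by (metis dvd_minus_iff le_SucI minus_add_distrib order_refl minus_diff_eq diff_minus_eq_add mult_minus_left add.commute)
  ultimately have "2 ^ K dvd int (hn + d * N)" by simp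
  then have "2 ^ K dvd hn + d * N" by (metis int_dvd_int_iff of_nat_numeral of_nat_power)
  then have "C ^ (hn + d * N) = 1" using CK by (auto simp: dvd_def power_mult)
  then have "C ^ hn * C ^ (d * N) = 1" by (simp add: power_add)
  then have "C ^ hn = ginv (C ^ (d * N))" by (metis grp_solve_right mult_1_left)
  also have "\<dots> = zp B (- (h * int N)) * zp A (y * geo (\<alpha>' ^ d) N)"
    by (simp add: CN zp_minus)
  finally have "zp A (\<alpha> ^ d - 1) = zp B (hex \<beta> hn + - (h * int N)) * zp A (y * geo (\<alpha>' ^ d) N)"
    unfolding ii by (simp only: zp_add mult.assoc)
  then have fin: "zp A (\<alpha> ^ d - 1 - y * geo (\<alpha>' ^ d) N) = zp B (hex \<beta> hn - h * int N)"
    by (simp add: zp_diff[of A "\<alpha> ^ d - 1"] mult.assoc)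
  have e: "4 * m - 2 - l = 2 * m - 1 + (2 * m - 1 - l)" using ml by simp
  have "tv (m + l) (\<alpha> ^ d - 1)"
    using tv_power_minus_one[OF a ml(1)] l d by simp
  moreover have "tv (4 * m - 2 - l) (y * geo (\<alpha>' ^ d) N)"
    unfolding e using y tv_geo[OF _ tN] dvd_power_minus_one[OF four'] by (intro tv_mult) auto
  moreover have "tv (4 * m - 2 - l) (hex \<beta> hn - h * int N)"
  proof -
    \<comment> \<open>The \<open>hex\<close> term is divisible by \<open>2 ^ (3 * m - 2)\<close>,
      which exceeds the valuation \<open>4 * m - 2 - l\<close> of the other term because
      \<open>m < l\<close>.\<close>
    have "2 ^ (2 * m - 1) dvd hn" using tv_dvd[OF hnv order_refl] by (metis int_dvd_int_iff of_nat_numeral of_nat_power)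
    then have "2 ^ (2 * m - 1 + m - 1) dvd hex \<beta> hn"
      using two_power_dvd_hex[of m \<beta> "2 * m - 1" hn] ml tv_dvd[OF b order_refl] by simp
    then have "2 ^ Suc (4 * m - 2 - l) dvd hex \<beta> hn"
      by (rule power_le_dvd) (use ml in linarith)
    moreover have "tv (4 * m - 2 - l) (- (h * int N))"
      unfolding e using h tN by (intro tv_uminus tv_mult)
    ultimately show ?thesis using tv_add[of _ "- (h * int N)"] by (metis add.commute diff_conv_add_uminus)
  qed
  ultimately show thesis using that fin by blast
qed

lemma positive_representatives:
  fixes \<alpha> \<beta> :: int
  obtains \<alpha>' \<beta>' where "0 < \<beta>'" "\<beta>' < \<alpha>'" "2 ^ K dvd \<alpha> - \<alpha>'" "2 ^ K dvd \<beta> - \<beta>'"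
proof -
  define \<beta>' where "\<beta>' = \<beta> + 2 ^ K * (\<bar>\<beta>\<bar> + 1)"
  define \<alpha>' where "\<alpha>' = \<alpha> + 2 ^ K * (\<bar>\<alpha>\<bar> + \<beta>' + 1)"
  have "1 * (\<bar>\<beta>\<bar> + 1) \<le> 2 ^ K * (\<bar>\<beta>\<bar> + 1)" by (intro mult_right_mono) auto
  then have "\<bar>\<beta>\<bar> + 1 \<le> \<beta>' - \<beta>" unfolding \<beta>'_def by simp
  then have b: "\<beta>' > 0" by linarith
  then have "1 * (\<bar>\<alpha>\<bar> + \<beta>' + 1) \<le> 2 ^ K * (\<bar>\<alpha>\<bar> + \<beta>' + 1)" by (intro mult_right_mono) auto
  then have "\<bar>\<alpha>\<bar> + \<beta>' + 1 \<le> \<alpha>' - \<alpha>" unfolding \<alpha>'_def by simp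
  then have "\<beta>' < \<alpha>'" by linarith
  then show thesis using that b by (simp add: \<alpha>'_def \<beta>'_def)
qed

lemma tv_shift: "tv a (x - y) \<Longrightarrow> 2 ^ K dvd x - x' \<Longrightarrow> 2 ^ K dvd y - y' \<Longrightarrow> a < K \<Longrightarrow> tv a (x' - y')"
proof (rule tv_cong)
  assume "2 ^ K dvd x - x'" "2 ^ K dvd y - y'" "a < K"
  then have "2 ^ K dvd (x - x') - (y - y')" using dvd_diff by blast
  then have "2 ^ K dvd x - y - (x' - y')" by (simp add: algebra_simps)
  then show "2 ^ Suc a dvd x - y - (x' - y')" by (rule power_le_dvd) (use \<open>a < K\<close> in simp)
qed

text \<open>The valuations \<open>m + l\<close> and \<open>4 * m - 2 - l\<close> in
  \<open>mac_two_star\<close> coincide exactly when \<open>2 * l + 2 = 3 * m\<close>; otherwise the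
  second is larger. After division by \<open>2 ^ (l + m)\<close>, the two odd terms on the left
  cancel to an even \<open>q\<close> in the first case, whereas \<open>p\<close> is even in the
  second.\<close>

lemma mac_two_star_parity:
  assumes mac: "mac \<alpha> \<beta> A B" and A: "A ^ (2 ^ K) = 1" and B: "B ^ (2 ^ K) = 1" and K: "4 * m \<le> K"
    and a: "tv m (\<alpha> - 1)" and b: "tv m (\<beta> - 1)" and l: "tv l (\<alpha> - \<beta>)"
    and ml: "2 \<le> m" "m < l" "l < 2 * m" "2 * l + 2 \<le> 3 * m"
  obtains q p where "zp A (2 ^ (l + m) * q) = zp B (2 ^ (l + m) * p)"
    "even p \<longleftrightarrow> 2 * l + 2 < 3 * m" "even q \<longleftrightarrow> 2 * l + 2 = 3 * m"
proof -
  obtain \<alpha>' \<beta>' where r: "0 < \<beta>'" "\<beta>' < \<alpha>'" "2 ^ K dvd \<alpha> - \<alpha>'" "2 ^ K dvd \<beta> - \<beta>'"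
    using positive_representatives .
  have "mac \<alpha>' \<beta>' A B" using mac_cong[OF mac A B r(3,4)] .
  moreover have "tv m (\<alpha>' - 1)" "tv m (\<beta>' - 1)" "tv l (\<alpha>' - \<beta>')"
    using tv_shift[OF a r(3), of 1] tv_shift[OF b r(4), of 1] tv_shift[OF l r(3,4)] ml K by auto
  ultimately obtain q1 q2 p where q: "tv (m + l) q1" "tv (4 * m - 2 - l) q2" "tv (4 * m - 2 - l) p"
    "zp A (q1 - q2) = zp B p"
    using mac_two_star[of \<alpha>' \<beta>' A B K m l] A B K ml r by auto
  obtain k where k: "4 * m - 2 - l = l + m + k" "k = 0 \<longleftrightarrow> 2 * l + 2 = 3 * m"
    using ml by (intro that[of "4 * m - 2 - l - (l + m)"]) auto
  obtain c1 c2 c3 where c: "odd c1" "q1 = 2 ^ (m + l) * c1" "odd c2" "q2 = 2 ^ (l + m + k) * c2"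
    "odd c3" "p = 2 ^ (l + m + k) * c3"
    using q(1-3) unfolding k tv_def by blast
  have "zp A (2 ^ (l + m) * (c1 - 2 ^ k * c2)) = zp B (2 ^ (l + m) * (2 ^ k * c3))"
    using q(4) c by (simp add: power_add algebra_simps)
  then show thesis
    using that[of "c1 - 2 ^ k * c2" "2 ^ k * c3"] c k ml(4) by (cases "k = 0") auto
qed

text \<open>The parity relation and its mirror image are two linear relations between
  \<open>x\<close> and \<open>y\<close>. In both cases their determinant
  \<open>q * q' - p * p'\<close> is odd, so it kills only the identity among elements of 2-power
  order.\<close>

theorem mac_two_order:
  assumes mac: "mac \<alpha> \<beta> A B" and A: "A ^ (2 ^ K) = 1" and B: "B ^ (2 ^ K) = 1"
    and a: "tv m (\<alpha> - 1)" and b: "tv m (\<beta> - 1)" and l: "tv l (\<alpha> - \<beta>)"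
    and ml: "2 \<le> m" "m < l" "l < 2 * m" "2 * l + 2 \<le> 3 * m"
  shows "A ^ (2 ^ (l + m)) = 1" "B ^ (2 ^ (l + m)) = 1"
proof -
  define K' where "K' = K + 4 * m"
  have A': "A ^ (2 ^ K') = 1" and B': "B ^ (2 ^ K') = 1"
    using A B by (simp_all add: K'_def power_add power_mult)
  define x where "x = A ^ (2 ^ (l + m))"
  define y where "y = B ^ (2 ^ (l + m))"
  have z: "zp A (2 ^ (l + m) * c) = zp x c" "zp B (2 ^ (l + m) * c) = zp y c" for c
    using zp_of_nat[of A "2 ^ (l + m)"] zp_of_nat[of B "2 ^ (l + m)"] by (simp_all add: zp_mult x_def y_def)
  have fin: "x ^ (2 ^ K) = 1" "y ^ (2 ^ K) = 1"
    using A B by (simp_all add: x_def y_def mult.commute flip: power_mult) (simp_all add: power_mult)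
  obtain q p where 1: "zp x q = zp y p" "even p \<longleftrightarrow> 2 * l + 2 < 3 * m" "even q \<longleftrightarrow> 2 * l + 2 = 3 * m"
    using mac_two_star_parity[OF mac A' B' _ a b l ml] z K'_def by (metis le_add2)
  have l': "tv l (\<beta> - \<alpha>)" using tv_uminus[OF l] by simp
  obtain q' p' where 2: "zp y q' = zp x p'" "even p' \<longleftrightarrow> 2 * l + 2 < 3 * m" "even q' \<longleftrightarrow> 2 * l + 2 = 3 * m"
    using mac_two_star_parity[OF mac_sym[OF mac] B' A' _ b a l' ml] z K'_def by (metis le_add2)
  have par: "odd (q * q' - p * p')" using 1 2 ml(4) by auto
  have "zp x (q * q') = zp x (p * p')"
    by (metis 1(1) 2(1) zp_mult mult.commute)
  then have "zp x (q * q' - p * p') = 1" by (simp add: zp_diff)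
  then show "A ^ (2 ^ (l + m)) = 1" using odd_power_eq_one[OF fin(1) _ par] by (simp add: x_def)
  have "zp y (q * q') = zp y (p * p')"
    by (metis 1(1) 2(1) zp_mult mult.commute)
  then have "zp y (q * q' - p * p') = 1" by (simp add: zp_diff)
  then show "B ^ (2 ^ (l + m)) = 1" using odd_power_eq_one[OF fin(2) _ par] by (simp add: y_def)
qed

text \<open>As \<open>d\<close> has valuation \<open>l\<close>, \<open>\<alpha> ^ d\<close> and
  \<open>\<beta> ^ d\<close> are 1 modulo \<open>2 ^ (l + m)\<close>, so \<open>C ^ d\<close> is
  central. The relation between \<open>A ^ y\<close>, \<open>C ^ d\<close> and \<open>B ^ h\<close>
  makes the other two central as well, and odd factors of the exponents can be inverted.\<close>

theorem mac_two_structure: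
  assumes mac: "mac \<alpha> \<beta> A B" and A: "A ^ (2 ^ (l + m)) = 1" and B: "B ^ (2 ^ (l + m)) = 1"
    and a: "tv m (\<alpha> - 1)" and b: "tv m (\<beta> - 1)" and l: "tv l (\<alpha> - \<beta>)"
    and ml: "2 \<le> m" "m < l" "l < 2 * m"
  shows "A ^ (2 ^ (2 * m - 1)) * B = B * A ^ (2 ^ (2 * m - 1))"
    and "B ^ (2 ^ (2 * m - 1)) * A = A * B ^ (2 ^ (2 * m - 1))"
    and "\<exists>x y. gc A B ^ (2 ^ l) = zp A (2 ^ (2 * m - 1) * x) * zp B (2 ^ (2 * m - 1) * y)"
proof -
  define K where "K = l + m"
  note A = A[folded K_def] and B = B[folded K_def]
  define C where "C = gc A B"
  obtain \<alpha>' \<beta>' where r: "0 < \<beta>'" "\<beta>' < \<alpha>'" "2 ^ K dvd \<alpha> - \<alpha>'" "2 ^ K dvd \<beta> - \<beta>'"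
    using positive_representatives .
  have mac': "mac \<alpha>' \<beta>' A B" using mac_cong[OF mac A B r(3,4)] .
  have v: "tv m (\<alpha>' - 1)" "tv m (\<beta>' - 1)" "tv l (\<alpha>' - \<beta>')"
    using tv_shift[OF a r(3), of 1] tv_shift[OF b r(4), of 1] tv_shift[OF l r(3,4)] ml K_def by auto
  define d where "d = nat (\<alpha>' - \<beta>')"
  have d: "int d = \<alpha>' - \<beta>'" using r by (simp add: d_def)
  obtain y h where y: "tv (2 * m - 1) y" and h: "tv (2 * m - 1) h" and yh: "zp A y * C ^ d = zp B h"
    using mac_two_relation[OF mac' A B ml(1) v(1,2) r(1,2)] by (auto simp: C_def d_def)
  have dv: "2 ^ K dvd x ^ d - 1" if "tv m (x - 1)" for x
    using tv_dvd[OF tv_power_minus_one[OF that ml(1), of l d], of K] v(3) d by (simp add: K_def)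
  have CA: "C ^ d * A = A * C ^ d"
    using mac_swapA[OF mac', of 1 d] zp_two_power[OF A dv[OF v(1)]] by (simp add: C_def)
  have CB: "C ^ d * B = B * C ^ d"
    using mac_swapB[OF mac', of d 1] zp_two_power[OF B dv[OF v(2)]] by (simp add: C_def)
  have "zp B h * A = A * zp B h"
    unfolding yh[symmetric] using CA commute_zp[of A A y] by (intro commute_mult) auto
  moreover have "zp A y * B = B * zp A y"
  proof -
    have "zp A y = zp B h * ginv (C ^ d)" using yh by (simp add: grp_solve_right)
    then show ?thesis using commute_zp[of B B h] commute_ginv[OF CB] by (simp add: commute_mult)
  qed
  moreover have tv_gen: "x ^ (2 ^ (2 * m - 1)) * g = g * x ^ (2 ^ (2 * m - 1))"
    if com: "zp x k * g = g * zp x k" and tk: "tv (2 * m - 1) k" and xK: "x ^ (2 ^ K) = 1" for x g :: 'a and k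
  proof -
    obtain z where z: "odd z" "k = 2 ^ (2 * m - 1) * z" using tk by (auto simp: tv_def)
    obtain w where w: "2 ^ K dvd z * w - 1" using odd_inverse_mod[OF z(1)] by blast
    have "zp (zp x k) w = zp x (2 ^ (2 * m - 1) * (z * w))" by (simp add: z mult.assoc flip: zp_mult)
    also have "\<dots> = zp x (2 ^ (2 * m - 1))"
    proof (rule zp_two_power[OF xK])
      have "2 ^ (2 * m - 1) * (z * w) - 2 ^ (2 * m - 1) = 2 ^ (2 * m - 1) * (z * w - 1)"
        by (simp add: algebra_simps)
      then show "2 ^ K dvd 2 ^ (2 * m - 1) * (z * w) - 2 ^ (2 * m - 1)" using w by (metis dvd_mult)
    qed
    also have "\<dots> = x ^ (2 ^ (2 * m - 1))" using zp_of_nat[of x "2 ^ (2 * m - 1)"] by simp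
    finally show ?thesis using commute_zp[OF com, of w] by simp
  qed
  ultimately show "A ^ (2 ^ (2 * m - 1)) * B = B * A ^ (2 ^ (2 * m - 1))"
    and "B ^ (2 ^ (2 * m - 1)) * A = A * B ^ (2 ^ (2 * m - 1))"
    using y h A B by blast+
  have "even (\<alpha> - 1)" using tv_dvd[OF a, of 1] ml by simp
  then have CK: "C ^ (2 ^ K) = 1" using mac_comm_two_power[OF mac A] by (simp add: C_def)
  obtain u where u: "odd u" "\<alpha>' - \<beta>' = 2 ^ l * u" using v(3) by (auto simp: tv_def)
  obtain w where w: "2 ^ K dvd u * w - 1" using odd_inverse_mod[OF u(1)] by blast
  have "zp C (int d * w) = zp C (2 ^ l)"
  proof (rule zp_two_power[OF CK])
    have "int d * w - 2 ^ l = 2 ^ l * (u * w - 1)" using d u by (simp add: algebra_simps)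
    then show "2 ^ K dvd int d * w - 2 ^ l" using w by (metis dvd_mult)
  qed
  then have "C ^ (2 ^ l) = zp (C ^ d) w" using zp_of_nat[of C "2 ^ l"] by (simp add: zp_mult zp_of_nat)
  also have "C ^ d = zp A (- y) * zp B h" using yh by (simp add: zp_minus grp_solve_left)
  also have "zp (zp A (- y) * zp B h) w = zp (zp A (- y)) w * zp (zp B h) w"
    using \<open>zp B h * A = A * zp B h\<close> by (intro zp_mult_distrib) (metis commute_zp)
  finally have e: "C ^ (2 ^ l) = zp A (- y * w) * zp B (h * w)" by (simp only: zp_mult)
  obtain y' h' where "y = 2 ^ (2 * m - 1) * y'" "h = 2 ^ (2 * m - 1) * h'" using y h by (auto simp: tv_def)
  then have "C ^ (2 ^ l) = zp A (2 ^ (2 * m - 1) * (- y' * w)) * zp B (2 ^ (2 * m - 1) * (h' * w))"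
    using e by (simp add: mult.assoc)
  then show "\<exists>x y. gc A B ^ (2 ^ l) = zp A (2 ^ (2 * m - 1) * x) * zp B (2 ^ (2 * m - 1) * y)"
    unfolding C_def by blast
qed

section \<open>The action on the cosets of a cyclic subgroup\<close>

text \<open>Permutation model of the action on the cosets of \<open>\<langle>a\<rangle>\<close>: the pair \<open>(k, j)\<close> stands for \<open>\<langle>a\<rangle> c ^ k b ^ j\<close>, and
  pairs are identified modulo the lattice spanned by \<open>(2 ^ l, - x)\<close> and \<open>(0, 2 ^ (l + m))\<close>. Here \<open>\<alpha> = 1 + 2 * g\<close>,
  \<open>\<beta> = 1 + 2 * h\<close>, and \<open>\<theta>\<close>, \<open>\<gamma>\<close> are inverses of \<open>3\<close> and \<open>\<beta>\<close>. Since \<open>h ^ 3\<close> vanishes modulo \<open>2 ^ (l + m)\<close>, the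
  exponent \<open>\<beta> + \<dots> + \<beta> ^ j\<close> in \<open>a\<^sup>-\<^sup>1 b ^ j a = c ^ - j b ^ (\<beta> + \<dots> + \<beta> ^ j)\<close> is the polynomial \<open>f j\<close>. The value of
  \<open>x\<close> is forced by \<open>a c = c a ^ \<alpha>\<close>.\<close>

locale coset_model =
  fixes l m :: nat and g h u \<theta> x \<gamma> :: int
  assumes lm: "m < l" "l + 3 \<le> 2 * m" "2 * l + 2 \<le> 3 * m"
    and g_dvd: "2 ^ (m - 1) dvd g" and h_dvd: "2 ^ (m - 1) dvd h"
    and gh: "g - h = 2 ^ (l - 1) * u"
    and \<theta>: "2 ^ (l + m) dvd 3 * \<theta> - 1"
    and \<gamma>: "2 ^ (l + m) dvd (1 + 2 * h) * \<gamma> - 1"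
    and x: "2 ^ (l + m) dvd x * u - 2 * h * (2 * g - h)" "tv (2 * m - 1) x"
begin

abbreviation M :: int where "M \<equiv> 2 ^ (l + m)"

definition f :: "int \<Rightarrow> int" where
  "f j = j + h * (j * (j + 1)) + 2 * h ^ 2 * \<theta> * (j ^ 3 - j)"

text \<open>Right multiplications of \<open>\<langle>a\<rangle> c ^ k b ^ j\<close>. In
  \<open>pa\<close> the factor \<open>a\<close> moves left past \<open>b ^ j\<close>, leaves
  \<open>c ^ - j b ^ f j\<close> behind and is absorbed by \<open>\<langle>a\<rangle>\<close>; in
  \<open>pc\<close> the factor \<open>c\<close> conjugates \<open>b ^ j\<close>, which inverts the
  exponent \<open>\<beta>\<close>.\<close>

definition pa :: "int \<times> int \<Rightarrow> int \<times> int" where "pa p = (fst p - snd p, f (snd p))"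
definition pb :: "int \<times> int \<Rightarrow> int \<times> int" where "pb p = (fst p, snd p + 1)"
definition pb' :: "int \<times> int \<Rightarrow> int \<times> int" where "pb' p = (fst p, snd p - 1)"
definition pc :: "int \<times> int \<Rightarrow> int \<times> int" where "pc p = (fst p + 1, \<gamma> * snd p)"

lemma fst_pa [simp]: "fst (pa p) = fst p - snd p" and snd_pa [simp]: "snd (pa p) = f (snd p)"
  by (simp_all add: pa_def)

definition eqv :: "int \<times> int \<Rightarrow> int \<times> int \<Rightarrow> bool" where
  "eqv p q \<longleftrightarrow> (\<exists>z. fst q = fst p + 2 ^ l * z \<and> M dvd snd p - snd q - x * z)"

lemma eqvI: "fst q = fst p + 2 ^ l * z \<Longrightarrow> M dvd snd p - snd q - x * z \<Longrightarrow> eqv p q"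
  unfolding eqv_def by blast

lemma eqv_refl: "eqv p p"
  by (rule eqvI[of _ _ 0]) simp_all

lemma eqv_sym: "eqv p q \<Longrightarrow> eqv q p"
  unfolding eqv_def
proof (elim exE conjE)
  fix z assume z: "fst q = fst p + 2 ^ l * z" "M dvd snd p - snd q - x * z"
  have "snd q - snd p - x * (- z) = - (snd p - snd q - x * z)" by simp
  then have "M dvd snd q - snd p - x * (- z)" using z(2) by (metis dvd_minus_iff)
  then show "\<exists>z. fst p = fst q + 2 ^ l * z \<and> M dvd snd q - snd p - x * z"
    using z(1) by (intro exI[of _ "- z"]) simp
qed

lemma eqv_trans: "eqv p q \<Longrightarrow> eqv q r \<Longrightarrow> eqv p r"
  unfolding eqv_def
proof (elim exE conjE)
  fix z w assume z: "fst q = fst p + 2 ^ l * z" "M dvd snd p - snd q - x * z"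
    and w: "fst r = fst q + 2 ^ l * w" "M dvd snd q - snd r - x * w"
  have "snd p - snd r - x * (z + w) = (snd p - snd q - x * z) + (snd q - snd r - x * w)"
    by (simp add: algebra_simps)
  then have "M dvd snd p - snd r - x * (z + w)" using z(2) w(2) by (metis dvd_add)
  then show "\<exists>z. fst r = fst p + 2 ^ l * z \<and> M dvd snd p - snd r - x * z"
    using z(1) w(1) by (intro exI[of _ "z + w"]) (simp add: algebra_simps)
qed

lemma M_dvd_power: "l + m \<le> k \<Longrightarrow> M dvd 2 ^ k"
  by (rule le_imp_power_dvd)

lemma M_dvd_mult: "2 ^ i dvd y \<Longrightarrow> 2 ^ k dvd z \<Longrightarrow> l + m \<le> i + k \<Longrightarrow> M dvd y * z"
proof -
  assume "2 ^ i dvd y" "2 ^ k dvd z" "l + m \<le> i + k"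
  then have "2 ^ (i + k) dvd y * z" by (simp add: power_add mult_dvd_mono)
  then show ?thesis using M_dvd_power[OF \<open>l + m \<le> i + k\<close>] by (rule dvd_trans[rotated])
qed

lemma x_dvd: "2 ^ (2 * m - 1) dvd x"
  using tv_dvd[OF x(2) order_refl] .

lemma M_h3: "M dvd h ^ 3 * y"
proof -
  have hh: "2 ^ (m - 1 + (m - 1)) dvd h * h" using h_dvd by (simp add: power_add mult_dvd_mono)
  have "M dvd h * (h * h)" using M_dvd_mult[OF h_dvd hh] lm by simp
  then have "M dvd h * (h * h) * y" by (rule dvd_mult2)
  then show "M dvd h ^ 3 * y" by (simp only: power3_eq_cube mult.assoc)
qed

lemma M_hx: "M dvd h * (x * y)"
proof -
  have "M dvd h * x" using M_dvd_mult[OF h_dvd x_dvd] lm by simp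
  then have "M dvd h * x * y" by (rule dvd_mult2)
  then show ?thesis by (simp only: mult.assoc)
qed

text \<open>Moving the first coordinate by \<open>2 ^ (2 * m - 1)\<close> takes
  \<open>2 ^ (2 * m - 1 - l)\<close> lattice vectors, and their second coordinates add up to
  valuation at least \<open>4 * m - 2 - l \<ge> l + m\<close>. So first coordinates are needed only
  modulo \<open>2 ^ (2 * m - 1)\<close>.\<close>

lemma eqv_shift:
  assumes "2 ^ (2 * m - 1) dvd fst q - fst p" "M dvd snd p - snd q"
  shows "eqv p q"
proof -
  obtain w where w: "fst q - fst p = 2 ^ (2 * m - 1) * w" using assms(1) by (elim dvdE)
  have e: "2 * m - 1 = l + (2 * m - 1 - l)" using lm by simp
  have "(2::int) ^ (2 * m - 1) = 2 ^ l * 2 ^ (2 * m - 1 - l)" by (subst e) (simp only: power_add)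
  then have 1: "fst q = fst p + 2 ^ l * (2 ^ (2 * m - 1 - l) * w)" using w by simp
  have "M dvd x * 2 ^ (2 * m - 1 - l)"
    using M_dvd_mult[OF x_dvd dvd_refl] lm by simp
  then have "M dvd x * 2 ^ (2 * m - 1 - l) * w" by (rule dvd_mult2)
  then have "M dvd x * (2 ^ (2 * m - 1 - l) * w)" by (simp only: mult.assoc)
  then have "M dvd snd p - snd q - x * (2 ^ (2 * m - 1 - l) * w)" using assms(2) by (rule dvd_diff[rotated])
  then show ?thesis using 1 by (rule eqvI[rotated])
qed

lemma f_diff: "f (j + e) - f j - e = h * e * (2 * j + 1 + e + 2 * h * \<theta> * (3 * j ^ 2 + 3 * j * e + e ^ 2 - 1))"
  by (simp add: f_def algebra_simps power2_eq_square power3_eq_cube)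

lemma f_cong: "M dvd i - j \<Longrightarrow> M dvd f i - f j"
proof -
  assume "M dvd i - j"
  then obtain c where "i = j + M * c" by (metis add.commute diff_eq_eq dvdE)
  then have "f i - f j = M * c * (1 + h * (2 * j + 1 + M * c + 2 * h * \<theta> * (3 * j ^ 2 + 3 * j * (M * c) + (M * c) ^ 2 - 1)))"
    using f_diff[of j "M * c"] by (simp add: algebra_simps)
  then show ?thesis by (simp add: mult.assoc)
qed

lemma pa_eqv: "eqv p q \<Longrightarrow> eqv (pa p) (pa q)"
  unfolding eqv_def
proof (elim exE conjE)
  fix z assume z: "fst q = fst p + 2 ^ l * z" "M dvd snd p - snd q - x * z"
  define j where "j = snd q"
  obtain w where w: "snd p - snd q - x * z = M * w" using z(2) by (elim dvdE)
  have p: "snd p = j + (x * z + M * w)" using w by (simp add: j_def)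
  have "l \<le> 2 * m - 1" using lm by simp
  then have "2 ^ l dvd x" by (rule tv_dvd[OF x(2)])
  then obtain x1 where x1: "x = 2 ^ l * x1" by (elim dvdE)
  have x1d: "2 ^ (2 * m - 1 - l) dvd x1"
  proof -
    have "2 * m - 1 = l + (2 * m - 1 - l)" using lm by simp
    then have "2 ^ l * 2 ^ (2 * m - 1 - l) dvd 2 ^ l * x1" using x_dvd x1 by (metis power_add)
    then show ?thesis by simp
  qed
  \<comment> \<open>\<open>pa\<close> subtracts the second coordinate from the first, so the
    difference \<open>x * z + M * w\<close> enters there, divided by \<open>2 ^ l\<close>. The new
    multiples of \<open>x\<close> vanish modulo \<open>M\<close>.\<close>
  define z' where "z' = z + x1 * z + 2 ^ m * w"
  have "fst (pa q) = fst (pa p) + 2 ^ l * z'"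
    by (simp add: pa_def z(1) p j_def[symmetric] z'_def x1 algebra_simps power_add)
  moreover have "M dvd snd (pa p) - snd (pa q) - x * z'"
  proof -
    have a: "M dvd f (snd p) - f (j + x * z)" by (rule f_cong) (simp add: p)
    have b: "M dvd f (j + x * z) - f j - x * z"
      unfolding f_diff using M_hx[of z] by (rule dvd_mult2)
    have "M dvd x * x1" using M_dvd_mult[OF x_dvd x1d] lm by simp
    moreover have "M dvd x * 2 ^ m" using M_dvd_mult[OF x_dvd dvd_refl] lm by simp
    ultimately have c: "M dvd x * x1 * z + x * 2 ^ m * w" by (rule dvd_add[OF dvd_mult2 dvd_mult2])
    have "snd (pa p) - snd (pa q) - x * z' = (f (snd p) - f (j + x * z)) + (f (j + x * z) - f j - x * z) - (x * x1 * z + x * 2 ^ m * w)"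
      by (simp add: pa_def j_def z'_def algebra_simps)
    then show ?thesis using dvd_diff[OF dvd_add[OF a b] c] by (simp only:)
  qed
  ultimately show "\<exists>z. fst (pa q) = fst (pa p) + 2 ^ l * z \<and> M dvd snd (pa p) - snd (pa q) - x * z" by blast
qed

lemma pb_eqv: "eqv p q \<Longrightarrow> eqv (pb p) (pb q)" and pb'_eqv: "eqv p q \<Longrightarrow> eqv (pb' p) (pb' q)"
  unfolding eqv_def by (auto simp: pb_def pb'_def)

lemma M_\<gamma>x: "M dvd \<gamma> * x - x"
proof -
  have "M dvd ((1 + 2 * h) * \<gamma> - 1) * x - 2 * \<gamma> * (h * (x * 1))"
    by (rule dvd_diff[OF dvd_mult2[OF \<gamma>] dvd_mult[OF M_hx]])
  then show ?thesis by (simp add: algebra_simps)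
qed

lemma pc_eqv: "eqv p q \<Longrightarrow> eqv (pc p) (pc q)"
  unfolding eqv_def
proof (elim exE conjE)
  fix z assume z: "fst q = fst p + 2 ^ l * z" "M dvd snd p - snd q - x * z"
  have "snd (pc p) - snd (pc q) - x * z = \<gamma> * (snd p - snd q - x * z) + (\<gamma> * x - x) * z"
    by (simp add: pc_def algebra_simps)
  then have "M dvd snd (pc p) - snd (pc q) - x * z" using z(2) M_\<gamma>x by simp
  then show "\<exists>z. fst (pc q) = fst (pc p) + 2 ^ l * z \<and> M dvd snd (pc p) - snd (pc q) - x * z"
    using z(1) by (intro exI[of _ z]) (simp add: pc_def)
qed

text \<open>The recursion of \<open>\<beta> + ... + \<beta> ^ j\<close>, which the polynomial
  \<open>f\<close> satisfies only up to \<open>h ^ 3\<close> and the error in the inverse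
  \<open>\<theta>\<close> of 3.\<close>

lemma f_Suc: "M dvd f (j + 1) - (1 + 2 * h) * (f j + 1)"
proof -
  have "f (j + 1) - (1 + 2 * h) * (f j + 1) = 2 * h ^ 2 * (j + j ^ 2) * (3 * \<theta> - 1) + h ^ 3 * (4 * \<theta> * (j - j ^ 3))"
    by (simp add: f_def algebra_simps power2_eq_square power3_eq_cube)
  then show ?thesis using \<theta> M_h3 by simp
qed

text \<open>The identity \<open>a b = b a [a, b]\<close>, read in the order of application; it
  identifies \<open>pc\<close> as the action of the commutator.\<close>

lemma pab: "eqv (pb (pa p)) (pc (pa (pb p)))"
proof (rule eqvI[of _ _ 0])
  show "fst (pc (pa (pb p))) = fst (pb (pa p)) + 2 ^ l * 0"
    by (simp add: pa_def pb_def pc_def)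
  define j where "j = snd p"
  have "M dvd (- \<gamma>) * (f (j + 1) - (1 + 2 * h) * (f j + 1)) - ((1 + 2 * h) * \<gamma> - 1) * (f j + 1)"
    by (rule dvd_diff[OF dvd_mult[OF f_Suc] dvd_mult2[OF \<gamma>]])
  moreover have "(- \<gamma>) * (f (j + 1) - (1 + 2 * h) * (f j + 1)) - ((1 + 2 * h) * \<gamma> - 1) * (f j + 1) = f j + 1 - \<gamma> * f (j + 1)"
    by (simp add: algebra_simps)
  ultimately show "M dvd snd (pb (pa p)) - snd (pc (pa (pb p))) - x * 0"
    by (simp add: pa_def pb_def pc_def j_def)
qed

section \<open>Iterates of \<open>pa\<close>, and the first defining relation in the model\<close>

definition tri :: "nat \<Rightarrow> int" where "tri n = int (\<Sum>i<n. i)"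

lemma tri_Suc: "tri (Suc n) = tri n + int n" and tri_0 [simp]: "tri 0 = 0"
  by (simp_all add: tri_def)

lemma tri_double: "2 * tri n = int n * (int n - 1)"
  by (induction n) (simp_all add: tri_Suc algebra_simps)

text \<open>The \<open>n\<close>-th iterate of \<open>f\<close>, up to terms in \<open>h ^ 3\<close>.\<close>

definition it :: "nat \<Rightarrow> int \<Rightarrow> int" where
  "it n j = j + h * (int n * (j * (j + 1)) + h * (2 * int n * \<theta> * (j ^ 3 - j) + tri n * (j * (j + 1) * (2 * j + 1))))"

lemma f_it: "M dvd f (it n j) - it (Suc n) j"
proof -
  define G where "G = 2 * int n * \<theta> * (j ^ 3 - j) + tri n * (j * (j + 1) * (2 * j + 1))"
  define E where "E = int n * (j * (j + 1)) + h * G"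
  have fe: "f (j + h * E) = j + h * E + h * (j * (j + 1)) + h ^ 2 * E * (2 * j + 1) + 2 * h ^ 2 * \<theta> * (j ^ 3 - j)
      + h ^ 3 * (E ^ 2 + 2 * \<theta> * (3 * j ^ 2 * E + 3 * j * h * E ^ 2 + h ^ 2 * E ^ 3 - E))"
    by (simp add: f_def algebra_simps power2_eq_square power3_eq_cube)
  have "it (Suc n) j = j + h * E + h * (j * (j + 1)) + 2 * h ^ 2 * \<theta> * (j ^ 3 - j) + h ^ 2 * (int n * (j * (j + 1)) * (2 * j + 1))"
    by (simp add: it_def E_def G_def tri_Suc algebra_simps power2_eq_square)
  moreover have "h ^ 2 * E * (2 * j + 1) = h ^ 2 * (int n * (j * (j + 1)) * (2 * j + 1)) + h ^ 3 * (G * (2 * j + 1))"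
    by (simp add: E_def algebra_simps power2_eq_square power3_eq_cube)
  ultimately have "f (j + h * E) - it (Suc n) j = h ^ 3 * (G * (2 * j + 1)) + h ^ 3 * (E ^ 2 + 2 * \<theta> * (3 * j ^ 2 * E + 3 * j * h * E ^ 2 + h ^ 2 * E ^ 3 - E))"
    unfolding fe by linarith
  moreover have "it n j = j + h * E" by (simp add: it_def E_def G_def)
  ultimately show ?thesis using M_h3 by (simp only: dvd_add)
qed

lemma snd_pa_iter: "M dvd snd ((pa ^^ n) (k, j)) - it n j"
proof (induction n)
  case 0
  then show ?case by (simp add: it_def)
next
  case (Suc n)
  have "M dvd (f (snd ((pa ^^ n) (k, j))) - f (it n j)) + (f (it n j) - it (Suc n) j)"
    using f_cong[OF Suc] f_it by (rule dvd_add)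
  then show ?case by simp
qed

lemma two_h_square_dvd: "2 ^ (2 * m - 1) dvd 2 * h ^ 2 * y"
proof -
  have "2 * 2 ^ (m - 1 + (m - 1)) dvd 2 * (h * h)"
    using h_dvd by (intro mult_dvd_mono) (auto simp: power_add mult_dvd_mono)
  moreover have "2 * (2::int) ^ (m - 1 + (m - 1)) = 2 ^ (2 * m - 1)"
  proof -
    have "2 * m - 1 = Suc (m - 1 + (m - 1))" using lm by simp
    then show ?thesis by simp
  qed
  ultimately have "2 ^ (2 * m - 1) dvd 2 * (h * h)" by metis
  then show "2 ^ (2 * m - 1) dvd 2 * h ^ 2 * y" unfolding power2_eq_square by (rule dvd_mult2)
qed

text \<open>The second coordinates of the iterates are summed. Modulo \<open>2 ^ (2 * m - 1)\<close>
  the quadratic terms of \<open>it\<close> drop out: each carries \<open>2 * h ^ 2\<close>, the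
  factor 2 coming from \<open>j * (j + 1)\<close> where it is not explicit.\<close>

lemma fst_pa_iter:
  "2 ^ (2 * m - 1) dvd fst ((pa ^^ n) (k, j)) - (k - int n * j - h * tri n * (j * (j + 1)))"
proof (induction n)
  case (Suc n)
  define q where "q = (pa ^^ n) (k, j)"
  have "2 ^ (2 * m - 1) dvd M" using lm by (intro le_imp_power_dvd) simp
  then have 1: "2 ^ (2 * m - 1) dvd snd q - it n j" using snd_pa_iter[of n k j] dvd_trans by (auto simp: q_def)
  have "even (j * (j + 1))" by simp
  then obtain c where c: "j * (j + 1) = 2 * c" by (elim evenE)
  have "it n j - (j + int n * h * (j * (j + 1))) = 2 * h ^ 2 * (int n * \<theta> * (j ^ 3 - j) + tri n * (c * (2 * j + 1)))"
    unfolding it_def c by (simp add: algebra_simps power2_eq_square)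
  then have 2: "2 ^ (2 * m - 1) dvd it n j - (j + int n * h * (j * (j + 1)))" using two_h_square_dvd by metis
  have "fst ((pa ^^ Suc n) (k, j)) - (k - int (Suc n) * j - h * tri (Suc n) * (j * (j + 1)))
     = (fst q - (k - int n * j - h * tri n * (j * (j + 1)))) - (snd q - it n j) - (it n j - (j + int n * h * (j * (j + 1))))"
    by (simp add: q_def tri_Suc algebra_simps)
  then show ?case using dvd_diff[OF dvd_diff[OF Suc[folded q_def] 1] 2] by (simp only:)
qed simp

text \<open>This is what makes \<open>pa\<close> invertible on classes: \<open>n\<close> and
  \<open>tri n\<close> vanish modulo \<open>2 ^ (2 * m - 1)\<close> for
  \<open>n = 2 ^ (2 * m)\<close>, and \<open>h * 2 ^ (2 * m - 1)\<close> vanishes modulo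
  \<open>M\<close>.\<close>

lemma pa_period: "eqv ((pa ^^ 2 ^ (2 * m)) p) p"
proof -
  obtain k j where p: "p = (k, j)" by (cases p)
  have "2 * tri (2 ^ (2 * m)) = 2 * (2 ^ (2 * m - 1) * (2 ^ (2 * m) - 1))"
  proof -
    have "2 * m = Suc (2 * m - 1)" using lm by simp
    then have "(2::int) ^ (2 * m) = 2 * 2 ^ (2 * m - 1)" by (metis power_Suc)
    then show ?thesis using tri_double[of "2 ^ (2 * m)"] by simp
  qed
  then have t: "tri (2 ^ (2 * m)) = 2 ^ (2 * m - 1) * (2 ^ (2 * m) - 1)" by simp
  have d: "2 ^ (2 * m - 1) dvd (2::int) ^ (2 * m)" by (rule le_imp_power_dvd) simp
  have "2 ^ (2 * m - 1) dvd (fst ((pa ^^ 2 ^ (2 * m)) (k, j)) - (k - int (2 ^ (2 * m)) * j - h * tri (2 ^ (2 * m)) * (j * (j + 1))))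
     - (int (2 ^ (2 * m)) * j + h * tri (2 ^ (2 * m)) * (j * (j + 1)))"
    using d by (intro dvd_diff fst_pa_iter dvd_add) (simp_all add: t)
  then have "2 ^ (2 * m - 1) dvd fst ((pa ^^ 2 ^ (2 * m)) p) - fst p" by (simp add: p)
  then have 1: "2 ^ (2 * m - 1) dvd fst p - fst ((pa ^^ 2 ^ (2 * m)) p)" by (metis dvd_minus_iff minus_diff_eq)
  have "M dvd h * 2 ^ (2 * m)" "M dvd h * 2 ^ (2 * m - 1)"
    using M_dvd_mult[OF h_dvd dvd_refl] lm by simp_all
  then have "M dvd h * 2 ^ (2 * m) * (j * (j + 1) + h * (2 * \<theta> * (j ^ 3 - j)))
      + h * 2 ^ (2 * m - 1) * (h * ((2 ^ (2 * m) - 1) * (j * (j + 1) * (2 * j + 1))))"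
    by (rule dvd_add[OF dvd_mult2 dvd_mult2])
  moreover have "it (2 ^ (2 * m)) j - j = h * 2 ^ (2 * m) * (j * (j + 1) + h * (2 * \<theta> * (j ^ 3 - j)))
      + h * 2 ^ (2 * m - 1) * (h * ((2 ^ (2 * m) - 1) * (j * (j + 1) * (2 * j + 1))))"
    unfolding it_def t by (simp add: algebra_simps)
  ultimately have "M dvd (snd ((pa ^^ 2 ^ (2 * m)) (k, j)) - it (2 ^ (2 * m)) j) + (it (2 ^ (2 * m)) j - j)"
    using dvd_add[OF snd_pa_iter] by metis
  then show ?thesis using 1 by (intro eqv_shift) (simp_all add: p)
qed

text \<open>The relation \<open>a c = c a ^ \<alpha>\<close>, with the exponent free modulo the
  period so that it can be natural. The first coordinates differ by \<open>2 ^ l * (u * i)\<close>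
  up to what \<open>eqv_shift\<close> ignores, so the second ones must differ by
  \<open>x * u * i\<close>; this is where the congruence for \<open>x\<close> comes from.\<close>

lemma pca:
  assumes n: "int n = 1 + 2 * g + 2 ^ (2 * m) * w"
  shows "eqv (pc (pa p)) ((pa ^^ n) (pc p))"
proof -
  obtain k j where p: "p = (k, j)" by (cases p)
  define i where "i = \<gamma> * j"
  define q where "q = (pa ^^ n) (k + 1, i)"
  define g' where "g' = g + 2 ^ (2 * m - 1) * w"
  have mm: "(2::int) ^ (2 * m) = 2 * 2 ^ (2 * m - 1)"
  proof -
    have "2 * m = Suc (2 * m - 1)" using lm by simp
    then show ?thesis by (metis power_Suc)
  qed
  have n': "int n = 1 + 2 * g'" using n by (simp add: g'_def mm)
  have tri: "tri n = g' * int n"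
    using tri_double[of n] n' by (simp add: algebra_simps)
  have g'd: "2 ^ (m - 1) dvd g'"
    unfolding g'_def using g_dvd by (intro dvd_add dvd_mult2 le_imp_power_dvd) auto
  define \<beta> where "\<beta> = 1 + 2 * h"
  have ji: "M dvd j - \<beta> * i"
  proof -
    have "j - \<beta> * i = - ((\<beta> * \<gamma> - 1) * j)" by (simp add: i_def algebra_simps)
    then show ?thesis using \<gamma> by (simp add: \<beta>_def)
  qed
  have hg: "2 ^ (2 * m - 1) dvd h * tri n * (i * (i + 1))"
  proof -
    have "even (i * (i + 1))" by simp
    then obtain c where c: "i * (i + 1) = 2 * c" by (elim evenE)
    have "2 * 2 ^ (m - 1 + (m - 1)) dvd 2 * (h * g')"
      using h_dvd g'd by (intro mult_dvd_mono) (auto simp: power_add mult_dvd_mono)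
    moreover have "2 * m - 1 = Suc (m - 1 + (m - 1))" using lm by simp
    ultimately have "2 ^ (2 * m - 1) dvd 2 * (h * g')" by simp
    then have "2 ^ (2 * m - 1) dvd 2 * (h * g') * (int n * c)" by (rule dvd_mult2)
    then show ?thesis by (simp add: tri c mult_ac)
  qed
  have l1: "(2::int) ^ l = 2 * 2 ^ (l - 1)"
  proof -
    have "l = Suc (l - 1)" using lm by simp
    then show ?thesis by (metis power_Suc)
  qed
  have "\<beta> * i - int n * i = - (2 ^ l * (u * i)) - 2 ^ (2 * m) * (w * i)"
  proof -
    have "\<beta> - int n = - 2 * (g - h) - 2 ^ (2 * m) * w" by (simp add: \<beta>_def n)
    then have "\<beta> - int n = - (2 ^ l * u) - 2 ^ (2 * m) * w" using gh l1 by simp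
    then show ?thesis by (metis left_diff_distrib minus_mult_left mult.assoc)
  qed
  moreover obtain e1 where e1: "j - \<beta> * i = M * e1" using ji by (elim dvdE)
  moreover obtain e2 where e2: "fst q - (k + 1 - int n * i - h * tri n * (i * (i + 1))) = 2 ^ (2 * m - 1) * e2"
    using fst_pa_iter[of n "k + 1" i] by (auto simp: q_def elim: dvdE)
  moreover obtain e3 where e3: "h * tri n * (i * (i + 1)) = 2 ^ (2 * m - 1) * e3" using hg by (elim dvdE)
  ultimately have "fst q = k + 1 - j - 2 ^ l * (u * i) - 2 ^ (2 * m) * (w * i) + M * e1 + 2 ^ (2 * m - 1) * e2 - 2 ^ (2 * m - 1) * e3"
    by linarith
  moreover have "M = 2 ^ (2 * m - 1) * 2 ^ (l + m - (2 * m - 1))"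
    using lm by (simp flip: power_add)
  ultimately have fq: "fst q = k + 1 - j - 2 ^ l * (u * i) + 2 ^ (2 * m - 1) * (- 2 * (w * i) + 2 ^ (l + m - (2 * m - 1)) * e1 + e2 - e3)"
    unfolding mm by (simp add: algebra_simps)

  have "eqv (pc (pa p)) (k + 1 - j - 2 ^ l * (u * i), it n i)"
  proof (rule eqvI[of _ _ "- (u * i)"])
    show "fst (k + 1 - j - 2 ^ l * (u * i), it n i) = fst (pc (pa p)) + 2 ^ l * (- (u * i))"
      by (simp add: p pa_def pc_def)
    have gg: "M dvd g' * h ^ 2 * y" for y
    proof -
      have hh: "2 ^ (m - 1 + (m - 1)) dvd h * h" using h_dvd by (simp add: power_add mult_dvd_mono)
      have "M dvd g' * (h * h)" using M_dvd_mult[OF g'd hh] lm by simp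
      then have "M dvd g' * (h * h) * y" by (rule dvd_mult2)
      then show ?thesis by (simp add: power2_eq_square mult.assoc)
    qed
    \<comment> \<open>An exact expansion: the terms kept on the left are treated in
      \<open>key1\<close> and \<open>key2\<close>, and everything on the right contains
      \<open>g' * h ^ 2\<close> or \<open>h ^ 3\<close>, hence vanishes modulo
      \<open>M\<close>.\<close>
    have key0: "\<beta> * it n i - f (\<beta> * i) - 2 * h * (g' - h) * (i * (i - 1)) - 2 * h * (2 * g' - h) * i
      = g' * h ^ 2 * ((5 * i + 2 * i * g' - 4 * i * \<theta> + 7 * i ^ 2 + 6 * i ^ 2 * g' + 2 * i ^ 3 + 4 * i ^ 3 * g' + 4 * i ^ 3 * \<theta>))
      + h ^ 3 * (2 * i * g' + 4 * i * g' ^ 2 - 8 * i * \<theta> * g' - 4 * i ^ 2 + 6 * i ^ 2 * g' + 12 * i ^ 2 * g' ^ 2 + 4 * i ^ 3 * g' + 8 * i ^ 3 * g' ^ 2 - 8 * i ^ 3 * \<theta> + 8 * i ^ 3 * \<theta> * g' - 24 * h * i ^ 3 * \<theta> - 16 * h ^ 2 * i ^ 3 * \<theta>)"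
      by (simp add: it_def tri n' f_def \<beta>_def algebra_simps power2_eq_square power3_eq_cube)
    have key1: "M dvd 2 * h * (g' - h) * (i * (i - 1))"
    proof -
      have "even (i * (i - 1))" by simp
      then obtain c where c: "i * (i - 1) = 2 * c" by (elim evenE)
      have "2 ^ (l - 1) dvd g' - h"
      proof -
        have "g' - h = 2 ^ (l - 1) * u + 2 ^ (2 * m - 1) * w" using gh by (simp add: g'_def)
        then show ?thesis using lm by (auto intro!: dvd_add dvd_mult2 le_imp_power_dvd)
      qed
      then have "2 ^ (m - 1 + (l - 1)) dvd h * (g' - h)" using h_dvd by (simp add: power_add mult_dvd_mono)
      then have "M dvd 4 * (h * (g' - h))"
        using M_dvd_mult[of 2 4 "m - 1 + (l - 1)" "h * (g' - h)"] lm by simp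
      then have "M dvd 4 * (h * (g' - h)) * c" by (rule dvd_mult2)
      then show ?thesis by (simp add: c mult_ac)
    qed
    have key2: "M dvd 2 * h * (2 * g' - h) * i - x * u * i"
    proof -
      have "2 ^ m dvd 2 * h"
      proof -
        have "2 * 2 ^ (m - 1) dvd 2 * h" using h_dvd by (intro mult_dvd_mono) auto
        moreover have "m = Suc (m - 1)" using lm by simp
        ultimately show ?thesis by (metis power_Suc)
      qed
      then have "M dvd 2 * h * 2 ^ (2 * m)" using M_dvd_mult[of m "2 * h" "2 * m" "2 ^ (2 * m)"] lm by simp
      then have "M dvd 2 * h * 2 ^ (2 * m) * (w * i) - (x * u - 2 * h * (2 * g - h)) * i"
        using dvd_diff[OF dvd_mult2 dvd_mult2[OF x(1)]] by blast
      moreover have "2 * h * 2 ^ (2 * m) * (w * i) - (x * u - 2 * h * (2 * g - h)) * i = 2 * h * (2 * g' - h) * i - x * u * i"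
        unfolding g'_def mm by (simp add: algebra_simps)
      ultimately show ?thesis by simp
    qed
    have fj: "M dvd f j - f (\<beta> * i)" using ji by (rule f_cong)
    have key: "M dvd \<beta> * it n i - f j - x * u * i"
    proof -
      have "M dvd g' * h ^ 2 * y + h ^ 3 * z" for y z by (rule dvd_add[OF gg M_h3])
      then have "M dvd \<beta> * it n i - f (\<beta> * i) - 2 * h * (g' - h) * (i * (i - 1)) - 2 * h * (2 * g' - h) * i"
        unfolding key0 by blast
      then have "M dvd (\<beta> * it n i - f (\<beta> * i) - 2 * h * (g' - h) * (i * (i - 1)) - 2 * h * (2 * g' - h) * i)
        + 2 * h * (g' - h) * (i * (i - 1)) + (2 * h * (2 * g' - h) * i - x * u * i) - (f j - f (\<beta> * i))"
        by (rule dvd_diff[OF dvd_add[OF dvd_add[OF _ key1] key2] fj])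
      then show ?thesis by (simp add: algebra_simps)
    qed
    have "M dvd - (\<gamma> * (\<beta> * it n i - f j - x * u * i)) + (\<beta> * \<gamma> - 1) * it n i - (\<gamma> * x - x) * (u * i)"
      unfolding \<beta>_def
      by (rule dvd_diff[OF dvd_add[OF _ dvd_mult2[OF \<gamma>]] dvd_mult2[OF M_\<gamma>x]])
         (use dvd_mult[OF key, of "- \<gamma>"] in \<open>simp add: \<beta>_def\<close>)
    moreover have "- (\<gamma> * (\<beta> * it n i - f j - x * u * i)) + (\<beta> * \<gamma> - 1) * it n i - (\<gamma> * x - x) * (u * i)
       = \<gamma> * f j - it n i - x * (- (u * i))"
      by (simp add: algebra_simps)
    ultimately show "M dvd snd (pc (pa p)) - snd (k + 1 - j - 2 ^ l * (u * i), it n i) - x * (- (u * i))"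
      by (simp add: p pa_def pc_def)
  qed
  moreover have "eqv (k + 1 - j - 2 ^ l * (u * i), it n i) q"
  proof (rule eqv_shift)
    show "2 ^ (2 * m - 1) dvd fst q - fst (k + 1 - j - 2 ^ l * (u * i), it n i)"
      by (simp add: fq)
    have "M dvd snd q - it n i" using snd_pa_iter by (simp add: q_def)
    then show "M dvd snd (k + 1 - j - 2 ^ l * (u * i), it n i) - snd q" by (metis dvd_minus_iff minus_diff_eq snd_conv)
  qed
  ultimately have "eqv (pc (pa p)) q" by (rule eqv_trans)
  then show ?thesis by (simp add: q_def p pc_def i_def)
qed

end

section \<open>Cayley embedding and the upper central series\<close>

typedef 'a perms = "{f :: 'a \<Rightarrow> 'a. bij f}"
  by (auto intro: exI[of _ id])

instantiation perms :: (type) grp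
begin

definition one_perms :: "'a perms" where "one_perms = Abs_perms id"
definition times_perms :: "'a perms \<Rightarrow> 'a perms \<Rightarrow> 'a perms" where
  "times_perms f g = Abs_perms (Rep_perms f \<circ> Rep_perms g)"
definition ginv_perms :: "'a perms \<Rightarrow> 'a perms" where
  "ginv_perms f = Abs_perms (inv_into UNIV (Rep_perms f))"

instance
proof
  fix f g k :: "'a perms"
  have bij: "bij (Rep_perms f)" for f :: "'a perms" using Rep_perms[of f] by simp
  have rep: "Rep_perms (f * g) = Rep_perms f \<circ> Rep_perms g" for f g :: "'a perms"
    unfolding times_perms_def using bij by (intro Abs_perms_inverse) (simp add: bij_comp)
  have one: "Rep_perms 1 = id" unfolding one_perms_def by (intro Abs_perms_inverse) simp
  have gi: "Rep_perms (ginv f) = inv_into UNIV (Rep_perms f)" for f :: "'a perms"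
    unfolding ginv_perms_def using bij by (intro Abs_perms_inverse) (simp add: bij_imp_bij_inv)
  show "f * g * k = f * (g * k)" "1 * f = f" "f * 1 = f"
    by (simp_all add: Rep_perms_inject[symmetric] rep one comp_assoc)
  show "ginv f * f = 1"
    using bij by (simp add: Rep_perms_inject[symmetric] rep one gi bij_is_inj)
qed

end

locale grp_hom = group G for G (structure) +
  fixes \<phi> :: "'a \<Rightarrow> 'c::grp"
  assumes hom: "x \<in> carrier G \<Longrightarrow> y \<in> carrier G \<Longrightarrow> \<phi> (x \<otimes> y) = \<phi> x * \<phi> y"
begin

lemma hom_one [simp]: "\<phi> \<one> = 1"
proof -
  have "\<phi> \<one> * \<phi> \<one> = \<phi> \<one> * 1" using hom[of \<one> \<one>] by simp
  then show ?thesis by (simp only: grp_left_cancel)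
qed

lemma hom_inv: "x \<in> carrier G \<Longrightarrow> \<phi> (inv x) = ginv (\<phi> x)"
  using hom[of x "inv x"] by (intro ginv_unique[symmetric]) simp

lemma hom_pow: "x \<in> carrier G \<Longrightarrow> \<phi> (x [^] (n::nat)) = \<phi> x ^ n"
proof (induction n)
  case (Suc n)
  then show ?case by (simp add: hom power_Suc2 del: power_Suc)
qed simp

lemma hom_int_pow: "x \<in> carrier G \<Longrightarrow> \<phi> (x [^] (k::int)) = zp (\<phi> x) k"
proof (cases k rule: int_cases2)
  case (nonneg n)
  assume "x \<in> carrier G"
  then show ?thesis by (simp add: nonneg int_pow_int zp_of_nat hom_pow)
next
  case (nonpos n)
  assume "x \<in> carrier G"
  then show ?thesis by (simp add: nonpos int_pow_neg_int zp_of_nat zp_minus hom_inv hom_pow)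
qed

end

definition comm :: "('a, 'b) monoid_scheme \<Rightarrow> 'a \<Rightarrow> 'a \<Rightarrow> 'a" where
  "comm G x y = inv\<^bsub>G\<^esub> x \<otimes>\<^bsub>G\<^esub> inv\<^bsub>G\<^esub> y \<otimes>\<^bsub>G\<^esub> x \<otimes>\<^bsub>G\<^esub> y"

lemma (in group) comm_closed [simp]: "x \<in> carrier G \<Longrightarrow> y \<in> carrier G \<Longrightarrow> comm G x y \<in> carrier G"
  by (simp add: comm_def)

lemma (in grp_hom) hom_comm: "x \<in> carrier G \<Longrightarrow> y \<in> carrier G \<Longrightarrow> \<phi> (comm G x y) = gc (\<phi> x) (\<phi> y)"
  by (simp add: comm_def gc_def hom hom_inv)

text \<open>Extended by the identity outside the carrier, so that it is a permutation of the whole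
  type.\<close>

definition cayley :: "('a, 'b) monoid_scheme \<Rightarrow> 'a \<Rightarrow> 'a perms" where
  "cayley G x = Abs_perms (\<lambda>y. if y \<in> carrier G then x \<otimes>\<^bsub>G\<^esub> y else y)"

lemma (in group) Rep_cayley:
  assumes x: "x \<in> carrier G"
  shows "Rep_perms (cayley G x) = (\<lambda>y. if y \<in> carrier G then x \<otimes> y else y)"
  unfolding cayley_def
proof (rule Abs_perms_inverse, rule CollectI, rule o_bij)
  have "inv x \<otimes> (x \<otimes> y) = y" "x \<otimes> (inv x \<otimes> y) = y" if "y \<in> carrier G" for y
    using that x by (simp_all flip: m_assoc)
  then
  show "(\<lambda>y. if y \<in> carrier G then inv x \<otimes> y else y) \<circ> (\<lambda>y. if y \<in> carrier G then x \<otimes> y else y) = id"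
    "(\<lambda>y. if y \<in> carrier G then x \<otimes> y else y) \<circ> (\<lambda>y. if y \<in> carrier G then inv x \<otimes> y else y) = id"
    using x by (auto simp: fun_eq_iff)
qed

lemma (in group) cayley_hom: "grp_hom G (cayley G)"
proof
  fix x y assume "x \<in> carrier G" "y \<in> carrier G"
  then have "Rep_perms (cayley G (x \<otimes> y)) = Rep_perms (cayley G x) \<circ> Rep_perms (cayley G y)"
    by (auto simp: Rep_cayley m_assoc fun_eq_iff)
  then show "cayley G (x \<otimes> y) = cayley G x * cayley G y"
    unfolding times_perms_def by (metis Rep_perms_inverse)
qed

lemma (in group) cayley_eq_one: "x \<in> carrier G \<Longrightarrow> cayley G x = 1 \<longleftrightarrow> x = \<one>"
proof
  interpret c: grp_hom G "cayley G" by (rule cayley_hom)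
  show "x = \<one> \<Longrightarrow> cayley G x = 1" by simp
  assume x: "x \<in> carrier G" and "cayley G x = 1"
  then have "Rep_perms (cayley G x) \<one> = Rep_perms (cayley G \<one>) \<one>" by simp
  then show "x = \<one>" unfolding Rep_cayley[OF x] Rep_cayley[OF one_closed] using x by simp
qed

text \<open>A homomorphism with kernel \<open>N\<close> for normal \<open>N\<close>: congruences
  modulo \<open>N\<close> become equations in a type of class \<open>grp\<close>.\<close>

definition quot_perm :: "('a, 'b) monoid_scheme \<Rightarrow> 'a set \<Rightarrow> 'a \<Rightarrow> 'a set perms" where
  "quot_perm G N x = cayley (G Mod N) (N #>\<^bsub>G\<^esub> x)"

lemma (in normal) quot_perm_hom: "grp_hom G (quot_perm G H)"
  and quot_perm_eq_one: "x \<in> carrier G \<Longrightarrow> quot_perm G H x = 1 \<longleftrightarrow> x \<in> H"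
proof -
  interpret q: group "G Mod H" by (rule factorgroup_is_group)
  interpret c: grp_hom "G Mod H" "cayley (G Mod H)" by (rule q.cayley_hom)
  have car: "H #> x \<in> carrier (G Mod H)" if "x \<in> carrier G" for x
    using that by (auto simp: FactGroup_def RCOSETS_def)
  show "grp_hom G (quot_perm G H)"
  proof
    fix x y assume xy: "x \<in> carrier G" "y \<in> carrier G"
    then have "H #> (x \<otimes> y) = (H #> x) \<otimes>\<^bsub>G Mod H\<^esub> (H #> y)" by (simp add: FactGroup_def rcos_sum)
    then show "quot_perm G H (x \<otimes> y) = quot_perm G H x * quot_perm G H y"
      using xy car c.hom by (simp add: quot_perm_def)
  qed
  assume x: "x \<in> carrier G"
  have "quot_perm G H x = 1 \<longleftrightarrow> H #> x = H"
    using q.cayley_eq_one[OF car[OF x]] by (simp add: quot_perm_def FactGroup_def)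
  also have "\<dots> \<longleftrightarrow> x \<in> H"
    using coset_join1[OF _ x subgroup_axioms] coset_join2[OF x subgroup_axioms] by blast
  finally show "quot_perm G H x = 1 \<longleftrightarrow> x \<in> H" .
qed

section \<open>The upper central series\<close>

primrec ucs :: "('a, 'b) monoid_scheme \<Rightarrow> nat \<Rightarrow> 'a set" where
  "ucs G 0 = {\<one>\<^bsub>G\<^esub>}"
| "ucs G (Suc n) = {x \<in> carrier G. \<forall>y \<in> carrier G. comm G x y \<in> ucs G n}"

lemma (in group) ucs_normal: "ucs G n \<lhd> G"
proof (induction n)
  case 0
  then show ?case using one_is_normal by simp
next
  case (Suc n)
  interpret N: normal "ucs G n" G by (rule Suc)
  interpret q: grp_hom G "quot_perm G (ucs G n)" by (rule N.quot_perm_hom)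
  let ?q = "quot_perm G (ucs G n)"
  \<comment> \<open>Membership in the next term means that the image modulo \<open>ucs G n\<close>
    is central.\<close>
  have mem: "x \<in> ucs G (Suc n) \<longleftrightarrow> x \<in> carrier G \<and> (\<forall>y \<in> carrier G. ?q x * ?q y = ?q y * ?q x)" for x
    by (auto simp: N.quot_perm_eq_one[symmetric] q.hom_comm gc_eq_one_iff)
  show ?case
    unfolding normal_inv_iff
  proof (intro conjI subgroupI ballI)
    show "ucs G (Suc n) \<subseteq> carrier G" by auto
    have "\<one> \<in> ucs G (Suc n)" unfolding mem by simp
    then show "ucs G (Suc n) \<noteq> {}" by blast
    show "inv x \<in> ucs G (Suc n)" if x: "x \<in> ucs G (Suc n)" for x
    proof -
      have xc: "x \<in> carrier G" and com: "\<And>z. z \<in> carrier G \<Longrightarrow> ?q x * ?q z = ?q z * ?q x" using x mem by blast+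
      show ?thesis
        unfolding mem q.hom_inv[OF xc] using inv_closed[OF xc] commute_ginv[OF com] by blast
    qed
    show "x \<otimes> y \<in> ucs G (Suc n)" if x: "x \<in> ucs G (Suc n)" and y: "y \<in> ucs G (Suc n)" for x y
    proof -
      have xc: "x \<in> carrier G" and com: "\<And>z. z \<in> carrier G \<Longrightarrow> ?q x * ?q z = ?q z * ?q x" using x mem by blast+
      have yc: "y \<in> carrier G" and com': "\<And>z. z \<in> carrier G \<Longrightarrow> ?q y * ?q z = ?q z * ?q y" using y mem by blast+
      show ?thesis
        unfolding mem q.hom[OF xc yc] using m_closed[OF xc yc] commute_mult[OF com com'] by blast
    qed
    show "x \<otimes> y \<otimes> inv x \<in> ucs G (Suc n)" if x: "x \<in> carrier G" and y: "y \<in> ucs G (Suc n)" for x y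
    proof -
      have yc: "y \<in> carrier G" and com: "\<And>z. z \<in> carrier G \<Longrightarrow> ?q y * ?q z = ?q z * ?q y" using y mem by blast+
      have "?q (x \<otimes> y \<otimes> inv x) = ?q x * ?q y * ginv (?q x)" using x yc by (simp add: q.hom q.hom_inv)
      also have "\<dots> = ?q y" unfolding com[OF x, symmetric] by (simp add: mult.assoc)
      finally have "?q (x \<otimes> y \<otimes> inv x) = ?q y" .
      moreover have "x \<otimes> y \<otimes> inv x \<in> carrier G" using x yc by simp
      ultimately show ?thesis unfolding mem using com by presburger
    qed
  qed
qed

lemma (in group) ucs_subset: "ucs G n \<subseteq> carrier G"
  using ucs_normal normal_imp_subgroup subgroup.subset by blast

text \<open>Modulo \<open>ucs G n\<close> the elements commuting with \<open>x\<close> form a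
  subgroup, so generators suffice as a test.\<close>

lemma (in group) ucs_SucI:
  assumes gen: "carrier G = generate G S" and S: "S \<subseteq> carrier G" and x: "x \<in> carrier G"
    and com: "\<And>s. s \<in> S \<Longrightarrow> comm G x s \<in> ucs G n"
  shows "x \<in> ucs G (Suc n)"
proof -
  interpret N: normal "ucs G n" G by (rule ucs_normal)
  interpret q: grp_hom G "quot_perm G (ucs G n)" by (rule N.quot_perm_hom)
  let ?q = "quot_perm G (ucs G n)"
  have mem: "comm G x y \<in> ucs G n \<longleftrightarrow> ?q y * ?q x = ?q x * ?q y" if "y \<in> carrier G" for y
    using that x by (auto simp: N.quot_perm_eq_one[symmetric] q.hom_comm gc_eq_one_iff)
  have "?q y * ?q x = ?q x * ?q y \<and> y \<in> carrier G" if "y \<in> generate G S" for y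
    using that
  proof (induction rule: generate.induct)
    case one
    then show ?case by simp
  next
    case (incl h)
    then show ?case using com mem S by blast
  next
    case (inv h)
    then have "?q h * ?q x = ?q x * ?q h" "h \<in> carrier G" using com mem S by blast+
    then show ?case by (simp add: q.hom_inv commute_ginv)
  next
    case (eng h1 h2)
    then show ?case by (simp add: q.hom commute_mult)
  qed
  then show ?thesis using gen x mem by auto
qed

lemma (in group) ucs_mono: "ucs G n \<subseteq> ucs G (Suc n)"
proof
  fix x assume x: "x \<in> ucs G n"
  interpret N: normal "ucs G n" G by (rule ucs_normal)
  interpret q: grp_hom G "quot_perm G (ucs G n)" by (rule N.quot_perm_hom)
  have xc: "x \<in> carrier G" using x ucs_subset by blast
  then have "quot_perm G (ucs G n) x = 1" using x N.quot_perm_eq_one by blast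
  then have "comm G x y \<in> ucs G n" if "y \<in> carrier G" for y
    using that xc by (simp add: N.quot_perm_eq_one[symmetric] q.hom_comm gc_eq_one_iff)
  then show "x \<in> ucs G (Suc n)" using xc by simp
qed

lemma (in group) lcs_subset_ucs:
  assumes "ucs G c = carrier G" "k \<le> c"
  shows "lcs G k \<subseteq> ucs G (c - k)"
  using assms(2)
proof (induction k)
  case 0
  then show ?case using assms(1) by simp
next
  case (Suc k)
  have e: "c - k = Suc (c - Suc k)" using Suc.prems by simp
  have "subgroup (ucs G (c - Suc k)) G" using ucs_normal normal_imp_subgroup by blast
  moreover have "{inv x \<otimes> inv y \<otimes> x \<otimes> y | x y. x \<in> lcs G k \<and> y \<in> carrier G} \<subseteq> ucs G (c - Suc k)"
    using Suc e by (auto simp: comm_def)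
  ultimately show ?case by (simp add: generate_subgroup_incl)
qed

text \<open>Since the commutator commutes with \<open>x\<close> and \<open>y\<close>, its powers are
  the commutators with powers of \<open>x\<close> and of \<open>y\<close>. So both exponents kill
  it, and Bezout's identity concludes.\<close>

lemma coprime_order_commute:
  assumes "zp x p = 1" "zp y q = 1" "coprime p q"
    and "gc x y * x = x * gc x y" "gc x y * y = y * gc x y"
  shows "gc x y = (1::'a::grp)"
proof -
  let ?z = "gc x y"
  have "cj x y = x * ?z" by (rule cj_gc)
  then have "cj (zp x p) y = zp x p * zp ?z p"
    using assms(4) by (simp add: cj_zp zp_mult_distrib)
  then have 1: "zp ?z p = 1" using assms(1) by simp
  have "cj y x = y * ginv ?z" by (simp add: cj_gc ginv_gc)
  then have "cj (zp y q) x = zp y q * zp (ginv ?z) q"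
    using commute_ginv[OF assms(5)] by (simp add: cj_zp zp_mult_distrib)
  then have "zp (ginv ?z) q = 1" using assms(2) by simp
  then have "zp ?z (- q) = 1" by (metis zp_mult mult_minus1 zp_minus1)
  then have 2: "zp ?z q = 1" by (metis zp_minus ginv_ginv ginv_one)
  obtain a b where "a * p + b * q = 1" using assms(3) by (metis bezout_int coprime_iff_gcd_eq_1)
  then have "zp ?z (p * a + q * b) = ?z" by (simp add: mult.commute)
  then show ?thesis using 1 2 by (simp add: zp_add zp_mult)
qed

text \<open>Descent through the upper central series: modulo each term the commutator is central,
  which is the situation of \<open>coprime_order_commute\<close>.\<close>

lemma (in group) nilpotent_coprime_commute:
  assumes c: "ucs G c = carrier G" and x: "x \<in> carrier G" "x [^] (p::nat) = \<one>"
    and y: "y \<in> carrier G" "y [^] (q::nat) = \<one>" and pq: "coprime p q"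
  shows "x \<otimes> y = y \<otimes> x"
proof -
  have "k \<le> c \<Longrightarrow> comm G x y \<in> ucs G (c - k)" for k
  proof (induction k)
    case 0
    then show ?case using c x y by simp
  next
    case (Suc k)
    interpret N: normal "ucs G (c - Suc k)" G by (rule ucs_normal)
    interpret q: grp_hom G "quot_perm G (ucs G (c - Suc k))" by (rule N.quot_perm_hom)
    let ?q = "quot_perm G (ucs G (c - Suc k))"
    have "c - k = Suc (c - Suc k)" using Suc.prems by simp
    then have com: "comm G (comm G x y) z \<in> ucs G (c - Suc k)" if "z \<in> carrier G" for z
      using Suc that by auto
    have com': "gc (?q x) (?q y) * ?q z = ?q z * gc (?q x) (?q y)" if "z \<in> carrier G" for z
      using com[OF that] that x y by (simp add: N.quot_perm_eq_one[symmetric] q.hom_comm gc_eq_one_iff)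
    have "gc (?q x) (?q y) = 1"
    proof (rule coprime_order_commute)
      show "zp (?q x) (int p) = 1" "zp (?q y) (int q) = 1"
        using x y by (simp_all add: zp_of_nat flip: q.hom_pow)
      show "coprime (int p) (int q)" using pq by simp
    qed (use com' x y in auto)
    then show ?case using x y by (simp add: N.quot_perm_eq_one[symmetric] q.hom_comm)
  qed
  from this[of c] have "comm G x y = \<one>" by simp
  moreover interpret k: grp_hom G "cayley G" by (rule cayley_hom)
  have "cayley G (comm G x y) = 1 \<longleftrightarrow> cayley G x * cayley G y = cayley G y * cayley G x"
    using x y by (simp add: k.hom_comm gc_eq_one_iff)
  ultimately have "cayley G (x \<otimes> y) = cayley G (y \<otimes> x)" using x y by (simp add: k.hom)
  then have "cayley G (x \<otimes> y \<otimes> inv (y \<otimes> x)) = 1"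
    using x y k.hom[of "x \<otimes> y" "inv (y \<otimes> x)"] k.hom_inv[of "y \<otimes> x"] by (simp del: inv_mult_group)
  then have "\<one> = x \<otimes> y \<otimes> inv (y \<otimes> x)" using x y cayley_eq_one by simp
  then show ?thesis using x y inv_solve_right[of \<one> "x \<otimes> y" "y \<otimes> x"] by simp
qed

section \<open>The presented group and its permutation model\<close>

lemma inv_letter_inv [simp]: "inv_letter (inv_letter L) = L"
  by (simp add: inv_letter_def)

lemma winv_Nil [simp]: "winv [] = []" and winv_Cons: "winv (L # w) = winv w @ [inv_letter L]"
  by (simp_all add: winv_def)

lemma winv_winv [simp]: "winv (winv w) = w"
  by (simp add: winv_def rev_map comp_def)

lemma wrel_append: "wrel \<alpha> \<beta> u u' \<Longrightarrow> wrel \<alpha> \<beta> v v' \<Longrightarrow> wrel \<alpha> \<beta> (u @ v) (u' @ v')"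
  using wrel.ctx[of \<alpha> \<beta> u u' "[]" v] wrel.ctx[of \<alpha> \<beta> v v' u' "[]"] by (auto intro: wrel.trans)

lemma wrel_winv_left: "wrel \<alpha> \<beta> (winv w @ w) []"
proof (induction w)
  case Nil
  then show ?case by (simp add: wrel.refl)
next
  case (Cons L w)
  have "wrel \<alpha> \<beta> [inv_letter L, L] []" using wrel.cancel[of \<alpha> \<beta> "inv_letter L"] by simp
  then have "wrel \<alpha> \<beta> (winv w @ [inv_letter L, L] @ w) (winv w @ [] @ w)" by (rule wrel.ctx)
  then show ?case using Cons by (auto simp: winv_Cons intro: wrel.trans)
qed

lemma wclass_eq_iff: "wclass \<alpha> \<beta> u = wclass \<alpha> \<beta> v \<longleftrightarrow> wrel \<alpha> \<beta> u v"
  unfolding wclass_def by (blast intro: wrel.refl wrel.sym wrel.trans)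

lemma wmult_wclass: "wmult \<alpha> \<beta> (wclass \<alpha> \<beta> u) (wclass \<alpha> \<beta> v) = wclass \<alpha> \<beta> (u @ v)"
  unfolding wmult_def wclass_def by (blast intro: wrel.refl wrel.trans wrel_append)

lemma Gpres_mult [simp]: "wclass \<alpha> \<beta> u \<otimes>\<^bsub>Gpres \<alpha> \<beta>\<^esub> wclass \<alpha> \<beta> v = wclass \<alpha> \<beta> (u @ v)"
  and Gpres_one: "\<one>\<^bsub>Gpres \<alpha> \<beta>\<^esub> = wclass \<alpha> \<beta> []"
  and Gpres_carrier: "carrier (Gpres \<alpha> \<beta>) = range (wclass \<alpha> \<beta>)"
  by (simp_all add: Gpres_def wmult_wclass)

lemma wclass_closed [simp]: "wclass \<alpha> \<beta> w \<in> carrier (Gpres \<alpha> \<beta>)"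
  by (simp add: Gpres_carrier)

lemma group_Gpres: "group (Gpres \<alpha> \<beta>)"
proof (rule groupI)
  fix V Y Z assume "V \<in> carrier (Gpres \<alpha> \<beta>)" "Y \<in> carrier (Gpres \<alpha> \<beta>)" "Z \<in> carrier (Gpres \<alpha> \<beta>)"
  then obtain u v w where "V = wclass \<alpha> \<beta> u" "Y = wclass \<alpha> \<beta> v" "Z = wclass \<alpha> \<beta> w"
    by (auto simp: Gpres_carrier)
  then show "V \<otimes>\<^bsub>Gpres \<alpha> \<beta>\<^esub> Y \<otimes>\<^bsub>Gpres \<alpha> \<beta>\<^esub> Z = V \<otimes>\<^bsub>Gpres \<alpha> \<beta>\<^esub> (Y \<otimes>\<^bsub>Gpres \<alpha> \<beta>\<^esub> Z)" by simp
next
  fix V assume "V \<in> carrier (Gpres \<alpha> \<beta>)"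
  then obtain u where u: "V = wclass \<alpha> \<beta> u" by (auto simp: Gpres_carrier)
  show "\<one>\<^bsub>Gpres \<alpha> \<beta>\<^esub> \<otimes>\<^bsub>Gpres \<alpha> \<beta>\<^esub> V = V" by (simp add: u Gpres_one)
  have "wclass \<alpha> \<beta> (winv u) \<otimes>\<^bsub>Gpres \<alpha> \<beta>\<^esub> V = \<one>\<^bsub>Gpres \<alpha> \<beta>\<^esub>"
    by (simp add: u Gpres_one wclass_eq_iff wrel_winv_left)
  then show "\<exists>Y\<in>carrier (Gpres \<alpha> \<beta>). Y \<otimes>\<^bsub>Gpres \<alpha> \<beta>\<^esub> V = \<one>\<^bsub>Gpres \<alpha> \<beta>\<^esub>"
    using wclass_closed by blast
qed (auto simp: Gpres_carrier Gpres_one)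

lemma wclass_inv: "inv\<^bsub>Gpres \<alpha> \<beta>\<^esub> (wclass \<alpha> \<beta> w) = wclass \<alpha> \<beta> (winv w)"
proof -
  interpret group "Gpres \<alpha> \<beta>" by (rule group_Gpres)
  show ?thesis by (rule inv_equality) (simp_all add: Gpres_one wclass_eq_iff wrel_winv_left)
qed

lemma wclass_replicate: "wclass \<alpha> \<beta> (replicate n L) = wclass \<alpha> \<beta> [L] [^]\<^bsub>Gpres \<alpha> \<beta>\<^esub> n"
proof -
  interpret group "Gpres \<alpha> \<beta>" by (rule group_Gpres)
  show ?thesis
  proof (induction n)
    case 0
    then show ?case by (simp add: Gpres_one)
  next
    case (Suc n)
    then show ?case by (simp flip: Suc replicate_append_same)
  qed
qed

lemma wclass_wpow: "wclass \<alpha> \<beta> (wpow L k) = wclass \<alpha> \<beta> [L] [^]\<^bsub>Gpres \<alpha> \<beta>\<^esub> k"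
proof -
  interpret group "Gpres \<alpha> \<beta>" by (rule group_Gpres)
  have i: "wclass \<alpha> \<beta> [inv_letter L] = inv\<^bsub>Gpres \<alpha> \<beta>\<^esub> wclass \<alpha> \<beta> [L]" by (simp add: wclass_inv winv_Cons)
  show ?thesis
  proof (cases k rule: int_cases2)
    case (nonneg n)
    then show ?thesis by (simp add: wpow_def wclass_replicate int_pow_int)
  next
    case (nonpos n)
    then show ?thesis
      by (cases "n = 0") (simp_all add: wpow_def wclass_replicate int_pow_neg_int i nat_pow_inv Gpres_one)
  qed
qed

lemma wclass_wcomm:
  "wclass \<alpha> \<beta> (wcomm u v) = comm (Gpres \<alpha> \<beta>) (wclass \<alpha> \<beta> u) (wclass \<alpha> \<beta> v)"
  by (simp add: wcomm_def comm_def wclass_inv)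

lemma Celt_eq: "Celt \<alpha> \<beta> = comm (Gpres \<alpha> \<beta>) (Aelt \<alpha> \<beta>) (Belt \<alpha> \<beta>)"
  by (simp add: Celt_def Aelt_def Belt_def wclass_wcomm)

lemma Aelt_closed [simp]: "Aelt \<alpha> \<beta> \<in> carrier (Gpres \<alpha> \<beta>)" and Belt_closed [simp]: "Belt \<alpha> \<beta> \<in> carrier (Gpres \<alpha> \<beta>)"
  by (simp_all add: Aelt_def Belt_def)

lemma Gpres_generate: "carrier (Gpres \<alpha> \<beta>) = generate (Gpres \<alpha> \<beta>) {Aelt \<alpha> \<beta>, Belt \<alpha> \<beta>}"
proof -
  interpret group "Gpres \<alpha> \<beta>" by (rule group_Gpres)
  let ?S = "generate (Gpres \<alpha> \<beta>) {Aelt \<alpha> \<beta>, Belt \<alpha> \<beta>}"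
  have letter: "wclass \<alpha> \<beta> [L] \<in> ?S" for L
  proof -
    obtain c e where L: "L = (c, e)" by (cases L)
    define V where "V = (if c then Belt \<alpha> \<beta> else Aelt \<alpha> \<beta>)"
    have "wclass \<alpha> \<beta> [(c, False)] = V" by (simp add: V_def Aelt_def Belt_def LA_def LB_def)
    then have "wclass \<alpha> \<beta> [L] = (if e then inv\<^bsub>Gpres \<alpha> \<beta>\<^esub> V else V)"
      by (auto simp: L wclass_inv winv_Cons inv_letter_def)
    moreover have "V \<in> {Aelt \<alpha> \<beta>, Belt \<alpha> \<beta>}" by (simp add: V_def)
    ultimately show ?thesis by (auto intro: generate.incl generate.inv)
  qed
  have "wclass \<alpha> \<beta> w \<in> ?S" for w
  proof (induction w)
    case Nil
    then show ?case using generate.one by (metis Gpres_one)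
  next
    case (Cons L w)
    have "wclass \<alpha> \<beta> [L] \<otimes>\<^bsub>Gpres \<alpha> \<beta>\<^esub> wclass \<alpha> \<beta> w \<in> ?S"
      using letter Cons by (rule generate.eng)
    then show ?case by simp
  qed
  then have "carrier (Gpres \<alpha> \<beta>) \<subseteq> ?S" by (auto simp: Gpres_carrier)
  then show ?thesis using generate_in_carrier[of "{Aelt \<alpha> \<beta>, Belt \<alpha> \<beta>}"] by auto
qed

lemma Gpres_mac:
  assumes "grp_hom (Gpres \<alpha> \<beta>) \<phi>"
  shows "mac \<alpha> \<beta> (\<phi> (Aelt \<alpha> \<beta>)) (\<phi> (Belt \<alpha> \<beta>))"
proof -
  interpret grp_hom "Gpres \<alpha> \<beta>" \<phi> by (rule assms)
  let ?A = "Aelt \<alpha> \<beta>" and ?B = "Belt \<alpha> \<beta>"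
  have rel: "cj (\<phi> V) (gc (\<phi> V) (\<phi> Y)) = zp (\<phi> V) k"
    if "wrel \<alpha> \<beta> (winv (wcomm [L] [L']) @ [L] @ wcomm [L] [L'] @ wpow L (- k)) []"
      and "V = wclass \<alpha> \<beta> [L]" "Y = wclass \<alpha> \<beta> [L']" for V Y L L' k
  proof -
    have V: "V \<in> carrier (Gpres \<alpha> \<beta>)" "Y \<in> carrier (Gpres \<alpha> \<beta>)" using that by simp_all
    have "inv\<^bsub>Gpres \<alpha> \<beta>\<^esub> comm (Gpres \<alpha> \<beta>) V Y \<otimes>\<^bsub>Gpres \<alpha> \<beta>\<^esub> (V \<otimes>\<^bsub>Gpres \<alpha> \<beta>\<^esub>
      (comm (Gpres \<alpha> \<beta>) V Y \<otimes>\<^bsub>Gpres \<alpha> \<beta>\<^esub> V [^]\<^bsub>Gpres \<alpha> \<beta>\<^esub> (- k))) = \<one>\<^bsub>Gpres \<alpha> \<beta>\<^esub>"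
      using that by (simp add: wclass_eq_iff Gpres_one wclass_inv flip: wclass_wcomm wclass_wpow)
    then have "\<phi> (inv\<^bsub>Gpres \<alpha> \<beta>\<^esub> comm (Gpres \<alpha> \<beta>) V Y \<otimes>\<^bsub>Gpres \<alpha> \<beta>\<^esub> (V \<otimes>\<^bsub>Gpres \<alpha> \<beta>\<^esub>
      (comm (Gpres \<alpha> \<beta>) V Y \<otimes>\<^bsub>Gpres \<alpha> \<beta>\<^esub> V [^]\<^bsub>Gpres \<alpha> \<beta>\<^esub> (- k)))) = 1" by simp
    then have "ginv (gc (\<phi> V) (\<phi> Y)) * (\<phi> V * (gc (\<phi> V) (\<phi> Y) * zp (\<phi> V) (- k))) = 1"
      using V by (simp add: hom hom_inv hom_comm hom_int_pow)
    then have "cj (\<phi> V) (gc (\<phi> V) (\<phi> Y)) * ginv (zp (\<phi> V) k) = 1"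
      by (simp add: cj_def mult.assoc zp_minus)
    then show ?thesis by (metis grp_solve_right ginv_ginv mult_1_left)
  qed
  show ?thesis
    unfolding mac_def
  proof
    show "cj (\<phi> ?A) (gc (\<phi> ?A) (\<phi> ?B)) = zp (\<phi> ?A) \<alpha>"
      using wrel.r1[of \<alpha> \<beta>] by (intro rel[of LA LB]) (simp_all add: rel1_def Aelt_def Belt_def)
    show "cj (\<phi> ?B) (gc (\<phi> ?B) (\<phi> ?A)) = zp (\<phi> ?B) \<beta>"
      using wrel.r2[of \<alpha> \<beta>] by (intro rel[of LB LA]) (simp_all add: rel2_def Aelt_def Belt_def)
  qed
qed

section \<open>Words acting on the model\<close>

context coset_model
begin

abbreviation \<alpha> :: int where "\<alpha> \<equiv> 1 + 2 * g"
abbreviation \<beta> :: int where "\<beta> \<equiv> 1 + 2 * h"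

text \<open>An inverse of \<open>pa\<close> only up to \<open>eqv\<close>, by
  \<open>pa_period\<close>. Words therefore act on representatives, and all relations between them
  are checked up to \<open>eqv\<close>.\<close>

definition pa' :: "int \<times> int \<Rightarrow> int \<times> int" where "pa' = pa ^^ (2 ^ (2 * m) - 1)"

text \<open>Words act from the right, so the first letter is applied first.\<close>

definition actl :: "letter \<Rightarrow> int \<times> int \<Rightarrow> int \<times> int" where
  "actl L = (if fst L then (if snd L then pb' else pb)
     else (if snd L then pa' else pa))"

definition act :: "word \<Rightarrow> int \<times> int \<Rightarrow> int \<times> int" where
  "act w = fold actl w"

lemma act_Nil [simp]: "act [] p = p"
  and act_Cons [simp]: "act (L # w) p = act w (actl L p)"
  and act_append [simp]: "act (w @ v) p = act v (act w p)"
  by (simp_all add: act_def)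

lemma funpow_eqv: "eqv p q \<Longrightarrow> eqv ((pa ^^ n) p) ((pa ^^ n) q)"
  by (induction n) (simp_all add: pa_eqv)

lemma actl_eqv: "eqv p q \<Longrightarrow> eqv (actl L p) (actl L q)"
  by (simp add: actl_def pa_eqv pb_eqv pb'_eqv funpow_eqv pa'_def)

lemma act_eqv: "eqv p q \<Longrightarrow> eqv (act w p) (act w q)"
  by (induction w arbitrary: p q) (simp_all add: actl_eqv)

lemma pb_pb' [simp]: "pb (pb' p) = p" "pb' (pb p) = p"
  by (simp_all add: pb_def pb'_def)

lemma pa_pred: "pa (pa' p) = (pa ^^ 2 ^ (2 * m)) p" "pa' (pa p) = (pa ^^ 2 ^ (2 * m)) p"
proof -
  obtain n where n: "(2::nat) ^ (2 * m) = Suc n" using not0_implies_Suc[of "2 ^ (2 * m)"] by auto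
  show "pa (pa' p) = (pa ^^ 2 ^ (2 * m)) p" "pa' (pa p) = (pa ^^ 2 ^ (2 * m)) p"
    unfolding pa'_def n by (simp_all add: funpow_swap1)
qed

lemma actl_cancel: "eqv (actl (inv_letter L) (actl L p)) p"
  by (auto simp: actl_def inv_letter_def pa_pred pa_period eqv_refl)

lemma act_winv: "eqv (act (winv w) (act w p)) p"
proof (induction w arbitrary: p)
  case (Cons L w)
  have "eqv (actl (inv_letter L) (act (winv w) (act w (actl L p)))) (actl (inv_letter L) (actl L p))"
    by (rule actl_eqv[OF Cons])
  then show ?case using actl_cancel[of L p] eqv_trans by (auto simp: winv_Cons)
qed (simp add: eqv_refl)

lemma pa_period_mult: "eqv ((pa ^^ (2 ^ (2 * m) * q)) p) p"
proof (induction q)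
  case (Suc q)
  have "(pa ^^ (2 ^ (2 * m) * Suc q)) p = (pa ^^ (2 ^ (2 * m))) ((pa ^^ (2 ^ (2 * m) * q)) p)"
    by (simp add: funpow_add)
  then show ?case using funpow_eqv[OF Suc] pa_period eqv_trans by metis
qed (simp add: eqv_refl)

lemma act_replicate: "act (replicate n L) p = (actl L ^^ n) p"
  by (induction n arbitrary: p) (simp_all add: funpow_swap1)

lemma act_wpow_LA: "\<exists>n w. int n = k + 2 ^ (2 * m) * w \<and> (\<forall>p. act (wpow LA k) p = (pa ^^ n) p)"
proof (cases "k \<ge> 0")
  case True
  then show ?thesis
    by (intro exI[of _ "nat k"] exI[of _ 0]) (simp add: wpow_def act_replicate actl_def LA_def)
next
  case False
  define n where "n = nat (- k)"
  have "int ((2 ^ (2 * m) - 1) * n) = k + 2 ^ (2 * m) * int n"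
    using False by (simp add: n_def algebra_simps of_nat_diff)
  moreover have "act (wpow LA k) p = (pa ^^ ((2 ^ (2 * m) - 1) * n)) p" for p
    using False by (simp add: wpow_def act_replicate actl_def LA_def inv_letter_def n_def pa'_def funpow_mult mult.commute)
  ultimately show ?thesis by blast
qed

lemma act_wpow_LB: "act (wpow LB k) p = (fst p, snd p + k)"
proof -
  have "(pb ^^ n) p = (fst p, snd p + int n)" "(pb' ^^ n) p = (fst p, snd p - int n)" for n
    by (induction n) (simp_all add: pb_def pb'_def)
  then show ?thesis by (simp add: wpow_def act_replicate actl_def LB_def inv_letter_def)
qed

lemma act_comm: "eqv (act (wcomm [LA] [LB]) p) (pc p)"
proof -
  \<comment> \<open>The two inverse letters of the commutator have been applied; \<open>pab\<close>
    at \<open>r\<close> replaces the remaining two, and \<open>pa (pb r)\<close> is \<open>p\<close>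
    up to the period.\<close>
  define r where "r = pb' (pa' p)"
  have "act (wcomm [LA] [LB]) p = pb (pa r)"
    by (simp add: wcomm_def winv_Cons inv_letter_def LA_def LB_def actl_def r_def)
  moreover have "eqv (pb (pa r)) (pc (pa (pb r)))" by (rule pab)
  moreover have "pa (pb r) = (pa ^^ 2 ^ (2 * m)) p" by (simp add: r_def pa_pred)
  moreover have "eqv (pc ((pa ^^ 2 ^ (2 * m)) p)) (pc p)" by (rule pc_eqv[OF pa_period])
  ultimately show ?thesis using eqv_trans by metis
qed

text \<open>With \<open>q\<close> the image of \<open>p\<close> under the inverse of
  \<open>C\<close>, \<open>pca\<close> carries \<open>pa\<close> past \<open>C\<close> and yields
  \<open>pa ^^ n\<close> at \<open>p\<close>. The final power of \<open>A\<close> completes the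
  exponent to a multiple of the period.\<close>

lemma act_rel1: "eqv (act (rel1 \<alpha>) p) p"
proof -
  define C where "C = wcomm [LA] [LB]"
  define q where "q = act (winv C) p"
  obtain n w where n: "int n = \<alpha> + 2 ^ (2 * m) * w" using act_wpow_LA[of \<alpha>] by blast
  obtain n' w' where n': "int n' = - \<alpha> + 2 ^ (2 * m) * w'" "\<And>p. act (wpow LA (- \<alpha>)) p = (pa ^^ n') p"
    using act_wpow_LA[of "- \<alpha>"] by blast
  have Cq: "eqv (pc q) p"
    using act_comm[of q] act_winv[of "winv C" p] eqv_sym eqv_trans by (metis C_def q_def winv_winv)
  have "eqv (act C (pa q)) ((pa ^^ n) p)"
    using act_comm[of "pa q", folded C_def] pca[OF n, of q] funpow_eqv[OF Cq, of n] eqv_trans by metis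
  then have "eqv ((pa ^^ n') (act C (pa q))) ((pa ^^ n') ((pa ^^ n) p))" by (rule funpow_eqv)
  moreover have "int (n' + n) = 2 ^ (2 * m) * (w + w')" using n n' by (simp add: algebra_simps)
  then have "2 ^ (2 * m) dvd n' + n" by (metis dvd_triv_left int_dvd_int_iff of_nat_numeral of_nat_power)
  then obtain r where "n' + n = 2 ^ (2 * m) * r" by (elim dvdE)
  then have "eqv ((pa ^^ n') ((pa ^^ n) p)) p" using pa_period_mult[of r p] by (metis comp_apply funpow_add)
  ultimately have "eqv ((pa ^^ n') (act C (pa q))) p" by (rule eqv_trans)
  moreover have "act (rel1 \<alpha>) p = (pa ^^ n') (act C (pa q))"
    unfolding rel1_def act_append n'(2) C_def q_def by (simp add: actl_def LA_def)
  ultimately show ?thesis by simp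
qed

lemma act_rel2: "eqv (act (rel2 \<beta>) p) p"
proof -
  define C where "C = wcomm [LA] [LB]"
  have D: "wcomm [LB] [LA] = winv C" by (simp add: C_def wcomm_def winv_def)
  define r where "r = (fst p, snd p + \<beta>)"
  have "eqv (pb (act C p)) (pb (pc p))" using act_comm pb_eqv by (simp add: C_def)
  moreover have "eqv (pb (pc p)) (pc r)"
  proof (rule eqvI[of _ _ 0])
    have "snd (pb (pc p)) - snd (pc r) - x * 0 = - (\<beta> * \<gamma> - 1)"
      by (simp add: pb_def pc_def r_def algebra_simps)
    then show "M dvd snd (pb (pc p)) - snd (pc r) - x * 0" using \<gamma> by (metis dvd_minus_iff)
  qed (simp add: pb_def pc_def r_def)
  moreover have "eqv (pc r) (act C r)" using act_comm eqv_sym by (simp add: C_def)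
  ultimately have "eqv (pb (act C p)) (act C r)" using eqv_trans by blast
  then have "eqv (act (winv C) (pb (act C p))) (act (winv C) (act C r))" by (rule act_eqv)
  then have "eqv (act (winv C) (pb (act C p))) r" using act_winv eqv_trans by blast
  then have "eqv (act (wpow LB (- \<beta>)) (act (winv C) (pb (act C p)))) (act (wpow LB (- \<beta>)) r)" by (rule act_eqv)
  moreover have "act (wpow LB (- \<beta>)) r = p" unfolding act_wpow_LB by (simp add: r_def)
  moreover have "act (rel2 \<beta>) p = act (wpow LB (- \<beta>)) (act (winv C) (pb (act C p)))"
    unfolding rel2_def D winv_winv by (simp add: actl_def LB_def)
  ultimately show ?thesis by simp
qed

lemma act_wrel: "wrel \<alpha> \<beta> w v \<Longrightarrow> eqv (act w p) (act v p)"
proof (induction arbitrary: p rule: wrel.induct)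
  case (refl w)
  then show ?case by (rule eqv_refl)
next
  case (sym u v)
  then show ?case using eqv_sym by blast
next
  case (trans u v w)
  then show ?case using eqv_trans by blast
next
  case (ctx u v x y)
  then show ?case by (simp add: act_eqv)
next
  case (cancel L)
  then show ?case by (simp add: actl_cancel)
next
  case r1
  then show ?case using act_rel1 by simp
next
  case r2
  then show ?case using act_rel2 by simp
qed

text \<open>A relation and not a function, since an element determines its map only up to
  \<open>eqv\<close> (see \<open>acts_unique\<close>); any convenient map can be named.\<close>

definition acts :: "word set \<Rightarrow> (int \<times> int \<Rightarrow> int \<times> int) \<Rightarrow> bool" where
  "acts V \<phi> \<longleftrightarrow> (\<exists>w. V = wclass \<alpha> \<beta> w \<and> (\<forall>p. eqv (act w p) (\<phi> p)))"

lemma acts_mult: "acts V \<phi> \<Longrightarrow> acts Y \<psi> \<Longrightarrow> acts (V \<otimes>\<^bsub>Gpres \<alpha> \<beta>\<^esub> Y) (\<lambda>p. \<psi> (\<phi> p))"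
  unfolding acts_def
proof (elim exE conjE)
  fix u v assume *: "V = wclass \<alpha> \<beta> u" "\<forall>p. eqv (act u p) (\<phi> p)" "Y = wclass \<alpha> \<beta> v" "\<forall>p. eqv (act v p) (\<psi> p)"
  have "eqv (act (u @ v) p) (\<psi> (\<phi> p))" for p
    using act_eqv[of "act u p" "\<phi> p" v] * eqv_trans by (metis act_append)
  then show "\<exists>w. V \<otimes>\<^bsub>Gpres \<alpha> \<beta>\<^esub> Y = wclass \<alpha> \<beta> w \<and> (\<forall>p. eqv (act w p) (\<psi> (\<phi> p)))"
    using * by (intro exI[of _ "u @ v"]) simp
qed

lemma acts_unique: "acts V \<phi> \<Longrightarrow> acts V \<psi> \<Longrightarrow> eqv (\<phi> p) (\<psi> p)"
  unfolding acts_def using act_wrel eqv_trans eqv_sym by (metis wclass_eq_iff)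

lemma acts_weaken: "acts V \<phi> \<Longrightarrow> (\<And>p. eqv (\<phi> p) (\<psi> p)) \<Longrightarrow> acts V \<psi>"
  unfolding acts_def using eqv_trans by blast

lemma acts_one: "acts \<one>\<^bsub>Gpres \<alpha> \<beta>\<^esub> (\<lambda>p. p)"
  unfolding acts_def by (intro exI[of _ "[]"]) (simp add: Gpres_one eqv_refl)

lemma acts_pow: "acts V \<phi> \<Longrightarrow> acts (V [^]\<^bsub>Gpres \<alpha> \<beta>\<^esub> (n::nat)) (\<phi> ^^ n)"
proof (induction n)
  case 0
  then show ?case using acts_one by (simp add: id_def)
next
  case (Suc n)
  then show ?case using acts_mult[OF Suc.IH[OF Suc.prems] Suc.prems] by (simp add: comp_def)
qed

lemma acts_Aelt: "acts (Aelt \<alpha> \<beta>) pa" and acts_Belt: "acts (Belt \<alpha> \<beta>) pb"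
  unfolding acts_def Aelt_def Belt_def
  by (rule exI[of _ "[LA]"], simp add: actl_def LA_def eqv_refl)
     (rule exI[of _ "[LB]"], simp add: actl_def LB_def eqv_refl)

text \<open>Needed because \<open>c\<close> is the commutator of powers of the generators that
  merely act like them. By \<open>V Y = Y V [V, Y]\<close> and \<open>pab\<close> it acts as
  \<open>pc\<close> on every \<open>pa (pb p)\<close>, and each class contains such a point.\<close>

lemma acts_comm:
  assumes V: "acts V pa" "V \<in> carrier (Gpres \<alpha> \<beta>)" and Y: "acts Y pb" "Y \<in> carrier (Gpres \<alpha> \<beta>)"
  shows "acts (comm (Gpres \<alpha> \<beta>) V Y) pc"
proof -
  interpret G: group "Gpres \<alpha> \<beta>" by (rule group_Gpres)
  interpret k: grp_hom "Gpres \<alpha> \<beta>" "cayley (Gpres \<alpha> \<beta>)" by (rule G.cayley_hom)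
  have "comm (Gpres \<alpha> \<beta>) V Y \<in> carrier (Gpres \<alpha> \<beta>)" using V Y by simp
  then obtain w where w: "comm (Gpres \<alpha> \<beta>) V Y = wclass \<alpha> \<beta> w" by (auto simp: Gpres_carrier)
  then have aw: "acts (comm (Gpres \<alpha> \<beta>) V Y) (act w)" unfolding acts_def using eqv_refl by blast
  have eq: "V \<otimes>\<^bsub>Gpres \<alpha> \<beta>\<^esub> Y = Y \<otimes>\<^bsub>Gpres \<alpha> \<beta>\<^esub> V \<otimes>\<^bsub>Gpres \<alpha> \<beta>\<^esub> comm (Gpres \<alpha> \<beta>) V Y"
  proof -
    have "comm (Gpres \<alpha> \<beta>) V Y = inv\<^bsub>Gpres \<alpha> \<beta>\<^esub> (Y \<otimes>\<^bsub>Gpres \<alpha> \<beta>\<^esub> V) \<otimes>\<^bsub>Gpres \<alpha> \<beta>\<^esub> (V \<otimes>\<^bsub>Gpres \<alpha> \<beta>\<^esub> Y)"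
      using V Y by (simp add: comm_def G.inv_mult_group G.m_assoc)
    then show ?thesis using V Y G.inv_solve_left by (metis G.inv_closed G.m_closed)
  qed
  have "eqv (pb (pa p)) (act w (pa (pb p)))" for p
    using acts_unique[OF acts_mult[OF V(1) Y(1)]] acts_mult[OF acts_mult[OF Y(1) V(1)] aw] eq by metis
  then have 1: "eqv (pc (pa (pb p))) (act w (pa (pb p)))" for p using pab eqv_sym eqv_trans by blast
  have "eqv (act w q) (pc q)" for q
  proof -
    define p where "p = pb' (pa' q)"
    have "eqv (pa (pb p)) q" by (simp add: p_def pa_pred pa_period)
    then show ?thesis using 1[of p] act_eqv pc_eqv eqv_sym eqv_trans by meson
  qed
  then show ?thesis using w unfolding acts_def by blast
qed

lemma pc_iter: "(pc ^^ n) (k, j) = (k + int n, \<gamma> ^ n * j)"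
  by (induction n) (simp_all add: pc_def)

lemma pb_iter: "(pb ^^ n) (k, j) = (k, j + int n)"
  by (induction n) (simp_all add: pb_def)

lemma pa_iter_zero: "(pa ^^ n) (0, 0) = (0, 0)"
  by (induction n) (simp_all add: pa_def f_def)

lemma eqv_reduced:
  assumes "eqv (int k, int j) (int k', int j')" "k < 2 ^ l" "k' < 2 ^ l" "j < 2 ^ (l + m)" "j' < 2 ^ (l + m)"
  shows "k = k' \<and> j = j'"
proof -
  obtain z where z: "int k' = int k + 2 ^ l * z" "M dvd int j - int j' - x * z"
    using assms(1) by (auto simp: eqv_def)
  have b: "int k < 2 ^ l" "int k' < 2 ^ l" "int j < M" "int j' < M"
    using assms(2-5) by (metis of_nat_less_iff of_nat_numeral of_nat_power)+
  have "2 ^ l dvd int k' - int k" using z(1) by simp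
  then have k: "int k' = int k" using b by (metis mod_eq_dvd_iff mod_pos_pos_trivial of_nat_0_le_iff)
  then have "z = 0" using z(1) by simp
  then have "M dvd int j - int j'" using z(2) by simp
  then have "int j = int j'" using b by (metis mod_eq_dvd_iff mod_pos_pos_trivial of_nat_0_le_iff)
  then show ?thesis using k by simp
qed

context
  fixes a b c w assumes w: "2 ^ (4 * m) dvd int w - 1"
    and a: "a = Aelt \<alpha> \<beta> [^]\<^bsub>Gpres \<alpha> \<beta>\<^esub> w"
    and b: "b = Belt \<alpha> \<beta> [^]\<^bsub>Gpres \<alpha> \<beta>\<^esub> w"
    and c: "c = comm (Gpres \<alpha> \<beta>) a b"
begin

text \<open>Passing to the 2-components does not change the action: \<open>w\<close> is 1 modulo
  \<open>2 ^ (4 * m)\<close>, a multiple of the periods \<open>2 ^ (2 * m)\<close> of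
  \<open>pa\<close> and \<open>2 ^ (l + m)\<close> of \<open>pb\<close>.\<close>

lemma acts_abc: "acts a pa" "acts b pb" "acts c pc"
proof -
  interpret G: group "Gpres \<alpha> \<beta>" by (rule group_Gpres)
  have mpos: "m > 0" using lm by simp
  have "w \<noteq> 0"
  proof
    assume "w = 0"
    then have "is_unit ((2::int) ^ (4 * m))" using w by simp
    then show False using mpos by simp
  qed
  then obtain v where v: "w = Suc v" by (cases w) auto
  have dv: "(2::int) ^ (4 * m) dvd int v" using w v by simp
  have "(2::int) ^ (2 * m) dvd int v" by (rule power_le_dvd[OF dv]) simp
  then have "2 ^ (2 * m) dvd v" by (metis int_dvd_int_iff of_nat_numeral of_nat_power)
  then obtain q where q: "v = 2 ^ (2 * m) * q" by (elim dvdE)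
  have "eqv ((pa ^^ w) p) (pa p)" for p
    unfolding v funpow_Suc_right comp_apply q by (rule pa_period_mult)
  then show "acts a pa" unfolding a by (rule acts_weaken[OF acts_pow[OF acts_Aelt]])
  have Mv: "M dvd int v" by (rule power_le_dvd[OF dv]) (use lm in simp)
  have "eqv ((pb ^^ w) p) (pb p)" for p
  proof (rule eqvI[of _ _ 0])
    obtain k j where p: "p = (k, j)" by (cases p)
    show "fst (pb p) = fst ((pb ^^ w) p) + 2 ^ l * 0" unfolding p pb_iter by (simp add: pb_def)
    show "M dvd snd ((pb ^^ w) p) - snd (pb p) - x * 0" unfolding p pb_iter using Mv by (simp add: pb_def v)
  qed
  then show "acts b pb" unfolding b by (rule acts_weaken[OF acts_pow[OF acts_Belt]])
  then show "acts c pc" unfolding c using \<open>acts a pa\<close> by (intro acts_comm) (simp_all add: a b)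
qed

lemma model_b_order: "b [^]\<^bsub>Gpres \<alpha> \<beta>\<^esub> (n::nat) = \<one>\<^bsub>Gpres \<alpha> \<beta>\<^esub> \<Longrightarrow> 2 ^ (l + m) dvd n"
proof -
  assume "b [^]\<^bsub>Gpres \<alpha> \<beta>\<^esub> n = \<one>\<^bsub>Gpres \<alpha> \<beta>\<^esub>"
  then have "eqv ((pb ^^ n) (0, 0)) (0, 0)"
    using acts_unique[OF acts_pow[OF acts_abc(2), of n]] acts_one by metis
  then obtain z where z: "0 = 2 ^ l * z" "M dvd int n - x * z" unfolding pb_iter eqv_def by auto
  then have "z = 0" by simp
  then have "M dvd int n" using z by simp
  then show ?thesis by (metis int_dvd_int_iff of_nat_numeral of_nat_power)
qed

text \<open>The base point \<open>(0, 0)\<close> is the coset \<open>\<langle>a\<rangle>\<close>. It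
  is fixed by \<open>pa\<close>, so the exponent of \<open>a\<close> disappears, and it is moved to
  \<open>(k, j)\<close>.\<close>

lemma model_normal_form:
  fixes i i' k k' j j' :: nat
  assumes "a [^]\<^bsub>Gpres \<alpha> \<beta>\<^esub> i \<otimes>\<^bsub>Gpres \<alpha> \<beta>\<^esub> c [^]\<^bsub>Gpres \<alpha> \<beta>\<^esub> k \<otimes>\<^bsub>Gpres \<alpha> \<beta>\<^esub> b [^]\<^bsub>Gpres \<alpha> \<beta>\<^esub> j
    = a [^]\<^bsub>Gpres \<alpha> \<beta>\<^esub> i' \<otimes>\<^bsub>Gpres \<alpha> \<beta>\<^esub> c [^]\<^bsub>Gpres \<alpha> \<beta>\<^esub> k' \<otimes>\<^bsub>Gpres \<alpha> \<beta>\<^esub> b [^]\<^bsub>Gpres \<alpha> \<beta>\<^esub> j'"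
    and "k < 2 ^ l" "k' < 2 ^ l" "j < 2 ^ (l + m)" "j' < 2 ^ (l + m)"
  shows "k = k' \<and> j = j'"
proof -
  have acts: "acts (a [^]\<^bsub>Gpres \<alpha> \<beta>\<^esub> i \<otimes>\<^bsub>Gpres \<alpha> \<beta>\<^esub> c [^]\<^bsub>Gpres \<alpha> \<beta>\<^esub> k \<otimes>\<^bsub>Gpres \<alpha> \<beta>\<^esub> b [^]\<^bsub>Gpres \<alpha> \<beta>\<^esub> j)
    (\<lambda>p. (pb ^^ j) ((pc ^^ k) ((pa ^^ i) p)))" for i k j :: nat
    by (intro acts_mult acts_pow acts_abc)
  have "eqv ((pb ^^ j) ((pc ^^ k) ((pa ^^ i) (0, 0)))) ((pb ^^ j') ((pc ^^ k') ((pa ^^ i') (0, 0))))"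
    using acts_unique[OF acts[of i k j]] acts[of i' k' j'] assms(1) by metis
  then have "eqv (int k, int j) (int k', int j')" unfolding pa_iter_zero pc_iter pb_iter by simp
  then show ?thesis using assms(2-5) by (rule eqv_reduced)
qed

text \<open>The base point moves to \<open>(2 ^ (2 * l - m), 0)\<close>, equivalent to
  \<open>(0, x * 2 ^ (l - m))\<close>; that entry has valuation \<open>l + m - 1\<close>, just too
  small to vanish modulo \<open>M\<close>.\<close>

lemma model_c_order: "c [^]\<^bsub>Gpres \<alpha> \<beta>\<^esub> ((2::nat) ^ (2 * l - m)) \<noteq> \<one>\<^bsub>Gpres \<alpha> \<beta>\<^esub>"
proof
  assume "c [^]\<^bsub>Gpres \<alpha> \<beta>\<^esub> ((2::nat) ^ (2 * l - m)) = \<one>\<^bsub>Gpres \<alpha> \<beta>\<^esub>"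
  then have "eqv ((pc ^^ (2 ^ (2 * l - m))) (0, 0)) (0, 0)"
    using acts_unique[OF acts_pow[OF acts_abc(3), of "2 ^ (2 * l - m)"]] acts_one by metis
  then obtain z where z: "0 = 2 ^ (2 * l - m) + 2 ^ l * z" "M dvd - (x * z)" unfolding pc_iter eqv_def by auto
  have "2 * l - m = l + (l - m)" using lm by simp
  then have "2 ^ l * z = 2 ^ l * (- (2 ^ (l - m)))" using z(1) by (simp add: power_add)
  then have "2 ^ l * (z + 2 ^ (l - m)) = 0" by (simp add: algebra_simps)
  then have "z = - (2 ^ (l - m))" by simp
  then have "M dvd x * 2 ^ (l - m)" using z(2) by simp
  moreover have "tv (2 * m - 1 + (l - m)) (x * 2 ^ (l - m))"
    using x(2) by (rule tv_mult) (auto simp: tv_def)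
  then have "tv (l + m - 1) (x * 2 ^ (l - m))"
  proof -
    have "2 * m - 1 + (l - m) = l + m - 1" using lm by simp
    then show ?thesis using \<open>tv (2 * m - 1 + (l - m)) (x * 2 ^ (l - m))\<close> by simp
  qed
  then obtain y where y: "odd y" "x * 2 ^ (l - m) = 2 ^ (l + m - 1) * y" unfolding tv_def by blast
  moreover have "M = 2 ^ (l + m - 1) * 2"
  proof -
    have "l + m = Suc (l + m - 1)" using lm by simp
    then show ?thesis by (metis power_Suc2)
  qed
  ultimately have "2 ^ (l + m - 1) * 2 dvd 2 ^ (l + m - 1) * y" by (simp only:)
  then have "2 dvd y" by simp
  then show False using y by simp
qed

end

end

lemma coset_model_exists:
  assumes a: "tv m (a - 1)" and b: "tv m (b - 1)" and l: "tv l (a - b)"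
    and lm: "m < l" "l + 3 \<le> 2 * m" "2 * l + 2 \<le> 3 * m"
  obtains g h u \<theta> x \<gamma> where "coset_model l m g h u \<theta> x \<gamma>" "a = 1 + 2 * g" "b = 1 + 2 * h"
proof -
  obtain m' where m': "m = Suc m'" using lm by (cases m) auto
  obtain l' where l': "l = Suc l'" using lm by (cases l) auto
  obtain a' b' u where u: "odd u" "a - b = 2 ^ l * u" and a': "odd a'" "a - 1 = 2 ^ m * a'" and b': "odd b'" "b - 1 = 2 ^ m * b'"
    using a b l unfolding tv_def by blast
  define g where "g = 2 ^ m' * a'"
  define h where "h = 2 ^ m' * b'"
  have ab: "a = 1 + 2 * g" "b = 1 + 2 * h" using a' b' by (simp_all add: g_def h_def m' algebra_simps)
  obtain \<theta> where \<theta>: "2 ^ (l + m) dvd 3 * \<theta> - (1::int)" using odd_inverse_mod[of 3 "l + m"] by auto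
  obtain \<gamma> where \<gamma>: "2 ^ (l + m) dvd (1 + 2 * h) * \<gamma> - 1" using odd_inverse_mod[of "1 + 2 * h" "l + m"] by auto
  obtain v where v: "2 ^ Suc (l + m) dvd u * v - 1" using odd_inverse_mod[OF u(1)] by blast
  have "even (u * v - 1)" using v by (meson dvd_trans dvd_power zero_less_Suc)
  then have "odd v" by auto
  \<comment> \<open>Solves \<open>x * u = 2 * h * (2 * g - h)\<close> modulo
    \<open>2 ^ (l + m)\<close>, as \<open>v\<close> inverts \<open>u\<close>. The valuation is
    \<open>m + (m - 1)\<close> because \<open>2 * a' - b'\<close> is odd.\<close>
  define x where "x = 2 * h * (2 * g - h) * v"
  have xu: "2 ^ (l + m) dvd x * u - 2 * h * (2 * g - h)"
  proof -
    have "x * u - 2 * h * (2 * g - h) = 2 * h * (2 * g - h) * (u * v - 1)" by (simp add: x_def algebra_simps)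
    then show ?thesis using power_le_dvd[OF v, of "l + m"] by simp
  qed
  have "tv m (2 * h)" using b' by (auto simp: tv_def h_def m')
  have "tv m' (2 * g - h)"
    unfolding tv_def using b' by (intro exI[of _ "2 * a' - b'"]) (simp add: g_def h_def algebra_simps)
  with \<open>tv m (2 * h)\<close> have "tv (m + m') (2 * h * (2 * g - h) * v)"
    using tv_mult_odd[OF tv_mult \<open>odd v\<close>] by blast
  moreover have "m + m' = 2 * m - 1" by (simp add: m')
  ultimately have "tv (2 * m - 1) x" by (simp only: x_def)
  moreover have "g - h = 2 ^ (l - 1) * u" using ab u(2) by (simp add: l')
  ultimately have "coset_model l m g h u \<theta> x \<gamma>"
    using lm \<theta> \<gamma> xu by unfold_locales (simp_all add: g_def h_def m')
  then show thesis using that ab by blast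
qed

section \<open>Nilpotency and normal forms\<close>

lemma (in group) cayley_inject: "x \<in> carrier G \<Longrightarrow> y \<in> carrier G \<Longrightarrow> cayley G x = cayley G y \<longleftrightarrow> x = y"
proof
  interpret k: grp_hom G "cayley G" by (rule cayley_hom)
  assume xy: "x \<in> carrier G" "y \<in> carrier G" and "cayley G x = cayley G y"
  then have "cayley G (x \<otimes> inv y) = 1" using k.hom[of x "inv y"] k.hom_inv[of y] by simp
  then have "\<one> = x \<otimes> inv y" using xy cayley_eq_one by simp
  then show "x = y" using xy inv_solve_right[of \<one> x y] by simp
qed simp

lemma (in group) finite_range_pow:
  assumes "x \<in> carrier G" "x [^] (n::nat) = \<one>" "n > 0"
  shows "finite (range (\<lambda>k::nat. x [^] k))"
proof -
  have "x [^] k = x [^] (k mod n)" for k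
  proof -
    have "x [^] k = x [^] (n * (k div n) + k mod n)" by simp
    also have "\<dots> = (x [^] n) [^] (k div n) \<otimes> x [^] (k mod n)"
      using assms(1) by (simp only: nat_pow_mult[symmetric] nat_pow_pow)
    finally show ?thesis using assms by simp
  qed
  then have "range (\<lambda>k::nat. x [^] k) \<subseteq> (\<lambda>k. x [^] k) ` {..<n}"
    using assms(3) by (metis (no_types, lifting) image_subset_iff imageI lessThan_iff mod_less_divisor)
  then show ?thesis by (rule finite_subset) simp
qed

lemma Gpres_finite_order:
  assumes "\<bar>\<alpha>\<bar> \<ge> 2" "\<bar>\<beta>\<bar> \<ge> 2"
  obtains n :: nat where "n > 0" "Aelt \<alpha> \<beta> [^]\<^bsub>Gpres \<alpha> \<beta>\<^esub> n = \<one>\<^bsub>Gpres \<alpha> \<beta>\<^esub>"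
    "Belt \<alpha> \<beta> [^]\<^bsub>Gpres \<alpha> \<beta>\<^esub> n = \<one>\<^bsub>Gpres \<alpha> \<beta>\<^esub>"
proof -
  interpret G: group "Gpres \<alpha> \<beta>" by (rule group_Gpres)
  interpret k: grp_hom "Gpres \<alpha> \<beta>" "cayley (Gpres \<alpha> \<beta>)" by (rule G.cayley_hom)
  obtain n where "n > 0" "cayley (Gpres \<alpha> \<beta>) (Aelt \<alpha> \<beta>) ^ n = 1" "cayley (Gpres \<alpha> \<beta>) (Belt \<alpha> \<beta>) ^ n = 1"
    using mac_finite_order[OF Gpres_mac[OF k.grp_hom_axioms] assms] .
  then show thesis using that by (simp add: G.cayley_eq_one flip: k.hom_pow)
qed

text \<open>As long as a term of the upper central series is proper,
  \<open>mac_central_power\<close> in the quotient gives a power of \<open>A\<close>,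
  \<open>B\<close> or \<open>C\<close> that is new in the next term. These powers form the finite
  set \<open>T\<close>, which bounds the number of steps.\<close>

lemma Gpres_nilpotent:
  assumes ab: "\<bar>\<alpha>\<bar> \<ge> 2" "\<bar>\<beta>\<bar> \<ge> 2" and four: "4 dvd \<alpha> - 1" "4 dvd \<beta> - 1"
  obtains c where "ucs (Gpres \<alpha> \<beta>) c = carrier (Gpres \<alpha> \<beta>)"
proof -
  let ?G = "Gpres \<alpha> \<beta>" and ?A = "Aelt \<alpha> \<beta>" and ?B = "Belt \<alpha> \<beta>"
  interpret G: group ?G by (rule group_Gpres)
  interpret k: grp_hom ?G "cayley ?G" by (rule G.cayley_hom)
  define C where "C = comm ?G ?A ?B"
  have Cc: "C \<in> carrier ?G" by (simp add: C_def)
  obtain n :: nat where n: "n > 0" "?A [^]\<^bsub>?G\<^esub> n = \<one>\<^bsub>?G\<^esub>" "?B [^]\<^bsub>?G\<^esub> n = \<one>\<^bsub>?G\<^esub>"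
    using Gpres_finite_order[OF ab] .
  have "cayley ?G ?A ^ n = 1" using n by (simp flip: k.hom_pow)
  then obtain i where i: "i > 0" "\<And>z. zp (cayley ?G ?A) z = 1 \<longleftrightarrow> int i dvd z"
    using finite_order_exists n(1) by blast
  have "gc (cayley ?G ?A) (cayley ?G ?B) ^ i = 1"
    using mac_comm_pow_order(1)[OF Gpres_mac[OF k.grp_hom_axioms] i] .
  then have "cayley ?G (C [^]\<^bsub>?G\<^esub> i) = 1" using Cc by (simp add: k.hom_pow k.hom_comm C_def)
  then have Ci: "C [^]\<^bsub>?G\<^esub> i = \<one>\<^bsub>?G\<^esub>" using Cc G.cayley_eq_one by blast
  define T where "T = range (\<lambda>k::nat. ?A [^]\<^bsub>?G\<^esub> k) \<union> range (\<lambda>k::nat. ?B [^]\<^bsub>?G\<^esub> k) \<union> range (\<lambda>k::nat. C [^]\<^bsub>?G\<^esub> k)"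
  have finT: "finite T"
    unfolding T_def using G.finite_range_pow[OF Aelt_closed n(2,1)] G.finite_range_pow[OF Belt_closed n(3,1)]
      G.finite_range_pow[OF Cc Ci i(1)] by simp
  have TG: "T \<subseteq> carrier ?G" using Cc by (auto simp: T_def)
  show thesis
  proof (rule ccontr)
    assume "\<not> thesis"
    then have not: "ucs ?G c \<noteq> carrier ?G" for c using that by blast
    have step: "\<exists>x \<in> T. x \<notin> ucs ?G c \<and> x \<in> ucs ?G (Suc c)" for c
    proof -
      interpret N: normal "ucs ?G c" ?G by (rule G.ucs_normal)
      interpret q: grp_hom ?G "quot_perm ?G (ucs ?G c)" by (rule N.quot_perm_hom)
      let ?q = "quot_perm ?G (ucs ?G c)"
      have "\<not> (?A \<in> ucs ?G c \<and> ?B \<in> ucs ?G c)"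
      proof
        assume "?A \<in> ucs ?G c \<and> ?B \<in> ucs ?G c"
        then have "generate ?G {?A, ?B} \<subseteq> ucs ?G c"
          by (intro G.generate_subgroup_incl N.subgroup_axioms) auto
        then show False using not[of c] G.ucs_subset[of c] by (auto simp: Gpres_generate[symmetric])
      qed
      then have "?q ?A \<noteq> 1 \<or> ?q ?B \<noteq> 1" by (simp add: N.quot_perm_eq_one)
      moreover have "?q ?A ^ n = 1" "?q ?B ^ n = 1" using n by (simp_all flip: q.hom_pow)
      ultimately obtain r x where x: "x \<in> {?q ?A ^ r, ?q ?B ^ r, gc (?q ?A) (?q ?B) ^ r}" "x \<noteq> 1"
        "x * ?q ?A = ?q ?A * x" "x * ?q ?B = ?q ?B * x"
        using mac_central_power[OF Gpres_mac[OF q.grp_hom_axioms] _ _ n(1) four] by blast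
      have "{?q ?A ^ r, ?q ?B ^ r, gc (?q ?A) (?q ?B) ^ r} \<subseteq> ?q ` T"
        using Cc by (auto simp: T_def C_def simp flip: q.hom_pow q.hom_comm)
      then obtain y where y: "y \<in> T" "x = ?q y" using x(1) by blast
      have yc: "y \<in> carrier ?G" using y TG by blast
      have "y \<notin> ucs ?G c" using x(2) y yc by (simp add: N.quot_perm_eq_one)
      moreover have "y \<in> ucs ?G (Suc c)"
      proof (rule G.ucs_SucI[OF Gpres_generate])
        fix s assume "s \<in> {?A, ?B}"
        then have "?q (comm ?G y s) = 1" using x(3,4) y yc by (auto simp: q.hom_comm gc_eq_one_iff)
        then show "comm ?G y s \<in> ucs ?G c" using yc \<open>s \<in> {?A, ?B}\<close> by (subst (asm) N.quot_perm_eq_one) auto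
      qed (use yc in auto)
      ultimately show ?thesis using y by blast
    qed
    have "card (T \<inter> ucs ?G c) \<ge> c" for c
    proof (induction c)
      case (Suc c)
      obtain x where "x \<in> T" "x \<notin> ucs ?G c" "x \<in> ucs ?G (Suc c)" using step by blast
      then have "T \<inter> ucs ?G c \<subset> T \<inter> ucs ?G (Suc c)" using G.ucs_mono[of c] by blast
      then have "card (T \<inter> ucs ?G c) < card (T \<inter> ucs ?G (Suc c))" using finT by (intro psubset_card_mono) auto
      then show ?case using Suc by simp
    qed simp
    from this[of "Suc (card T)"] have "Suc (card T) \<le> card (T \<inter> ucs ?G (Suc (card T)))" .
    moreover have "card (T \<inter> ucs ?G (Suc (card T))) \<le> card T" using finT by (intro card_mono) auto
    ultimately show False by simp
  qed
qed

lemma gc_commuting_product: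
  fixes a1 a2 b1 b2 :: "'a::grp"
  assumes "a1 * a2 = a2 * a1" "a1 * b2 = b2 * a1" "b1 * a2 = a2 * b1" "b1 * b2 = b2 * b1"
  shows "gc (a1 * a2) (b1 * b2) = gc a1 b1 * gc a2 b2"
proof -
  have g1: "gc a1 b1 * b2 = b2 * gc a1 b1" "gc a1 b1 * a2 = a2 * gc a1 b1"
    using assms by (auto intro!: commute_gc)
  have "cj a1 (b1 * b2) = cj (a1 * gc a1 b1) b2" unfolding cj_cj[symmetric] cj_gc[of a1 b1] by (simp only:)
  also have "\<dots> = a1 * gc a1 b1" unfolding cj_eq_iff using assms(2) g1(1) by (rule commute_mult)
  finally have 1: "cj a1 (b1 * b2) = a1 * gc a1 b1" .
  have "cj a2 b1 = a2" using assms(3) by (simp add: cj_eq_iff)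
  then have 2: "cj a2 (b1 * b2) = a2 * gc a2 b2" by (metis cj_cj cj_gc)
  have "a1 * a2 * gc (a1 * a2) (b1 * b2) = cj a1 (b1 * b2) * cj a2 (b1 * b2)"
    by (simp only: cj_gc[symmetric, of "a1 * a2"] cj_mult)
  also have "\<dots> = a1 * (gc a1 b1 * a2) * gc a2 b2"
    unfolding 1 2 by (simp only: mult.assoc)
  also have "\<dots> = a1 * a2 * (gc a1 b1 * gc a2 b2)" by (simp add: g1(2) mult.assoc)
  finally show ?thesis by simp
qed

text \<open>The relation for \<open>A\<close> passes to its power \<open>a1\<close>. The commutator
  of \<open>A\<close> and \<open>B\<close> splits accordingly, and its second factor commutes with
  \<open>a1\<close>, so only the commutator of \<open>a1\<close> and \<open>b1\<close> acts.\<close>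

lemma mac_split:
  fixes a1 a2 b1 b2 :: "'a::grp"
  assumes mac: "mac \<alpha> \<beta> A B" and A: "A = a1 * a2" "a1 = A ^ n" and B: "B = b1 * b2" "b1 = B ^ n"
    and com: "a1 * a2 = a2 * a1" "a1 * b2 = b2 * a1" "b1 * a2 = a2 * b1" "b1 * b2 = b2 * b1"
  shows "mac \<alpha> \<beta> a1 b1"
proof -
  have *: "cj x1 (gc x1 y1) = zp x1 \<delta>"
    if "cj V (gc V W) = zp V \<delta>" "V = x1 * x2" "x1 = V ^ n" "W = y1 * y2"
      "x1 * x2 = x2 * x1" "x1 * y2 = y2 * x1" "y1 * x2 = x2 * y1" "y1 * y2 = y2 * y1"
    for V W x1 x2 y1 y2 :: 'a and \<delta>
  proof -
    have "cj (V ^ n) (gc V W) = zp (zp V \<delta>) (int n)"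
      using that(1) by (simp add: cj_zp flip: zp_of_nat)
    then have 1: "cj x1 (gc V W) = zp x1 \<delta>" using that(3) by (metis zp_mult mult.commute zp_of_nat)
    have g: "gc V W = gc x2 y2 * gc x1 y1"
    proof -
      have "V = x2 * x1" by (rule HOL.trans[OF that(2,5)])
      moreover have "W = y2 * y1" by (rule HOL.trans[OF that(4,8)])
      ultimately show ?thesis
        using gc_commuting_product[OF that(5)[symmetric] that(7)[symmetric] that(6)[symmetric] that(8)[symmetric]] by (simp only:)
    qed
    have "gc x2 y2 * x1 = x1 * gc x2 y2"
      by (rule commute_gc[OF that(5)[symmetric] that(6)[symmetric]])
    then have "cj x1 (gc x2 y2) = x1" by (simp add: cj_eq_iff)
    then show ?thesis using 1 unfolding g by (simp flip: cj_cj)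
  qed
  show ?thesis
    unfolding mac_def
  proof
    show "cj a1 (gc a1 b1) = zp a1 \<alpha>"
      by (rule *[OF _ A B(1) com]) (use mac in \<open>simp add: mac_def\<close>)
    show "cj b1 (gc b1 a1) = zp b1 \<beta>"
      by (rule *[OF _ B A(1) com(4,3,2,1)]) (use mac in \<open>simp add: mac_def\<close>)
  qed
qed

text \<open>The new \<open>a\<close> moves left past the power of \<open>b\<close>, which leaves a
  negative power of the commutator behind, and then past the powers of the commutator. The finite
  orders serve to make all these exponents natural.\<close>

lemma mac_normal_form_step:
  fixes a b :: "'a::grp"
  assumes mac: "mac \<alpha> \<beta> a b" and b: "b ^ N = 1" "N > 0" and c: "gc a b ^ n = 1" "n > 0"
  shows "\<exists>i' k' j'. zp a i * gc a b ^ k * zp b j * a = zp a i' * gc a b ^ k' * zp b j'"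
proof -
  define C where "C = gc a b"
  define j0 where "j0 = nat (j mod int N)"
  have j0: "int j0 = j mod int N" using b(2) by (simp add: j0_def)
  have "zp b j = zp (zp b (int N)) (j div int N) * zp b (j mod int N)"
    by (simp flip: zp_mult zp_add)
  then have bj: "zp b j = b ^ j0" using b(1) by (simp add: zp_of_nat flip: j0)
  obtain n' where n': "n = Suc n'" using c(2) by (cases n) auto
  have Cinv: "ginv (C ^ r) = C ^ (n' * r)" for r
  proof (rule ginv_unique)
    have "r + n' * r = n * r" by (simp add: n')
    then have "C ^ r * C ^ (n' * r) = (C ^ n) ^ r" by (metis power_add power_mult)
    then show "C ^ r * C ^ (n' * r) = 1" using c(1) by (simp add: C_def)
  qed
  have "b ^ j0 * a = a * cj (b ^ j0) a" by (simp add: cj_def mult.assoc)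
  also have "cj (b ^ j0) a = ginv (C ^ j0) * zp b (\<beta> * geo \<beta> j0)"
    using mac_pow_cj[OF mac_sym[OF mac], of j0] by (simp add: C_def ginv_gc flip: power_ginv)
  finally have 1: "b ^ j0 * a = a * C ^ (n' * j0) * zp b (\<beta> * geo \<beta> j0)" by (simp add: Cinv mult.assoc)
  have "cj (zp a 1) (C ^ (n' * k)) = zp a (1 * \<alpha> ^ (n' * k))"
    using mac by (intro cj_zp_zp) (simp add: mac_def C_def)
  then have "C ^ k * a * ginv (C ^ k) = zp a (\<alpha> ^ (n' * k))"
    unfolding Cinv[symmetric] by (simp add: cj_def)
  then have "C ^ k * a = zp a (\<alpha> ^ (n' * k)) * ginv (ginv (C ^ k))" by (simp only: grp_solve_right)
  then have 2: "C ^ k * a = zp a (\<alpha> ^ (n' * k)) * C ^ k" by (simp only: ginv_ginv)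
  have "zp a i * C ^ k * zp b j * a = zp a i * (C ^ k * a) * C ^ (n' * j0) * zp b (\<beta> * geo \<beta> j0)"
    by (simp only: bj 1 mult.assoc)
  also have "\<dots> = zp a (i + \<alpha> ^ (n' * k)) * C ^ (k + n' * j0) * zp b (\<beta> * geo \<beta> j0)"
    by (simp only: 2 zp_add power_add mult.assoc)
  finally show ?thesis unfolding C_def by blast
qed

text \<open>The normal forms contain the identity and are stable under right multiplication by the
  generators; inverses of generators are positive powers.\<close>

lemma (in group) generate_normal_form:
  assumes a: "a \<in> carrier G" and b: "b \<in> carrier G" and mac: "mac \<alpha> \<beta> (cayley G a) (cayley G b)"
    and N: "N > 0" "a [^] (N::nat) = \<one>" "b [^] N = \<one>" and c: "comm G a b [^] (n::nat) = \<one>" "n > 0"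
    and x: "x \<in> generate G {a, b}"
  shows "\<exists>(i::int) (k::nat) (j::int). x = a [^] i \<otimes> comm G a b [^] k \<otimes> b [^] j"
proof -
  interpret k: grp_hom G "cayley G" by (rule cayley_hom)
  define S where "S = {a [^] i \<otimes> comm G a b [^] k \<otimes> b [^] j | (i::int) (k::nat) (j::int). True}"
  have SG: "S \<subseteq> carrier G" using a b by (auto simp: S_def)
  have im: "cayley G (a [^] i \<otimes> comm G a b [^] k \<otimes> b [^] j) = zp (cayley G a) i * gc (cayley G a) (cayley G b) ^ k * zp (cayley G b) j"
    for i j :: int and k :: nat
    using a b by (simp add: k.hom k.hom_pow k.hom_int_pow k.hom_comm)
  have nb: "cayley G b ^ N = 1" using N(3) b by (simp flip: k.hom_pow)
  have nc: "gc (cayley G a) (cayley G b) ^ n = 1" using c(1) a b by (simp flip: k.hom_pow k.hom_comm)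
  have Sa: "s \<otimes> a \<in> S" if s: "s \<in> S" for s
  proof -
    obtain i k j where s: "s = a [^] (i::int) \<otimes> comm G a b [^] (k::nat) \<otimes> b [^] (j::int)" using s by (auto simp: S_def)
    have sc: "s \<in> carrier G" using s a b by simp
    obtain i' k' j' where e: "zp (cayley G a) i * gc (cayley G a) (cayley G b) ^ k * zp (cayley G b) j * cayley G a
        = zp (cayley G a) i' * gc (cayley G a) (cayley G b) ^ k' * zp (cayley G b) j'"
      using mac_normal_form_step[OF mac nb N(1) nc c(2), of i k j] by blast
    have "cayley G (s \<otimes> a) = cayley G (a [^] i' \<otimes> comm G a b [^] k' \<otimes> b [^] j')"
      unfolding k.hom[OF sc a] by (simp only: s im e)
    then have "s \<otimes> a = a [^] i' \<otimes> comm G a b [^] k' \<otimes> b [^] j'" using a b s by (subst (asm) cayley_inject) simp_all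
    then show ?thesis by (auto simp: S_def)
  qed
  have Sb: "s \<otimes> b \<in> S" if s: "s \<in> S" for s
  proof -
    obtain i k j where s: "s = a [^] (i::int) \<otimes> comm G a b [^] (k::nat) \<otimes> b [^] (j::int)" using s by (auto simp: S_def)
    have "s \<otimes> b = a [^] i \<otimes> comm G a b [^] k \<otimes> (b [^] j \<otimes> b [^] (1::int))" using a b s by (simp add: m_assoc)
    also have "b [^] j \<otimes> b [^] (1::int) = b [^] (j + 1)" using b by (simp only: int_pow_mult)
    finally show ?thesis by (auto simp: S_def)
  qed
  have Spow: "s \<otimes> y [^] (r::nat) \<in> S" if "s \<in> S" "\<And>s. s \<in> S \<Longrightarrow> s \<otimes> y \<in> S" "y \<in> carrier G" for s y r
  proof (induction r)
    case (Suc r)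
    then show ?case using that SG by (auto simp: m_assoc[symmetric])
  qed (use that SG in auto)
  have inv: "inv y = y [^] (N - 1)" if "y \<in> carrier G" "y [^] N = \<one>" for y
  proof (rule inv_equality)
    have "y [^] (N - 1) \<otimes> y = y [^] Suc (N - 1)" by simp
    then show "y [^] (N - 1) \<otimes> y = \<one>" using that N(1) by (simp del: nat_pow_Suc)
  qed (use that in auto)
  have "\<forall>s\<in>S. s \<otimes> x \<in> S" using x
  proof (induction rule: generate.induct)
    case one
    then show ?case using SG by auto
  next
    case (incl h)
    then show ?case using Sa Sb by auto
  next
    case (inv h)
    then have "h \<in> carrier G" "h [^] N = \<one>" "\<And>s. s \<in> S \<Longrightarrow> s \<otimes> h \<in> S" using a b N Sa Sb by auto
    then show ?case using Spow \<open>\<And>y. y \<in> carrier G \<Longrightarrow> y [^] N = \<one> \<Longrightarrow> inv y = y [^] (N - 1)\<close> by auto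
  next
    case (eng h1 h2)
    then have "h1 \<in> carrier G" "h2 \<in> carrier G" using generate_in_carrier[of "{a, b}"] a b by blast+
    then show ?case using eng SG by (metis m_assoc subsetD)
  qed
  moreover have "\<one> \<in> S" unfolding S_def
    by (rule CollectI, rule exI[of _ 0], rule exI[of _ 0], rule exI[of _ 0]) simp
  moreover have "\<one> \<otimes> x = x" using x generate_in_carrier[of "{a, b}"] a b by auto
  ultimately have "x \<in> S" by metis
  then show ?thesis by (auto simp: S_def)
qed

text \<open>Commuting with \<open>b\<close> allows the factor \<open>zp b j\<close> to be split off
  before taking the \<open>n\<close>-th power, which is then a power of \<open>a\<close>. In
  \<open>Q_no_two_torsion\<close> this commuting is automatic for an element of 2-power
  order.\<close>

lemma mac_odd_element:
  fixes a b :: "'a::grp"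
  assumes mac: "mac \<alpha> \<beta> a b" and a: "a ^ n = 1" and b: "b ^ n = 1" and c: "gc a b ^ n = 1"
    and x: "x = zp a i * gc a b ^ k * zp b j" and com: "x * b = b * x"
  shows "x ^ (n * n) = 1"
proof -
  define C where "C = gc a b"
  have pw: "\<exists>z. (zp a i * C ^ k) ^ r = C ^ (k * r) * zp a z" for r
  proof (induction r)
    case 0
    then show ?case by (intro exI[of _ 0]) simp
  next
    case (Suc r)
    then obtain z where z: "(zp a i * C ^ k) ^ r = C ^ (k * r) * zp a z" by blast
    have "(zp a i * C ^ k) ^ Suc r = C ^ (k * r) * zp a (z + i) * C ^ k"
      using z by (simp add: power_Suc2 zp_add mult.assoc del: power_Suc)
    also have "\<dots> = C ^ (k * r) * (C ^ k * zp a ((z + i) * \<alpha> ^ k))"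
      using mac_swapA[OF mac, of "z + i" k] by (simp add: C_def mult.assoc)
    also have "\<dots> = C ^ (k * Suc r) * zp a ((z + i) * \<alpha> ^ k)"
      by (simp add: mult.assoc[symmetric] add.commute flip: power_add)
    finally show ?case by blast
  qed
  obtain z where z: "(zp a i * C ^ k) ^ n = C ^ (k * n) * zp a z" using pw by blast
  have "C ^ (k * n) = 1" using c by (metis C_def mult.commute power_mult power_one)
  then have 1: "(zp a i * C ^ k) ^ n = zp a z" using z by simp
  have "x * zp b (- j) = zp a i * C ^ k" using x by (simp add: C_def zp_minus mult.assoc)
  moreover have "x * zp b (- j) = zp b (- j) * x" using com commute_zp by metis
  then have "zp (x * zp b (- j)) (int n) = zp x (int n) * zp (zp b (- j)) (int n)" by (rule zp_mult_distrib)
  moreover have "zp (zp b (- j)) (int n) = 1"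
    using b by (metis zp_mult mult.commute zp_of_nat zp_one)
  ultimately have "x ^ n = zp a z" using 1 by (simp add: zp_of_nat)
  then have "x ^ (n * n) = zp (zp a z) (int n)" by (simp add: power_mult zp_of_nat)
  also have "\<dots> = 1" using a by (metis zp_mult mult.commute zp_of_nat zp_one)
  finally show ?thesis .
qed

lemma mac_gc_comm_powA:
  assumes mac: "mac \<alpha> \<beta> a b"
  shows "gc (gc a b ^ r) a = zp a (1 - \<alpha> ^ r)"
proof -
  have "ginv a * gc a b ^ r = gc a b ^ r * zp a (- (\<alpha> ^ r))"
    using mac_swapA[OF mac, of "-1" r] by simp
  then have "gc (gc a b ^ r) a = zp a (- (\<alpha> ^ r)) * zp a 1" by (simp add: gc_def mult.assoc)
  then show ?thesis by (simp only: zp_add[symmetric]) simp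
qed

lemma mac_gc_comm_powB:
  assumes mac: "mac \<alpha> \<beta> a b"
  shows "gc (gc a b ^ r) b = ginv (gc a b ^ r) * zp b (\<beta> ^ r - 1) * gc a b ^ r"
proof -
  have "gc a b ^ r * b = zp b (\<beta> ^ r) * gc a b ^ r" using mac_swapB[OF mac, of r 1] by simp
  then have "gc (gc a b ^ r) b = ginv (gc a b ^ r) * (zp b (-1) * zp b (\<beta> ^ r)) * gc a b ^ r"
    by (simp add: gc_def mult.assoc)
  then show ?thesis by (simp only: zp_add[symmetric]) (simp add: add.commute)
qed

section \<open>Splitting off the 2-part\<close>

definition swapw :: "word \<Rightarrow> word" where
  "swapw = map (\<lambda>L. (\<not> fst L, snd L))"

lemma swapw_append [simp]: "swapw (u @ v) = swapw u @ swapw v"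
  and swapw_replicate: "swapw (replicate n L) = replicate n (\<not> fst L, snd L)"
  by (simp_all add: swapw_def)

lemma swapw_winv: "swapw (winv w) = winv (swapw w)"
  by (simp add: swapw_def winv_def rev_map inv_letter_def comp_def)

lemma swapw_rel: "swapw (rel1 \<alpha>) = rel2 \<alpha>" "swapw (rel2 \<alpha>) = rel1 \<alpha>"
proof -
  have "swapw [LA] = [LB]" "swapw [LB] = [LA]" by (simp_all add: swapw_def LA_def LB_def)
  moreover have "swapw (wpow LA k) = wpow LB k" "swapw (wpow LB k) = wpow LA k" for k
    by (simp_all add: wpow_def swapw_replicate LA_def LB_def inv_letter_def)
  ultimately show "swapw (rel1 \<alpha>) = rel2 \<alpha>" "swapw (rel2 \<alpha>) = rel1 \<alpha>"
    by (simp_all only: rel1_def rel2_def wcomm_def swapw_append swapw_winv)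
qed

lemma wrel_swap: "wrel \<alpha> \<beta> u v \<Longrightarrow> wrel \<beta> \<alpha> (swapw u) (swapw v)"
proof (induction rule: wrel.induct)
  case (cancel L)
  have "swapw [L, inv_letter L] = [(\<not> fst L, snd L), inv_letter (\<not> fst L, snd L)]"
    by (simp add: swapw_def inv_letter_def)
  then show ?case by (simp only: wrel.cancel) (simp add: swapw_def wrel.cancel)
next
  case r1
  then show ?case using wrel.r2[of \<beta> \<alpha>] by (simp add: swapw_rel) (simp add: swapw_def)
next
  case r2
  then show ?case using wrel.r1[of \<beta> \<alpha>] by (simp add: swapw_rel) (simp add: swapw_def)
qed (auto intro: wrel.intros)

lemma Aelt_pow_swap:
  assumes "Aelt \<alpha> \<beta> [^]\<^bsub>Gpres \<alpha> \<beta>\<^esub> n = \<one>\<^bsub>Gpres \<alpha> \<beta>\<^esub>"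
  shows "Belt \<beta> \<alpha> [^]\<^bsub>Gpres \<beta> \<alpha>\<^esub> (n::nat) = \<one>\<^bsub>Gpres \<beta> \<alpha>\<^esub>"
proof -
  have "wrel \<alpha> \<beta> (replicate n LA) []"
    using assms by (simp add: Aelt_def Gpres_one wclass_eq_iff flip: wclass_replicate)
  from wrel_swap[OF this] have "wrel \<beta> \<alpha> (replicate n LB) []"
    by (simp add: swapw_replicate LA_def LB_def) (simp add: swapw_def)
  then show ?thesis by (simp add: Belt_def Gpres_one wclass_eq_iff flip: wclass_replicate)
qed

text \<open>For uniqueness, an exponent \<open>w\<close> that is 1 modulo
  \<open>2 ^ (k + k')\<close> and divisible by the odd exponents \<open>n\<close> and
  \<open>n'\<close> extracts the 2-component from both decompositions.\<close>

lemma (in group) proj2_eqI: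
  assumes u: "u \<in> carrier G" "u [^] ((2::nat) ^ k) = \<one>" and v: "v \<in> carrier G" "v [^] (n::nat) = \<one>" "odd n"
    and x: "x = u \<otimes> v" "u \<otimes> v = v \<otimes> u"
  shows "proj2 G x = u"
  unfolding proj2_def
proof (rule the_equality)
  show "u \<in> syl2 G \<and> (\<exists>v\<in>oddpart_set G. x = u \<otimes> v \<and> u \<otimes> v = v \<otimes> u)"
    using u v x by (auto simp: syl2_def oddpart_set_def)
  fix u' assume "u' \<in> syl2 G \<and> (\<exists>v\<in>oddpart_set G. x = u' \<otimes> v \<and> u' \<otimes> v = v \<otimes> u')"
  then obtain v' k' n' where u': "u' \<in> carrier G" "u' [^] ((2::nat) ^ k') = \<one>"
    and v': "v' \<in> carrier G" "v' [^] (n'::nat) = \<one>" "odd n'" and x': "x = u' \<otimes> v'" "u' \<otimes> v' = v' \<otimes> u'"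
    by (auto simp: syl2_def oddpart_set_def)
  have "odd (int (n * n'))" using v v' by simp
  then obtain y where y: "y > 0" "2 ^ (k + k') dvd int (n * n') * y - 1" using odd_inverse_mod by blast
  define w where "w = n * n' * nat y"
  have "0 < w" using y(1) v(3) v'(3) by (auto simp: w_def intro!: Nat.gr0I)
  have "2 ^ (k + k') dvd int w - 1" using y by (simp add: w_def)
  then have "2 ^ (k + k') dvd int (w - 1)" using \<open>0 < w\<close> by (simp add: of_nat_diff)
  then have "2 ^ (k + k') dvd w - 1" by (metis int_dvd_int_iff of_nat_numeral of_nat_power)
  then obtain r where "w - 1 = 2 ^ (k + k') * r" by (elim dvdE)
  then have w: "w = 2 ^ (k + k') * r + 1" using \<open>0 < w\<close> by simp
  have pw: "z [^] (p * q) = \<one>" if "z \<in> carrier G" "z [^] p = \<one>" for z and p q :: nat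
    using that by (simp flip: nat_pow_pow)
  have "u [^] w = u" unfolding w using u pw[OF u, of "2 ^ k' * r"] by (simp add: power_add mult.assoc flip: nat_pow_mult)
  moreover have "u' [^] w = u'" unfolding w using u' pw[OF u', of "2 ^ k * r"] by (simp add: power_add mult_ac flip: nat_pow_mult)
  moreover have "v [^] w = \<one>" using pw[OF v(1,2), of "n' * nat y"] by (simp add: w_def mult.assoc)
  moreover have "v' [^] w = \<one>" using pw[OF v'(1,2), of "n * nat y"] by (simp add: w_def mult_ac)
  moreover have "x [^] w = u [^] w \<otimes> v [^] w" "x [^] w = u' [^] w \<otimes> v' [^] w"
    using pow_mult_distrib[OF x(2) u(1) v(1)] pow_mult_distrib[OF x'(2) u'(1) v'(1)] x(1) x'(1) by metis+
  ultimately show "u' = u" using u u' by simp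
qed

lemma zp_mod_order: "x ^ n = 1 \<Longrightarrow> n > 0 \<Longrightarrow> zp x i = (x :: 'a::grp) ^ nat (i mod int n)"
proof -
  assume n: "x ^ n = 1" "n > 0"
  have "zp x i = zp (zp x (int n)) (i div int n) * zp x (i mod int n)" by (simp flip: zp_mult zp_add)
  also have "\<dots> = zp x (int (nat (i mod int n)))" using n by (simp add: zp_of_nat)
  finally show ?thesis by (simp only: zp_of_nat)
qed

text \<open>Multiples of \<open>2 ^ l\<close> in the exponent of the commutator are traded for
  central powers of \<open>a\<close> and \<open>b\<close>, which move to the two ends.\<close>

lemma mac_normal_form_reduce:
  fixes a b :: "'a::grp"
  assumes a: "a ^ E = 1" "E > 0" and b: "b ^ E = 1"
    and cen: "zp a p * b = b * zp a p" "zp b q * a = a * zp b q"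
    and c: "gc a b ^ (2 ^ l) = zp a p * zp b q"
  shows "\<exists>i' < E. \<exists>k' < 2 ^ l. \<exists>j' < E. zp a i * gc a b ^ k * zp b j = a ^ i' * gc a b ^ k' * b ^ j'"
proof -
  define C where "C = gc a b"
  define z where "z = k div 2 ^ l"
  define k' where "k' = k mod 2 ^ l"
  have k: "k = 2 ^ l * z + k'" by (simp add: z_def k'_def)
  have comp: "zp b q * C = C * zp b q"
    unfolding C_def using commute_gc[of a "zp b q" b] cen(2) commute_zp[of b b q] by metis
  have "C ^ (2 ^ l * z) = (zp a p * zp b q) ^ z" by (simp add: power_mult c C_def)
  also have "\<dots> = zp (zp a p * zp b q) (int z)" by (simp add: zp_of_nat)
  also have "\<dots> = zp (zp a p) (int z) * zp (zp b q) (int z)"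
    using cen(2) by (intro zp_mult_distrib) (metis commute_zp)
  finally have "C ^ (2 ^ l * z) = zp a (p * int z) * zp (zp b q) (int z)" by (simp add: zp_mult)
  moreover have "zp (zp b q) (int z) * C ^ k' = C ^ k' * zp (zp b q) (int z)"
    using commute_zp2[OF comp, of "int z" "int k'"] by (simp add: zp_of_nat)
  ultimately have "C ^ k = zp a (p * int z) * C ^ k' * zp b (q * int z)"
    unfolding k power_add by (simp add: mult.assoc zp_mult)
  then have "zp a i * C ^ k * zp b j = zp a (i + p * int z) * C ^ k' * zp b (q * int z + j)"
    by (simp add: zp_add mult.assoc)
  also have "\<dots> = a ^ nat ((i + p * int z) mod int E) * C ^ k' * b ^ nat ((q * int z + j) mod int E)"
    using a b by (simp only: zp_mod_order)
  finally have "zp a i * C ^ k * zp b j = a ^ nat ((i + p * int z) mod int E) * C ^ k' * b ^ nat ((q * int z + j) mod int E)" .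
  moreover have "nat ((i + p * int z) mod int E) < E" "nat ((q * int z + j) mod int E) < E" "k' < 2 ^ l"
    using a(2) by (simp_all add: k'_def nat_less_iff)
  ultimately show ?thesis unfolding C_def by blast
qed

lemma (in group) generate_commute:
  assumes S: "S \<subseteq> carrier G" and y: "y \<in> carrier G" and com: "\<And>s. s \<in> S \<Longrightarrow> s \<otimes> y = y \<otimes> s"
    and x: "x \<in> generate G S"
  shows "x \<otimes> y = y \<otimes> x"
proof -
  interpret k: grp_hom G "cayley G" by (rule cayley_hom)
  have "cayley G x * cayley G y = cayley G y * cayley G x \<and> x \<in> carrier G" using x
  proof (induction rule: generate.induct)
    case (incl h)
    then show ?case using com S y by (metis k.hom subsetD)
  next
    case (inv h)
    then have "h \<in> carrier G" "cayley G h * cayley G y = cayley G y * cayley G h"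
      using com S y by (metis k.hom subsetD)+
    then show ?case by (simp add: k.hom_inv commute_ginv)
  next
    case (eng h1 h2)
    then show ?case by (simp add: k.hom commute_mult)
  qed simp
  then have "cayley G (x \<otimes> y) = cayley G (y \<otimes> x)" "x \<in> carrier G" using y by (simp_all add: k.hom)
  then show ?thesis using y cayley_inject by simp
qed

text \<open>\<open>w1\<close> and \<open>w2\<close> are the idempotents splitting a cyclic group of order \<open>2 ^ K * n\<close> into its 2-part and its odd part.\<close>

locale macdonald_two =
  fixes \<alpha> \<beta> :: int and m l K n w1 w2 cl :: nat
  assumes va: "tv m (\<alpha> - 1)" and vb: "tv m (\<beta> - 1)" and vl: "tv l (\<alpha> - \<beta>)"
    and lm: "m < l" "l + 3 \<le> 2 * m" "2 * l + 2 \<le> 3 * m"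
    and K: "4 * m \<le> K" and n: "odd n"
    and AN: "Aelt \<alpha> \<beta> [^]\<^bsub>Gpres \<alpha> \<beta>\<^esub> (2 ^ K * n) = \<one>\<^bsub>Gpres \<alpha> \<beta>\<^esub>"
    and BN: "Belt \<alpha> \<beta> [^]\<^bsub>Gpres \<alpha> \<beta>\<^esub> (2 ^ K * n) = \<one>\<^bsub>Gpres \<alpha> \<beta>\<^esub>"
    and w1: "n dvd w1" "2 ^ K dvd int w1 - 1" and w2: "2 ^ K dvd w2"
    and w12: "\<exists>q. w1 + w2 = 2 ^ K * n * q + 1"
    and cl: "ucs (Gpres \<alpha> \<beta>) cl = carrier (Gpres \<alpha> \<beta>)"
begin

abbreviation G where "G \<equiv> Gpres \<alpha> \<beta>"
abbreviation A where "A \<equiv> Aelt \<alpha> \<beta>"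
abbreviation B where "B \<equiv> Belt \<alpha> \<beta>"

sublocale group G by (rule group_Gpres)
sublocale k: grp_hom G "cayley G" by (rule cayley_hom)

definition a where "a = A [^]\<^bsub>G\<^esub> w1"
definition b where "b = B [^]\<^bsub>G\<^esub> w1"
definition a' where "a' = A [^]\<^bsub>G\<^esub> w2"
definition b' where "b' = B [^]\<^bsub>G\<^esub> w2"
definition c where "c = comm G a b"
definition c' where "c' = comm G a' b'"
definition P where "P = generate G {a, b}"
definition Q where "Q = generate G {a', b'}"

lemma closed [simp]: "a \<in> carrier G" "b \<in> carrier G" "a' \<in> carrier G" "b' \<in> carrier G"
  "c \<in> carrier G" "c' \<in> carrier G"
  by (simp_all add: a_def b_def a'_def b'_def c_def c'_def)

lemma npos: "n > 0" using n by (auto intro: Nat.gr0I)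

lemma pow_dvd: "x \<in> carrier G \<Longrightarrow> x [^]\<^bsub>G\<^esub> (i::nat) = \<one>\<^bsub>G\<^esub> \<Longrightarrow> i dvd j \<Longrightarrow> x [^]\<^bsub>G\<^esub> j = \<one>\<^bsub>G\<^esub>"
  by (metis pow_eq_id dvd_trans)

lemma two_orders: "a [^]\<^bsub>G\<^esub> ((2::nat) ^ K) = \<one>\<^bsub>G\<^esub>" "b [^]\<^bsub>G\<^esub> ((2::nat) ^ K) = \<one>\<^bsub>G\<^esub>"
proof -
  have "2 ^ K * n dvd w1 * 2 ^ K" using w1(1) by (simp add: mult.commute mult_dvd_mono)
  then show "a [^]\<^bsub>G\<^esub> ((2::nat) ^ K) = \<one>\<^bsub>G\<^esub>" "b [^]\<^bsub>G\<^esub> ((2::nat) ^ K) = \<one>\<^bsub>G\<^esub>"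
    unfolding a_def b_def using pow_dvd[OF Aelt_closed AN] pow_dvd[OF Belt_closed BN] by (simp_all add: nat_pow_pow)
qed

lemma odd_orders: "a' [^]\<^bsub>G\<^esub> n = \<one>\<^bsub>G\<^esub>" "b' [^]\<^bsub>G\<^esub> n = \<one>\<^bsub>G\<^esub>"
proof -
  have "2 ^ K * n dvd w2 * n" using w2 by (simp add: mult_dvd_mono)
  then show "a' [^]\<^bsub>G\<^esub> n = \<one>\<^bsub>G\<^esub>" "b' [^]\<^bsub>G\<^esub> n = \<one>\<^bsub>G\<^esub>"
    unfolding a'_def b'_def using pow_dvd[OF Aelt_closed AN] pow_dvd[OF Belt_closed BN] by (simp_all add: nat_pow_pow)
qed

lemma splitA: "A = a \<otimes>\<^bsub>G\<^esub> a'" and splitB: "B = b \<otimes>\<^bsub>G\<^esub> b'"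
proof -
  obtain q where q: "w1 + w2 = 2 ^ K * n * q + 1" using w12 by blast
  have "x [^]\<^bsub>G\<^esub> w1 \<otimes>\<^bsub>G\<^esub> x [^]\<^bsub>G\<^esub> w2 = x" if x: "x \<in> carrier G" "x [^]\<^bsub>G\<^esub> (2 ^ K * n) = \<one>\<^bsub>G\<^esub>" for x
  proof -
    have "x [^]\<^bsub>G\<^esub> w1 \<otimes>\<^bsub>G\<^esub> x [^]\<^bsub>G\<^esub> w2 = x [^]\<^bsub>G\<^esub> (2 ^ K * n * q + 1)" using x q by (simp only: nat_pow_mult)
    also have "\<dots> = x [^]\<^bsub>G\<^esub> (2 ^ K * n * q) \<otimes>\<^bsub>G\<^esub> x" by simp
    also have "x [^]\<^bsub>G\<^esub> (2 ^ K * n * q) = \<one>\<^bsub>G\<^esub>" using pow_dvd[OF x] by simp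
    finally show ?thesis using x by simp
  qed
  then show "A = a \<otimes>\<^bsub>G\<^esub> a'" "B = b \<otimes>\<^bsub>G\<^esub> b'" using AN BN by (simp_all add: a_def a'_def b_def b'_def)
qed

lemma coprime_commute:
  assumes "x \<in> carrier G" "x [^]\<^bsub>G\<^esub> ((2::nat) ^ i) = \<one>\<^bsub>G\<^esub>" "y \<in> carrier G" "y [^]\<^bsub>G\<^esub> n = \<one>\<^bsub>G\<^esub>"
  shows "x \<otimes>\<^bsub>G\<^esub> y = y \<otimes>\<^bsub>G\<^esub> x"
  using nilpotent_coprime_commute[OF cl assms] n by simp

lemma com: "a \<otimes>\<^bsub>G\<^esub> a' = a' \<otimes>\<^bsub>G\<^esub> a" "a \<otimes>\<^bsub>G\<^esub> b' = b' \<otimes>\<^bsub>G\<^esub> a"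
  "b \<otimes>\<^bsub>G\<^esub> a' = a' \<otimes>\<^bsub>G\<^esub> b" "b \<otimes>\<^bsub>G\<^esub> b' = b' \<otimes>\<^bsub>G\<^esub> b"
  by (rule coprime_commute[OF _ two_orders(1) _ odd_orders(1)] coprime_commute[OF _ two_orders(1) _ odd_orders(2)]
      coprime_commute[OF _ two_orders(2) _ odd_orders(1)] coprime_commute[OF _ two_orders(2) _ odd_orders(2)]; simp)+

lemma mac_P: "mac \<alpha> \<beta> (cayley G a) (cayley G b)" and mac_Q: "mac \<alpha> \<beta> (cayley G a') (cayley G b')"
  and c_split: "comm G A B = c \<otimes>\<^bsub>G\<^esub> c'"
proof -
  have kc: "cayley G x * cayley G y = cayley G y * cayley G x"
    if "x \<otimes>\<^bsub>G\<^esub> y = y \<otimes>\<^bsub>G\<^esub> x" "x \<in> carrier G" "y \<in> carrier G" for x y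
    using that by (simp flip: k.hom)
  note kcom = kc[OF com(1)] kc[OF com(2)] kc[OF com(3)] kc[OF com(4)]
  have kA: "cayley G A = cayley G a * cayley G a'" "cayley G B = cayley G b * cayley G b'"
    using k.hom[of a a'] k.hom[of b b'] splitA splitB by simp_all
  have pw: "cayley G a = cayley G A ^ w1" "cayley G b = cayley G B ^ w1"
    "cayley G a' = cayley G A ^ w2" "cayley G b' = cayley G B ^ w2"
    by (simp_all add: a_def b_def a'_def b'_def k.hom_pow)
  show "mac \<alpha> \<beta> (cayley G a) (cayley G b)"
    by (rule mac_split[OF Gpres_mac[OF k.grp_hom_axioms] kA(1) pw(1) kA(2) pw(2)]) (simp_all add: kcom)
  have kA': "cayley G A = cayley G a' * cayley G a" "cayley G B = cayley G b' * cayley G b"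
    using kA kcom by simp_all
  show "mac \<alpha> \<beta> (cayley G a') (cayley G b')"
    by (rule mac_split[OF Gpres_mac[OF k.grp_hom_axioms] kA'(1) pw(3) kA'(2) pw(4)]) (simp_all add: kcom)
  have "gc (cayley G A) (cayley G B) = gc (cayley G a) (cayley G b) * gc (cayley G a') (cayley G b')"
    unfolding kA by (rule gc_commuting_product) (simp_all add: kcom)
  then have "cayley G (comm G A B) = cayley G (c \<otimes>\<^bsub>G\<^esub> c')"
    by (simp add: k.hom_comm k.hom c_def c'_def)
  then show "comm G A B = c \<otimes>\<^bsub>G\<^esub> c'" by (simp add: cayley_inject)
qed

lemma two_le_m: "2 \<le> m" using lm by simp

lemma ab_order: "a [^]\<^bsub>G\<^esub> ((2::nat) ^ (l + m)) = \<one>\<^bsub>G\<^esub>" "b [^]\<^bsub>G\<^esub> ((2::nat) ^ (l + m)) = \<one>\<^bsub>G\<^esub>"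
proof -
  have *: "cayley G a ^ (2 ^ K) = 1" "cayley G b ^ (2 ^ K) = 1"
    using two_orders by (simp_all flip: k.hom_pow)
  have "l < 2 * m" using lm by simp
  from mac_two_order[OF mac_P * va vb vl two_le_m lm(1) this lm(3)]
  show "a [^]\<^bsub>G\<^esub> ((2::nat) ^ (l + m)) = \<one>\<^bsub>G\<^esub>" "b [^]\<^bsub>G\<^esub> ((2::nat) ^ (l + m)) = \<one>\<^bsub>G\<^esub>"
    by (simp_all add: cayley_eq_one flip: k.hom_pow)
qed

lemma kab_order: "cayley G a ^ (2 ^ (l + m)) = 1" "cayley G b ^ (2 ^ (l + m)) = 1"
  using ab_order by (simp_all flip: k.hom_pow)

lemma structure_P:
  shows "cayley G a ^ (2 ^ (2 * m - 1)) * cayley G b = cayley G b * cayley G a ^ (2 ^ (2 * m - 1))"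
    and "cayley G b ^ (2 ^ (2 * m - 1)) * cayley G a = cayley G a * cayley G b ^ (2 ^ (2 * m - 1))"
    and "\<exists>x y. gc (cayley G a) (cayley G b) ^ (2 ^ l)
      = zp (cayley G a) (2 ^ (2 * m - 1) * x) * zp (cayley G b) (2 ^ (2 * m - 1) * y)"
proof -
  have "l < 2 * m" using lm by simp
  from mac_two_structure[OF mac_P kab_order va vb vl two_le_m lm(1) this]
  show "cayley G a ^ (2 ^ (2 * m - 1)) * cayley G b = cayley G b * cayley G a ^ (2 ^ (2 * m - 1))"
    and "cayley G b ^ (2 ^ (2 * m - 1)) * cayley G a = cayley G a * cayley G b ^ (2 ^ (2 * m - 1))"
    and "\<exists>x y. gc (cayley G a) (cayley G b) ^ (2 ^ l)
      = zp (cayley G a) (2 ^ (2 * m - 1) * x) * zp (cayley G b) (2 ^ (2 * m - 1) * y)" by auto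
qed

lemma zp_central:
  "zp (cayley G a) (2 ^ (2 * m - 1) * x) * cayley G b = cayley G b * zp (cayley G a) (2 ^ (2 * m - 1) * x)"
  "zp (cayley G b) (2 ^ (2 * m - 1) * x) * cayley G a = cayley G a * zp (cayley G b) (2 ^ (2 * m - 1) * x)"
proof -
  have z: "zp y (2 ^ (2 * m - 1) * x) = zp (y ^ (2 ^ (2 * m - 1))) x" for y :: "word set perms"
    using zp_of_nat[of y "2 ^ (2 * m - 1)"] by (simp add: zp_mult)
  show "zp (cayley G a) (2 ^ (2 * m - 1) * x) * cayley G b = cayley G b * zp (cayley G a) (2 ^ (2 * m - 1) * x)"
    "zp (cayley G b) (2 ^ (2 * m - 1) * x) * cayley G a = cayley G a * zp (cayley G b) (2 ^ (2 * m - 1) * x)"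
    unfolding z using commute_zp[OF structure_P(1)] commute_zp[OF structure_P(2)] by auto
qed

text \<open>\<open>c ^ (2 ^ l)\<close> is a product of commuting powers of \<open>a\<close> and
  \<open>b\<close> with exponents divisible by \<open>2 ^ (2 * m - 1)\<close>; a further
  \<open>2 ^ (l - m + 1)\<close> completes these to \<open>2 ^ (l + m)\<close>.\<close>

lemma c_two_order: "c [^]\<^bsub>G\<^esub> ((2::nat) ^ (2 * l - m + 1)) = \<one>\<^bsub>G\<^esub>"
proof -
  obtain x y where xy: "gc (cayley G a) (cayley G b) ^ (2 ^ l)
      = zp (cayley G a) (2 ^ (2 * m - 1) * x) * zp (cayley G b) (2 ^ (2 * m - 1) * y)" using structure_P(3) by blast
  let ?r = "2 ^ (l - m + 1) :: int"
  have e: "2 * l - m + 1 = l + (l - m + 1)" using lm by simp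
  have "gc (cayley G a) (cayley G b) ^ (2 ^ (2 * l - m + 1)) = (gc (cayley G a) (cayley G b) ^ (2 ^ l)) ^ (2 ^ (l - m + 1))"
    by (simp only: e power_add[of 2 l] power_mult)
  also have "\<dots> = zp (gc (cayley G a) (cayley G b) ^ (2 ^ l)) ?r"
    by (simp only: zp_of_nat[symmetric] of_nat_power of_nat_numeral)
  also have "\<dots> = zp (zp (cayley G a) (2 ^ (2 * m - 1) * x)) ?r * zp (zp (cayley G b) (2 ^ (2 * m - 1) * y)) ?r"
    unfolding xy using zp_central(2)[of y] by (intro zp_mult_distrib) (metis commute_zp)
  also have "\<dots> = 1"
  proof -
    have "2 * m - 1 + (l - m + 1) = l + m" using lm by simp
    then have "(2::int) ^ (2 * m - 1) * ?r = 2 ^ (l + m)" by (simp only: power_add[symmetric])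
    then have "2 ^ (2 * m - 1) * z * ?r = 2 ^ (l + m) * z" for z
      by (simp only: mult.assoc mult.commute[of z ?r]) (simp only: mult.assoc[symmetric])
    moreover have "zp v (2 ^ (l + m) * z) = zp (v ^ (2 ^ (l + m))) z" for v :: "word set perms" and z
      using zp_of_nat[of v "2 ^ (l + m)"] by (simp only: zp_mult of_nat_power of_nat_numeral)
    ultimately show ?thesis by (simp only: zp_mult[symmetric] kab_order zp_one mult_1)
  qed
  finally have "cayley G (c [^]\<^bsub>G\<^esub> ((2::nat) ^ (2 * l - m + 1))) = 1"
    by (simp add: k.hom_pow k.hom_comm c_def)
  then show ?thesis by (simp add: cayley_eq_one)
qed

lemma kc: "cayley G c = gc (cayley G a) (cayley G b)"
  by (simp add: c_def k.hom_comm)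

lemma P_reduced:
  assumes "x \<in> P"
  shows "\<exists>i < 2 ^ (l + m). \<exists>k < 2 ^ l. \<exists>j < 2 ^ (l + m). x = a [^]\<^bsub>G\<^esub> (i::nat) \<otimes>\<^bsub>G\<^esub> c [^]\<^bsub>G\<^esub> (k::nat) \<otimes>\<^bsub>G\<^esub> b [^]\<^bsub>G\<^esub> (j::nat)"
proof -
  obtain i k j where x: "x = a [^]\<^bsub>G\<^esub> (i::int) \<otimes>\<^bsub>G\<^esub> c [^]\<^bsub>G\<^esub> (k::nat) \<otimes>\<^bsub>G\<^esub> b [^]\<^bsub>G\<^esub> (j::int)"
    using generate_normal_form[OF closed(1,2) mac_P _ ab_order, of "2 ^ (2 * l - m + 1)" x] c_two_order assms
    unfolding P_def c_def by auto
  obtain p q where pq: "gc (cayley G a) (cayley G b) ^ (2 ^ l)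
      = zp (cayley G a) (2 ^ (2 * m - 1) * p) * zp (cayley G b) (2 ^ (2 * m - 1) * q)" using structure_P(3) by blast
  obtain i' k' j' where b: "i' < 2 ^ (l + m)" "k' < 2 ^ l" "j' < 2 ^ (l + m)" and
    e: "zp (cayley G a) i * gc (cayley G a) (cayley G b) ^ k * zp (cayley G b) j
      = cayley G a ^ i' * gc (cayley G a) (cayley G b) ^ k' * cayley G b ^ j'"
    using mac_normal_form_reduce[OF kab_order(1) _ kab_order(2) zp_central pq, of i k j] by auto
  have "cayley G x = cayley G (a [^]\<^bsub>G\<^esub> i' \<otimes>\<^bsub>G\<^esub> c [^]\<^bsub>G\<^esub> k' \<otimes>\<^bsub>G\<^esub> b [^]\<^bsub>G\<^esub> j')"
    using e by (simp add: x k.hom k.hom_pow k.hom_int_pow kc)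
  then have "x = a [^]\<^bsub>G\<^esub> i' \<otimes>\<^bsub>G\<^esub> c [^]\<^bsub>G\<^esub> k' \<otimes>\<^bsub>G\<^esub> b [^]\<^bsub>G\<^esub> j'"
    by (subst (asm) cayley_inject) (simp_all add: x)
  then show ?thesis using b by blast
qed

lemma subgroup_P: "subgroup P G" and subgroup_Q: "subgroup Q G"
  unfolding P_def Q_def by (rule generate_is_subgroup, simp)+

lemma in_P: "a \<in> P" "b \<in> P" "c \<in> P"
proof -
  show a: "a \<in> P" and b: "b \<in> P" unfolding P_def by (auto intro: generate.incl)
  show "c \<in> P" unfolding c_def comm_def
    using a b subgroup.m_inv_closed[OF subgroup_P] subgroup.m_closed[OF subgroup_P] by blast
qed

lemma pow_in_P: "x \<in> P \<Longrightarrow> x [^]\<^bsub>G\<^esub> (i::nat) \<in> P"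
  by (induction i) (auto simp: subgroup.one_closed[OF subgroup_P] subgroup.m_closed[OF subgroup_P])

lemma w_dvd: "2 ^ (4 * m) dvd int w1 - 1"
  by (rule power_le_dvd[OF w1(2) K])

lemma b_exact: "b [^]\<^bsub>G\<^esub> (i::nat) = \<one>\<^bsub>G\<^esub> \<Longrightarrow> 2 ^ (l + m) dvd i"
  and c_exact: "c [^]\<^bsub>G\<^esub> ((2::nat) ^ (2 * l - m)) \<noteq> \<one>\<^bsub>G\<^esub>"
  and normal_form_unique: "a [^]\<^bsub>G\<^esub> (i1::nat) \<otimes>\<^bsub>G\<^esub> c [^]\<^bsub>G\<^esub> (k1::nat) \<otimes>\<^bsub>G\<^esub> b [^]\<^bsub>G\<^esub> (j1::nat)
      = a [^]\<^bsub>G\<^esub> (i2::nat) \<otimes>\<^bsub>G\<^esub> c [^]\<^bsub>G\<^esub> (k2::nat) \<otimes>\<^bsub>G\<^esub> b [^]\<^bsub>G\<^esub> (j2::nat)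
    \<Longrightarrow> k1 < 2 ^ l \<Longrightarrow> k2 < 2 ^ l \<Longrightarrow> j1 < 2 ^ (l + m) \<Longrightarrow> j2 < 2 ^ (l + m) \<Longrightarrow> k1 = k2 \<and> j1 = j2"
proof -
  obtain g h u \<theta> x \<gamma> where cm: "coset_model l m g h u \<theta> x \<gamma>" and ab: "\<alpha> = 1 + 2 * g" "\<beta> = 1 + 2 * h"
    using coset_model_exists[OF va vb vl lm] .
  note def = a_def[unfolded ab] b_def[unfolded ab] c_def[unfolded ab]
  show "b [^]\<^bsub>G\<^esub> (i::nat) = \<one>\<^bsub>G\<^esub> \<Longrightarrow> 2 ^ (l + m) dvd i"
    using coset_model.model_b_order[OF cm w_dvd def] unfolding ab .
  show "c [^]\<^bsub>G\<^esub> ((2::nat) ^ (2 * l - m)) \<noteq> \<one>\<^bsub>G\<^esub>"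
    using coset_model.model_c_order[OF cm w_dvd def] unfolding ab .
  show "a [^]\<^bsub>G\<^esub> (i1::nat) \<otimes>\<^bsub>G\<^esub> c [^]\<^bsub>G\<^esub> (k1::nat) \<otimes>\<^bsub>G\<^esub> b [^]\<^bsub>G\<^esub> (j1::nat)
      = a [^]\<^bsub>G\<^esub> (i2::nat) \<otimes>\<^bsub>G\<^esub> c [^]\<^bsub>G\<^esub> (k2::nat) \<otimes>\<^bsub>G\<^esub> b [^]\<^bsub>G\<^esub> (j2::nat)
    \<Longrightarrow> k1 < 2 ^ l \<Longrightarrow> k2 < 2 ^ l \<Longrightarrow> j1 < 2 ^ (l + m) \<Longrightarrow> j2 < 2 ^ (l + m) \<Longrightarrow> k1 = k2 \<and> j1 = j2"
    using coset_model.model_normal_form[OF cm w_dvd def] unfolding ab .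
qed

text \<open>The model of \<open>G\<close> cannot show this order, as \<open>a\<close> fixes the base
  point. In the presentation with exchanged letters and exponents the same element is a power of the
  second generator, and \<open>model_b_order\<close> applies.\<close>

lemma a_exact: "a [^]\<^bsub>G\<^esub> (i::nat) = \<one>\<^bsub>G\<^esub> \<Longrightarrow> 2 ^ (l + m) dvd i"
proof -
  assume "a [^]\<^bsub>G\<^esub> i = \<one>\<^bsub>G\<^esub>"
  then have "A [^]\<^bsub>G\<^esub> (w1 * i) = \<one>\<^bsub>G\<^esub>" by (simp add: a_def nat_pow_pow)
  then have 1: "Belt \<beta> \<alpha> [^]\<^bsub>Gpres \<beta> \<alpha>\<^esub> (w1 * i) = \<one>\<^bsub>Gpres \<beta> \<alpha>\<^esub>" by (rule Aelt_pow_swap)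
  have vl': "tv l (\<beta> - \<alpha>)" using tv_uminus[OF vl] by simp
  obtain g h u \<theta> x \<gamma> where cm: "coset_model l m g h u \<theta> x \<gamma>" and ab: "\<beta> = 1 + 2 * g" "\<alpha> = 1 + 2 * h"
    using coset_model_exists[OF vb va vl' lm] .
  interpret H: group "Gpres \<beta> \<alpha>" by (rule group_Gpres)
  have "(Belt \<beta> \<alpha> [^]\<^bsub>Gpres \<beta> \<alpha>\<^esub> w1) [^]\<^bsub>Gpres \<beta> \<alpha>\<^esub> i = \<one>\<^bsub>Gpres \<beta> \<alpha>\<^esub>"
    using 1 by (simp add: H.nat_pow_pow)
  then show ?thesis
    using coset_model.model_b_order[OF cm w_dvd HOL.refl HOL.refl HOL.refl, of i] unfolding ab by blast
qed

lemma card_P: "card P = 2 ^ (2 * m + 3 * l)"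
proof -
  define D where "D = {..<(2::nat) ^ (l + m)} \<times> {..<(2::nat) ^ l} \<times> {..<(2::nat) ^ (l + m)}"
  define F where "F = (\<lambda>(i, k, j). a [^]\<^bsub>G\<^esub> (i::nat) \<otimes>\<^bsub>G\<^esub> c [^]\<^bsub>G\<^esub> (k::nat) \<otimes>\<^bsub>G\<^esub> b [^]\<^bsub>G\<^esub> (j::nat))"
  have "P = F ` D"
  proof
    show "P \<subseteq> F ` D"
    proof
      fix x assume "x \<in> P"
      then obtain i k j where "i < 2 ^ (l + m)" "k < 2 ^ l" "j < 2 ^ (l + m)"
        "x = a [^]\<^bsub>G\<^esub> (i::nat) \<otimes>\<^bsub>G\<^esub> c [^]\<^bsub>G\<^esub> (k::nat) \<otimes>\<^bsub>G\<^esub> b [^]\<^bsub>G\<^esub> (j::nat)" using P_reduced by blast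
      then have "x = F (i, k, j)" "(i, k, j) \<in> D" by (simp_all add: F_def D_def)
      then show "x \<in> F ` D" by blast
    qed
    show "F ` D \<subseteq> P"
      using in_P by (auto simp: F_def intro!: subgroup.m_closed[OF subgroup_P] pow_in_P)
  qed
  moreover have "inj_on F D"
  proof (rule inj_onI)
    fix p q assume pq: "p \<in> D" "q \<in> D" "F p = F q"
    obtain i1 k1 j1 where p: "p = (i1, k1, j1)" by (cases p)
    obtain i2 k2 j2 where q: "q = (i2, k2, j2)" by (cases q)
    have eq: "a [^]\<^bsub>G\<^esub> i1 \<otimes>\<^bsub>G\<^esub> c [^]\<^bsub>G\<^esub> k1 \<otimes>\<^bsub>G\<^esub> b [^]\<^bsub>G\<^esub> j1 = a [^]\<^bsub>G\<^esub> i2 \<otimes>\<^bsub>G\<^esub> c [^]\<^bsub>G\<^esub> k2 \<otimes>\<^bsub>G\<^esub> b [^]\<^bsub>G\<^esub> j2"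
      using pq by (simp add: p q F_def)
    \<comment> \<open>The model separates the exponents of \<open>c\<close> and \<open>b\<close>;
      that of \<open>a\<close> is then separated by \<open>a_exact\<close>.\<close>
    have kj: "k1 = k2" "j1 = j2" using normal_form_unique[OF eq] pq by (auto simp: p q D_def)
    then have "a [^]\<^bsub>G\<^esub> i1 = a [^]\<^bsub>G\<^esub> i2" using eq by simp
    moreover have "i1 = i2" if "i1 \<le> i2" "i1 < 2 ^ (l + m)" "i2 < 2 ^ (l + m)" "a [^]\<^bsub>G\<^esub> i1 = a [^]\<^bsub>G\<^esub> i2" for i1 i2 :: nat
    proof -
      have "a [^]\<^bsub>G\<^esub> i1 \<otimes>\<^bsub>G\<^esub> a [^]\<^bsub>G\<^esub> (i2 - i1) = a [^]\<^bsub>G\<^esub> i2" using that(1) by (simp add: nat_pow_mult)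
      then have "a [^]\<^bsub>G\<^esub> i1 \<otimes>\<^bsub>G\<^esub> a [^]\<^bsub>G\<^esub> (i2 - i1) = a [^]\<^bsub>G\<^esub> i1" using that(4) by simp
      then have "a [^]\<^bsub>G\<^esub> (i2 - i1) = \<one>\<^bsub>G\<^esub>" by (metis l_cancel_one nat_pow_closed closed(1))
      then have "2 ^ (l + m) dvd i2 - i1" by (rule a_exact)
      then have "i2 - i1 = 0" using that by (metis dvd_imp_le less_imp_diff_less not_le neq0_conv)
      then show ?thesis using that by simp
    qed
    ultimately have "i1 = i2" using pq by (metis p q D_def mem_Sigma_iff lessThan_iff nat_le_linear)
    then show "p = q" using p q kj by simp
  qed
  ultimately have "card P = card D" by (simp add: card_image)
  also have "\<dots> = 2 ^ (l + m) * (2 ^ l * 2 ^ (l + m))" by (simp add: D_def)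
  also have "\<dots> = 2 ^ (2 * m + 3 * l)"
  proof -
    have "l + m + (l + (l + m)) = 2 * m + 3 * l" by simp
    then show ?thesis by (simp only: power_add[symmetric])
  qed
  finally show ?thesis .
qed

end

section \<open>The Sylow 2-subgroup, the projections and the orders\<close>

context macdonald_two
begin

lemma P_subset: "P \<subseteq> carrier G" and Q_subset: "Q \<subseteq> carrier G"
  using subgroup.subset[OF subgroup_P] subgroup.subset[OF subgroup_Q] by auto

lemma PQ_commute: "x \<in> P \<Longrightarrow> y \<in> Q \<Longrightarrow> x \<otimes>\<^bsub>G\<^esub> y = y \<otimes>\<^bsub>G\<^esub> x"
proof -
  assume x: "x \<in> P" and y: "y \<in> Q"
  have "s \<otimes>\<^bsub>G\<^esub> x = x \<otimes>\<^bsub>G\<^esub> s" if s: "s \<in> {a', b'}" for s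
  proof -
    have sc: "s \<in> carrier G" using s by auto
    have st: "t \<otimes>\<^bsub>G\<^esub> s = s \<otimes>\<^bsub>G\<^esub> t" if "t \<in> {a, b}" for t using that s com by blast
    have "x \<in> generate G {a, b}" using x by (simp only: P_def)
    then have "x \<otimes>\<^bsub>G\<^esub> s = s \<otimes>\<^bsub>G\<^esub> x"
      using generate_commute[of "{a, b}" s x] sc st closed(1,2) by blast
    then show ?thesis by (rule HOL.sym)
  qed
  moreover have "y \<in> generate G {a', b'}" using y by (simp only: Q_def)
  moreover have "x \<in> carrier G" using x P_subset by blast
  ultimately have "y \<otimes>\<^bsub>G\<^esub> x = x \<otimes>\<^bsub>G\<^esub> y"
    using generate_commute[of "{a', b'}" x y] closed(3,4) by blast
  then show ?thesis by (rule HOL.sym)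
qed

lemma G_eq_PQ: "x \<in> carrier G \<Longrightarrow> \<exists>p \<in> P. \<exists>q \<in> Q. x = p \<otimes>\<^bsub>G\<^esub> q"
proof -
  interpret P: subgroup P G by (rule subgroup_P)
  interpret Q: subgroup Q G by (rule subgroup_Q)
  have gens: "a \<in> P" "b \<in> P" "a' \<in> Q" "b' \<in> Q" by (auto simp: P_def Q_def intro: generate.incl)
  have Pc: "p \<in> carrier G" if "p \<in> P" for p using that P_subset by blast
  have Qc: "q \<in> carrier G" if "q \<in> Q" for q using that Q_subset by blast
  have AB: "\<exists>p \<in> P. \<exists>q \<in> Q. h = p \<otimes>\<^bsub>G\<^esub> q" if h: "h \<in> {A, B}" for h
  proof (cases "h = A")
    case True
    show ?thesis
      by (rule bexI[OF bexI[OF _ gens(3)] gens(1)]) (simp only: True splitA[symmetric])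
  next
    case False
    then have "h = B" using h by simp
    show ?thesis
      by (rule bexI[OF bexI[OF _ gens(4)] gens(2)]) (simp only: \<open>h = B\<close> splitB[symmetric])
  qed
  assume "x \<in> carrier G"
  then have "x \<in> generate G {A, B}" by (simp only: Gpres_generate)
  then show ?thesis
  proof (induction rule: generate.induct)
    case one
    show ?case by (rule bexI[OF bexI[OF _ Q.one_closed] P.one_closed]) simp
  next
    case (incl h)
    then show ?case by (rule AB)
  next
    case (inv h)
    then have "\<exists>p \<in> P. \<exists>q \<in> Q. h = p \<otimes>\<^bsub>G\<^esub> q" by (rule AB)
    then obtain p q where pq: "p \<in> P" "q \<in> Q" "h = p \<otimes>\<^bsub>G\<^esub> q" by (elim bexE)
    have "h = q \<otimes>\<^bsub>G\<^esub> p" using pq(3) PQ_commute[OF pq(1,2)] by (simp only:)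
    then have "inv\<^bsub>G\<^esub> h = inv\<^bsub>G\<^esub> p \<otimes>\<^bsub>G\<^esub> inv\<^bsub>G\<^esub> q" using pq Pc Qc by (simp add: inv_mult_group)
    then show ?case using P.m_inv_closed[OF pq(1)] Q.m_inv_closed[OF pq(2)] by (intro bexI)
  next
    case (eng h1 h2)
    then obtain p1 q1 p2 q2 where h: "p1 \<in> P" "q1 \<in> Q" "h1 = p1 \<otimes>\<^bsub>G\<^esub> q1" "p2 \<in> P" "q2 \<in> Q" "h2 = p2 \<otimes>\<^bsub>G\<^esub> q2"
      by blast
    have "h1 \<otimes>\<^bsub>G\<^esub> h2 = p1 \<otimes>\<^bsub>G\<^esub> (q1 \<otimes>\<^bsub>G\<^esub> p2) \<otimes>\<^bsub>G\<^esub> q2" using h Pc Qc by (simp add: m_assoc)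
    also have "q1 \<otimes>\<^bsub>G\<^esub> p2 = p2 \<otimes>\<^bsub>G\<^esub> q1" using PQ_commute[OF h(4,2)] by (rule HOL.sym)
    finally have "h1 \<otimes>\<^bsub>G\<^esub> h2 = (p1 \<otimes>\<^bsub>G\<^esub> p2) \<otimes>\<^bsub>G\<^esub> (q1 \<otimes>\<^bsub>G\<^esub> q2)" using h Pc Qc by (simp add: m_assoc)
    then show ?case using P.m_closed[OF h(1,4)] Q.m_closed[OF h(2,5)] by (intro bexI)
  qed
qed

lemma P_two_power: "x \<in> P \<Longrightarrow> x [^]\<^bsub>G\<^esub> ((2::nat) ^ (2 * m + 3 * l)) = \<one>\<^bsub>G\<^esub>"
proof -
  assume x: "x \<in> P"
  interpret H: group "G\<lparr>carrier := P\<rparr>" by (rule subgroup_imp_group[OF subgroup_P])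
  have "finite P" by (rule ccontr) (use card_P in simp)
  then have "x [^]\<^bsub>G\<lparr>carrier := P\<rparr>\<^esub> Coset.order (G\<lparr>carrier := P\<rparr>) = \<one>\<^bsub>G\<lparr>carrier := P\<rparr>\<^esub>"
    using x by (intro H.pow_order_eq_1) simp
  then show ?thesis by (simp add: Coset.order_def card_P flip: nat_pow_consistent)
qed

lemma c'_order: "c' [^]\<^bsub>G\<^esub> n = \<one>\<^bsub>G\<^esub>"
proof -
  have an: "cayley G a' ^ n = 1" using odd_orders by (simp flip: k.hom_pow)
  obtain i where i: "i > 0" "\<And>z. zp (cayley G a') z = 1 \<longleftrightarrow> int i dvd z"
    using finite_order_exists[OF an npos] by blast
  have "i dvd n" using an i(2)[of "int n"] by (simp add: zp_of_nat)
  moreover have "gc (cayley G a') (cayley G b') ^ i = 1" by (rule mac_comm_pow_order(1)[OF mac_Q i])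
  then have "c' [^]\<^bsub>G\<^esub> i = \<one>\<^bsub>G\<^esub>" by (simp add: c'_def cayley_eq_one flip: k.hom_pow k.hom_comm)
  ultimately show ?thesis using pow_dvd by simp
qed

lemma Q_no_two_torsion:
  assumes x: "x \<in> Q" "x [^]\<^bsub>G\<^esub> ((2::nat) ^ e) = \<one>\<^bsub>G\<^esub>"
  shows "x = \<one>\<^bsub>G\<^esub>"
proof -
  have xc: "x \<in> carrier G" using x Q_subset by blast
  have c0: "comm G a' b' [^]\<^bsub>G\<^esub> n = \<one>\<^bsub>G\<^esub>" using c'_order by (simp only: c'_def)
  obtain i k j where e: "x = a' [^]\<^bsub>G\<^esub> (i::int) \<otimes>\<^bsub>G\<^esub> comm G a' b' [^]\<^bsub>G\<^esub> (k::nat) \<otimes>\<^bsub>G\<^esub> b' [^]\<^bsub>G\<^esub> (j::int)"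
    using generate_normal_form[OF closed(3,4) mac_Q npos odd_orders c0 npos x(1)[unfolded Q_def]] by (elim exE)
  have "cayley G x ^ (n * n) = 1"
  proof (rule mac_odd_element[OF mac_Q])
    show "cayley G a' ^ n = 1" "cayley G b' ^ n = 1" using odd_orders by (simp_all flip: k.hom_pow)
    show "gc (cayley G a') (cayley G b') ^ n = 1" using c0 by (simp flip: k.hom_pow k.hom_comm)
    show "cayley G x = zp (cayley G a') i * gc (cayley G a') (cayley G b') ^ k * zp (cayley G b') j"
      by (simp add: e k.hom k.hom_pow k.hom_int_pow k.hom_comm)
    have "x \<otimes>\<^bsub>G\<^esub> b' = b' \<otimes>\<^bsub>G\<^esub> x" by (rule coprime_commute[OF xc x(2) closed(4) odd_orders(2)])
    then show "cayley G x * cayley G b' = cayley G b' * cayley G x"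
      using k.hom[OF xc closed(4)] k.hom[OF closed(4) xc] by metis
  qed
  then have 1: "zp (cayley G x) (int (n * n)) = 1" by (simp only: zp_of_nat)
  have 2: "cayley G x ^ (2 ^ e) = 1" using x(2) xc by (simp flip: k.hom_pow)
  have "odd (int (n * n))" using n by simp
  then have "cayley G x = 1" by (rule odd_power_eq_one[OF 2 1])
  then show ?thesis using xc by (simp add: cayley_eq_one)
qed

lemma syl2_eq: "syl2 G = P"
proof
  show "P \<subseteq> syl2 G" using P_two_power P_subset by (auto simp: syl2_def)
  show "syl2 G \<subseteq> P"
  proof
    fix x assume "x \<in> syl2 G"
    then obtain e where x: "x \<in> carrier G" "x [^]\<^bsub>G\<^esub> ((2::nat) ^ e) = \<one>\<^bsub>G\<^esub>" by (auto simp: syl2_def)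
    obtain p q where pq: "p \<in> P" "q \<in> Q" "x = p \<otimes>\<^bsub>G\<^esub> q" using G_eq_PQ[OF x(1)] by blast
    have pc: "p \<in> carrier G" and qc: "q \<in> carrier G" using pq P_subset Q_subset by auto
    define r where "r = (2::nat) ^ (e + (2 * m + 3 * l))"
    have "x [^]\<^bsub>G\<^esub> r = \<one>\<^bsub>G\<^esub>" by (rule pow_dvd[OF x]) (simp add: r_def power_add)
    moreover have "p [^]\<^bsub>G\<^esub> r = \<one>\<^bsub>G\<^esub>" by (rule pow_dvd[OF pc P_two_power[OF pq(1)]]) (simp add: r_def power_add)
    moreover have "x [^]\<^bsub>G\<^esub> r = p [^]\<^bsub>G\<^esub> r \<otimes>\<^bsub>G\<^esub> q [^]\<^bsub>G\<^esub> r"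
      unfolding pq(3) by (rule pow_mult_distrib[OF PQ_commute[OF pq(1,2)] pc qc])
    ultimately have "q [^]\<^bsub>G\<^esub> r = \<one>\<^bsub>G\<^esub>" using qc by simp
    then have "q = \<one>\<^bsub>G\<^esub>" using Q_no_two_torsion[OF pq(2)] by (simp only: r_def)
    then show "x \<in> P" using pq pc by simp
  qed
qed

lemma proj2_A: "proj2 G A = a" and proj2_B: "proj2 G B = b" and proj2_C: "proj2 G (Celt \<alpha> \<beta>) = c"
proof -
  show "proj2 G A = a" by (rule proj2_eqI[OF _ two_orders(1) _ odd_orders(1) n splitA com(1)]) simp_all
  show "proj2 G B = b" by (rule proj2_eqI[OF _ two_orders(2) _ odd_orders(2) n splitB com(4)]) simp_all
  have "c \<otimes>\<^bsub>G\<^esub> c' = c' \<otimes>\<^bsub>G\<^esub> c" by (rule coprime_commute[OF _ c_two_order _ c'_order]) simp_all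
  moreover have "Celt \<alpha> \<beta> = c \<otimes>\<^bsub>G\<^esub> c'" using c_split by (simp add: Celt_eq)
  ultimately show "proj2 G (Celt \<alpha> \<beta>) = c"
    by (intro proj2_eqI[OF _ c_two_order _ c'_order n]) simp_all
qed

lemma ord_a: "ord a = 2 ^ (l + m)" and ord_b: "ord b = 2 ^ (l + m)"
proof -
  have "ord a dvd 2 ^ (l + m)" "ord b dvd 2 ^ (l + m)"
    using ab_order pow_eq_id[OF closed(1)] pow_eq_id[OF closed(2)] by blast+
  moreover have "2 ^ (l + m) dvd ord a" "2 ^ (l + m) dvd ord b"
    using a_exact[OF pow_ord_eq_1[OF closed(1)]] b_exact[OF pow_ord_eq_1[OF closed(2)]] .
  ultimately show "ord a = 2 ^ (l + m)" "ord b = 2 ^ (l + m)" by (simp_all only: dvd_antisym)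
qed

lemma ord_c: "ord c = 2 ^ (2 * l - m + 1)"
proof -
  have "ord c dvd 2 ^ (2 * l - m + 1)" using c_two_order by (simp add: pow_eq_id)
  then obtain i where i: "i \<le> 2 * l - m + 1" "ord c = 2 ^ i" using divides_primepow_nat[OF two_is_prime_nat] by blast
  have "\<not> ord c dvd 2 ^ (2 * l - m)" using c_exact by (simp add: pow_eq_id)
  then have "\<not> i \<le> 2 * l - m" using i by (auto simp: le_imp_power_dvd)
  then show ?thesis using i by (simp add: le_Suc_eq)
qed

section \<open>The nilpotency class\<close>

definition H where "H = G\<lparr>carrier := P\<rparr>"

lemma carrier_H: "carrier H = P" by (simp add: H_def)

lemma group_H: "group H" unfolding H_def by (rule subgroup_imp_group[OF subgroup_P])

lemma in_H: "a \<in> carrier H" "b \<in> carrier H" "c \<in> carrier H"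
  using in_P by (simp_all add: carrier_H)

lemma H_generate: "carrier H = generate H {a, b}"
  using generate_consistent[OF _ subgroup_P, of "{a, b}"] in_P by (simp add: H_def P_def[symmetric])

lemma H_hom: "grp_hom H (cayley G)"
proof -
  interpret H: group H by (rule group_H)
  show ?thesis
  proof
    fix x y assume "x \<in> carrier H" "y \<in> carrier H"
    then show "cayley G (x \<otimes>\<^bsub>H\<^esub> y) = cayley G x * cayley G y"
      using P_subset k.hom[of x y] by (auto simp: H_def)
  qed
qed

lemma H_cayley_inject: "x \<in> carrier H \<Longrightarrow> y \<in> carrier H \<Longrightarrow> cayley G x = cayley G y \<longleftrightarrow> x = y"
  unfolding carrier_H using cayley_inject P_subset by blast

text \<open>A ladder: the terms 1 to 5 contain in turn \<open>a\<close> and \<open>b\<close> to the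
  power \<open>2 ^ (2 * m - 1)\<close>, then \<open>c ^ (2 ^ (m - 1))\<close>, then \<open>a\<close>
  and \<open>b\<close> to the power \<open>2 ^ m\<close>, then \<open>c\<close>, then
  \<open>a\<close> and \<open>b\<close>. The rungs are commutator formulas:
  \<open>[c ^ r, a]\<close> is a power of \<open>a\<close> with exponent
  \<open>1 - \<alpha> ^ r\<close>, and \<open>[a ^ r, b]\<close> is \<open>c ^ r\<close> times a
  power of \<open>a\<close> with exponent \<open>- hex \<alpha> r\<close>.\<close>

lemma ucs_H: "ucs H 5 = carrier H"
proof -
  interpret H: group H by (rule group_H)
  interpret h: grp_hom H "cayley G" by (rule H_hom)
  let ?a = "cayley G a" and ?b = "cayley G b" and ?c = "cayley G c"
  note aP = in_H(1) and bP = in_H(2) and cP = in_H(3)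
  have step: "x \<in> ucs H (Suc i)"
    if "x \<in> carrier H" "comm H x a \<in> ucs H i" "comm H x b \<in> ucs H i" for x i
    by (rule H.ucs_SucI[OF H_generate]) (use that aP bP in auto)
  have sub: "subgroup (ucs H i) H" for i using H.ucs_normal normal_imp_subgroup by blast
  have pw: "x [^]\<^bsub>H\<^esub> (z::int) \<in> ucs H i" if "x \<in> ucs H i" for x z i
    using H.subgroup_int_pow_closed[OF sub that] .
  have eqH: "x = y" if "cayley G x = cayley G y" "x \<in> carrier H" "y \<in> carrier H" for x y
    using that H_cayley_inject by simp
  have mono: "x \<in> ucs H (Suc i)" if "x \<in> ucs H i" for x i using that H.ucs_mono by blast
  have self: "comm H (x [^]\<^bsub>H\<^esub> (r::nat)) x = \<one>\<^bsub>H\<^esub>" if "x \<in> carrier H" for x r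
    by (rule eqH) (use that in \<open>simp_all add: h.hom_comm h.hom_pow gc_eq_one_iff power_commutes\<close>)
  have ka: "mac \<alpha> \<beta> ?a ?b" by (rule mac_P)
  let ?u = "a [^]\<^bsub>H\<^esub> ((2::nat) ^ (2 * m - 1))" and ?v = "b [^]\<^bsub>H\<^esub> ((2::nat) ^ (2 * m - 1))"
  have zu: "zp ?a (2 ^ (2 * m - 1) * z) = cayley G (?u [^]\<^bsub>H\<^esub> z)" for z :: int
    using zp_of_nat[of ?a "2 ^ (2 * m - 1)"] aP by (simp add: h.hom_int_pow h.hom_pow zp_mult)
  have zv: "zp ?b (2 ^ (2 * m - 1) * z) = cayley G (?v [^]\<^bsub>H\<^esub> z)" for z :: int
    using zp_of_nat[of ?b "2 ^ (2 * m - 1)"] bP by (simp add: h.hom_int_pow h.hom_pow zp_mult)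
  have u1: "?u \<in> ucs H 1"
  proof -
    have "comm H ?u b = \<one>\<^bsub>H\<^esub>"
      by (rule eqH) (use structure_P(1) aP bP in \<open>simp_all add: h.hom_comm h.hom_pow gc_eq_one_iff\<close>)
    then show ?thesis using step[of ?u 0] self[OF aP] aP by simp
  qed
  have v1: "?v \<in> ucs H 1"
  proof -
    have "comm H ?v a = \<one>\<^bsub>H\<^esub>"
      by (rule eqH) (use structure_P(2) aP bP in \<open>simp_all add: h.hom_comm h.hom_pow gc_eq_one_iff\<close>)
    then show ?thesis using step[of ?v 0] self[OF bP] bP by simp
  qed
  note gca = mac_gc_comm_powA[OF mac_P] and gcb = mac_gc_comm_powB[OF mac_P]
  have conj: "inv\<^bsub>H\<^esub> y \<otimes>\<^bsub>H\<^esub> x \<otimes>\<^bsub>H\<^esub> y \<in> ucs H i" if "x \<in> ucs H i" "y \<in> carrier H" for x y i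
    using normal.inv_op_closed1[OF H.ucs_normal that(2,1)] .
  have c2: "c [^]\<^bsub>H\<^esub> ((2::nat) ^ (m - 1)) \<in> ucs H 2"
  proof -
    let ?r = "2 ^ (m - 1) :: nat"
    have d: "\<exists>z. x ^ ?r - 1 = 2 ^ (2 * m - 1) * z" if "tv m (x - 1)" for x
    proof -
      have "tv (m - 1) (int ?r)" by (auto simp: tv_def intro: exI[of _ 1])
      then have "tv (m + (m - 1)) (x ^ ?r - 1)" by (rule tv_power_minus_one[OF that two_le_m])
      then have "2 ^ (2 * m - 1) dvd x ^ ?r - 1" by (rule tv_dvd) simp
      then show ?thesis by (elim dvdE) blast
    qed
    obtain z1 z2 where z: "\<alpha> ^ ?r - 1 = 2 ^ (2 * m - 1) * z1" "\<beta> ^ ?r - 1 = 2 ^ (2 * m - 1) * z2"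
      using d[OF va] d[OF vb] by blast
    have "comm H (c [^]\<^bsub>H\<^esub> ?r) a = ?u [^]\<^bsub>H\<^esub> (- z1)"
    proof (rule eqH)
      have "cayley G (comm H (c [^]\<^bsub>H\<^esub> ?r) a) = zp ?a (1 - \<alpha> ^ ?r)"
        using aP cP gca[of ?r] by (simp add: h.hom_comm h.hom_pow kc)
      also have "1 - \<alpha> ^ ?r = 2 ^ (2 * m - 1) * (- z1)" using z(1) by simp
      finally show "cayley G (comm H (c [^]\<^bsub>H\<^esub> ?r) a) = cayley G (?u [^]\<^bsub>H\<^esub> (- z1))" unfolding zu .
    qed (use aP cP in auto)
    moreover have "comm H (c [^]\<^bsub>H\<^esub> ?r) b = inv\<^bsub>H\<^esub> (c [^]\<^bsub>H\<^esub> ?r) \<otimes>\<^bsub>H\<^esub> ?v [^]\<^bsub>H\<^esub> z2 \<otimes>\<^bsub>H\<^esub> c [^]\<^bsub>H\<^esub> ?r"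
      by (rule eqH) (use bP cP gcb[of ?r] zv[of z2] z(2) in \<open>simp_all add: h.hom_comm h.hom_pow h.hom h.hom_inv kc\<close>)
    ultimately have "c [^]\<^bsub>H\<^esub> ?r \<in> ucs H (Suc 1)"
      using pw[OF u1] conj[OF pw[OF v1]] cP by (intro step) auto
    then show ?thesis by (simp only: Suc_1)
  qed
  \<comment> \<open>The next rung takes the exponent \<open>2 ^ m\<close>, at which
    \<open>two_power_dvd_hex\<close> reaches \<open>2 ^ (2 * m - 1)\<close>; at
    \<open>2 ^ (m - 1)\<close> it falls short.\<close>
  have cm2: "c [^]\<^bsub>H\<^esub> ((2::nat) ^ m) \<in> ucs H 2"
  proof -
    have "(2::nat) ^ m = 2 ^ (m - 1) * 2" using two_le_m by (cases m) auto
    then have "c [^]\<^bsub>H\<^esub> ((2::nat) ^ m) = (c [^]\<^bsub>H\<^esub> ((2::nat) ^ (m - 1))) [^]\<^bsub>H\<^esub> (2::int)"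
      using cP by (simp add: H.nat_pow_pow int_pow_def2)
    then show ?thesis using pw[OF c2] by simp
  qed
  have hx: "\<exists>z. hex x (2 ^ m) = 2 ^ (2 * m - 1) * z" if "tv m (x - 1)" for x
  proof -
    have "2 ^ (m + m - 1) dvd hex x (2 ^ m)"
      using two_le_m tv_dvd[OF that order_refl] by (intro two_power_dvd_hex) auto
    then show ?thesis by (simp add: mult_2) (elim dvdE, blast)
  qed
  have u2: "x \<in> ucs H 2" if "x \<in> ucs H 1" for x using mono[OF that] by (simp only: Suc_1)
  have m2: "x \<otimes>\<^bsub>H\<^esub> y \<in> ucs H i" if "x \<in> ucs H i" "y \<in> ucs H i" for x y i
    using subgroup.m_closed[OF sub that] .
  have a3: "a [^]\<^bsub>H\<^esub> ((2::nat) ^ m) \<in> ucs H 3"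
  proof -
    obtain z where z: "hex \<alpha> (2 ^ m) = 2 ^ (2 * m - 1) * z" using hx[OF va] by blast
    have "comm H (a [^]\<^bsub>H\<^esub> ((2::nat) ^ m)) b = c [^]\<^bsub>H\<^esub> ((2::nat) ^ m) \<otimes>\<^bsub>H\<^esub> ?u [^]\<^bsub>H\<^esub> (- z)"
      by (rule eqH) (use aP bP cP mac_comm_powA[OF ka, of "2 ^ m"] z zu[of "- z"] in
        \<open>simp_all add: h.hom_comm h.hom_pow h.hom kc\<close>)
    then have "a [^]\<^bsub>H\<^esub> ((2::nat) ^ m) \<in> ucs H (Suc 2)"
      using m2[OF cm2 u2[OF pw[OF u1]]] self[OF aP] aP subgroup.one_closed[OF sub] by (intro step) auto
    then show ?thesis by simp
  qed
  have b3: "b [^]\<^bsub>H\<^esub> ((2::nat) ^ m) \<in> ucs H 3"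
  proof -
    obtain z where z: "hex \<beta> (2 ^ m) = 2 ^ (2 * m - 1) * z" using hx[OF vb] by blast
    have "comm H (b [^]\<^bsub>H\<^esub> ((2::nat) ^ m)) a = inv\<^bsub>H\<^esub> (?v [^]\<^bsub>H\<^esub> z \<otimes>\<^bsub>H\<^esub> c [^]\<^bsub>H\<^esub> ((2::nat) ^ m))"
    proof (rule eqH)
      have "gc (?b ^ (2 ^ m)) ?a = ginv (gc ?a (?b ^ (2 ^ m)))" by (simp add: ginv_gc)
      also have "gc ?a (?b ^ (2 ^ m)) = zp ?b (2 ^ (2 * m - 1) * z) * gc ?a ?b ^ (2 ^ m)"
        using mac_comm_powB[OF ka, of "2 ^ m"] z by simp
      finally show "cayley G (comm H (b [^]\<^bsub>H\<^esub> ((2::nat) ^ m)) a) = cayley G (inv\<^bsub>H\<^esub> (?v [^]\<^bsub>H\<^esub> z \<otimes>\<^bsub>H\<^esub> c [^]\<^bsub>H\<^esub> ((2::nat) ^ m)))"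
        unfolding zv using aP bP cP by (simp add: h.hom_comm h.hom_pow[of b "2 ^ m"] h.hom_inv h.hom h.hom_pow[of c] kc del: H.inv_mult_group)
    qed (use aP bP cP in auto)
    moreover have "inv\<^bsub>H\<^esub> (?v [^]\<^bsub>H\<^esub> z \<otimes>\<^bsub>H\<^esub> c [^]\<^bsub>H\<^esub> ((2::nat) ^ m)) \<in> ucs H 2"
      using m2[OF u2[OF pw[OF v1]] cm2] subgroup.m_inv_closed[OF sub] by blast
    ultimately have "b [^]\<^bsub>H\<^esub> ((2::nat) ^ m) \<in> ucs H (Suc 2)"
      using self[OF bP] bP subgroup.one_closed[OF sub] by (intro step) auto
    then show ?thesis by simp
  qed
  have c4: "c \<in> ucs H 4"
  proof -
    obtain z1 z2 where z: "\<alpha> - 1 = 2 ^ m * z1" "\<beta> - 1 = 2 ^ m * z2" using va vb by (auto simp: tv_def)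
    have "comm H c a = (a [^]\<^bsub>H\<^esub> ((2::nat) ^ m)) [^]\<^bsub>H\<^esub> (- z1)"
    proof (rule eqH)
      have "cayley G (comm H c a) = zp ?a (1 - \<alpha>)" using gca[of 1] aP cP by (simp add: h.hom_comm kc)
      also have "1 - \<alpha> = 2 ^ m * (- z1)" using z(1) by simp
      also have "zp ?a (2 ^ m * (- z1)) = cayley G ((a [^]\<^bsub>H\<^esub> ((2::nat) ^ m)) [^]\<^bsub>H\<^esub> (- z1))"
        using zp_of_nat[of ?a "2 ^ m"] aP by (simp only: zp_mult) (simp add: h.hom_int_pow h.hom_pow)
      finally show "cayley G (comm H c a) = cayley G ((a [^]\<^bsub>H\<^esub> ((2::nat) ^ m)) [^]\<^bsub>H\<^esub> (- z1))" .
    qed (use aP cP in auto)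
    moreover have "comm H c b = inv\<^bsub>H\<^esub> c \<otimes>\<^bsub>H\<^esub> ((b [^]\<^bsub>H\<^esub> ((2::nat) ^ m)) [^]\<^bsub>H\<^esub> z2) \<otimes>\<^bsub>H\<^esub> c"
    proof (rule eqH)
      have "zp ?b (\<beta> - 1) = cayley G ((b [^]\<^bsub>H\<^esub> ((2::nat) ^ m)) [^]\<^bsub>H\<^esub> z2)"
        unfolding z(2) using zp_of_nat[of ?b "2 ^ m"] bP by (simp only: zp_mult) (simp add: h.hom_int_pow h.hom_pow)
      then show "cayley G (comm H c b) = cayley G (inv\<^bsub>H\<^esub> c \<otimes>\<^bsub>H\<^esub> ((b [^]\<^bsub>H\<^esub> ((2::nat) ^ m)) [^]\<^bsub>H\<^esub> z2) \<otimes>\<^bsub>H\<^esub> c)"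
        using gcb[of 1] bP cP by (simp add: h.hom_comm h.hom h.hom_inv kc)
    qed (use bP cP in auto)
    ultimately have "c \<in> ucs H (Suc 3)"
      using pw[OF a3] conj[OF pw[OF b3] cP] cP by (intro step) auto
    then show ?thesis by simp
  qed
  have cH: "comm H a b = c" by (rule eqH) (use aP bP cP in \<open>simp_all add: h.hom_comm kc\<close>)
  have cH': "comm H b a = inv\<^bsub>H\<^esub> c"
    by (rule eqH) (use aP bP cP in \<open>simp_all add: h.hom_comm h.hom_inv kc ginv_gc\<close>)
  have "a \<in> ucs H (Suc 4)"
    using self[OF aP, of 1] cH c4 aP subgroup.one_closed[OF sub] by (intro step) auto
  moreover have "b \<in> ucs H (Suc 4)"
    using self[OF bP, of 1] cH' subgroup.m_inv_closed[OF sub c4] bP subgroup.one_closed[OF sub] by (intro step) auto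
  ultimately have "{a, b} \<subseteq> ucs H 5" by simp
  then have "generate H {a, b} \<subseteq> ucs H 5" by (rule H.generate_subgroup_incl[OF _ sub])
  then show ?thesis using H.ucs_subset[of 5] H_generate by blast
qed

text \<open>Since \<open>lcs\<close> starts at 0, this is the fifth term. The witness takes
  commutators of \<open>c\<close> with \<open>a\<close>, \<open>b\<close>, \<open>a\<close>,
  inverting after the first: this gives \<open>a ^ r\<close> with \<open>r\<close> of valuation
  \<open>m\<close>, then \<open>c ^ r\<close> times a power of \<open>a\<close>, and the last one
  could vanish only with \<open>a\<close> to the power \<open>1 - \<alpha> ^ r\<close>. That
  exponent has valuation \<open>2 * m < l + m\<close>.\<close>

lemma lcs_H_4: "lcs H 4 \<noteq> {\<one>\<^bsub>H\<^esub>}"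
proof
  assume triv: "lcs H 4 = {\<one>\<^bsub>H\<^esub>}"
  interpret H: group H by (rule group_H)
  interpret h: grp_hom H "cayley G" by (rule H_hom)
  let ?a = "cayley G a" and ?b = "cayley G b" and ?c = "cayley G c"
  note aP = in_H(1) and bP = in_H(2) and cP = in_H(3)
  have lcs_step: "{inv\<^bsub>H\<^esub> x \<otimes>\<^bsub>H\<^esub> inv\<^bsub>H\<^esub> y \<otimes>\<^bsub>H\<^esub> x \<otimes>\<^bsub>H\<^esub> y | x y. x \<in> lcs H i \<and> y \<in> carrier H} \<subseteq> carrier H"
    if "lcs H i \<subseteq> carrier H" for i
    using that by (blast intro: H.m_closed H.inv_closed)
  have lcs_sub: "lcs H i \<subseteq> carrier H" for i
  proof (induction i)
    case (Suc i)
    then show ?case unfolding lcs.simps by (intro H.generate_incl lcs_step)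
  qed simp
  have lcsI: "comm H x y \<in> lcs H (Suc i)" if "x \<in> lcs H i" "y \<in> carrier H" for x y i
    using that by (auto simp: comm_def intro!: generate.incl)
  have lcs_pow: "x [^]\<^bsub>H\<^esub> (z::int) \<in> lcs H (Suc i)" if "x \<in> lcs H (Suc i)" for x z i
  proof -
    have "subgroup (lcs H (Suc i)) H"
      unfolding lcs.simps by (intro H.generate_is_subgroup lcs_step lcs_sub)
    then show ?thesis using that H.subgroup_int_pow_closed by blast
  qed
  have c1: "comm H a b \<in> lcs H (Suc 0)" using lcsI[of a 0 b] aP bP by simp
  define d where "d = comm H (comm H a b) a"
  have d: "d \<in> lcs H (Suc (Suc 0))" unfolding d_def using lcsI[OF c1 aP] .
  have dc: "d \<in> carrier H" using d lcs_sub by blast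
  note gca = mac_gc_comm_powA[OF mac_P]
  have kd: "cayley G d = zp ?a (1 - \<alpha>)"
    using gca[of 1] aP bP by (simp add: d_def h.hom_comm)
  \<comment> \<open>A natural residue of \<open>\<alpha> - 1\<close>, so that
    \<open>mac_comm_powA\<close> applies; the inverse of \<open>d\<close> has this exponent.\<close>
  define r where "r = nat ((\<alpha> - 1) mod 2 ^ (l + m))"
  have r: "int r = (\<alpha> - 1) mod 2 ^ (l + m)" by (simp add: r_def)
  then have rd: "2 ^ (l + m) dvd (\<alpha> - 1) - int r" by (simp add: minus_mod_eq_mult_div)
  have tr: "tv m (int r)"
    by (rule tv_cong[OF va]) (use power_le_dvd[OF rd, of "Suc m"] lm in simp)
  have kd': "cayley G (d [^]\<^bsub>H\<^esub> (-1 :: int)) = ?a ^ r"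
  proof -
    have "cayley G (d [^]\<^bsub>H\<^esub> (-1 :: int)) = zp ?a (\<alpha> - 1)"
      by (simp only: h.hom_int_pow[OF dc] kd zp_mult[symmetric]) simp
    also have "\<dots> = zp ?a (int r)" by (rule zp_two_power[OF kab_order(1) rd])
    finally show ?thesis by (simp add: zp_of_nat)
  qed
  define f where "f = comm H (d [^]\<^bsub>H\<^esub> (-1 :: int)) b"
  have f: "f \<in> lcs H (Suc (Suc (Suc 0)))" unfolding f_def using lcsI[OF lcs_pow[OF d] bP] .
  have fc: "f \<in> carrier H" using f lcs_sub by blast
  have kf: "cayley G f = gc ?a ?b ^ r * zp ?a (- hex \<alpha> r)"
    using dc bP kd' mac_comm_powA[OF mac_P, of r] by (simp add: f_def h.hom_comm)
  have "comm H f a \<in> lcs H (Suc (Suc (Suc (Suc 0))))" using lcsI[OF f aP] .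
  then have "comm H f a = \<one>\<^bsub>H\<^esub>" using triv by (simp add: numeral_eq_Suc)
  then have "gc (cayley G f) ?a = 1" using fc aP h.hom_one by (simp flip: h.hom_comm)
  then have "gc ?a ?b ^ r * (zp ?a (- hex \<alpha> r) * ?a) = ?a * (gc ?a ?b ^ r * zp ?a (- hex \<alpha> r))"
    by (simp add: gc_eq_one_iff kf mult.assoc)
  then have "gc ?a ?b ^ r * (?a * zp ?a (- hex \<alpha> r)) = ?a * (gc ?a ?b ^ r * zp ?a (- hex \<alpha> r))"
    by (simp only: commute_zp[of ?a ?a, OF HOL.refl])
  then have "gc ?a ?b ^ r * ?a * zp ?a (- hex \<alpha> r) = ?a * gc ?a ?b ^ r * zp ?a (- hex \<alpha> r)"
    by (simp only: mult.assoc)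
  then have "gc ?a ?b ^ r * ?a = ?a * gc ?a ?b ^ r" by (simp only: grp_right_cancel)
  then have "zp ?a (1 - \<alpha> ^ r) = 1" unfolding gca[symmetric] by (simp add: gc_eq_one_iff)
  moreover have "tv (m + m) (1 - \<alpha> ^ r)"
    using tv_uminus[OF tv_power_minus_one[OF va two_le_m tr]] by simp
  then obtain z where z: "odd z" "1 - \<alpha> ^ r = 2 ^ (m + m) * z" by (auto simp: tv_def)
  ultimately have "zp (?a ^ (2 ^ (m + m))) z = 1"
    using zp_of_nat[of ?a "2 ^ (m + m)"] by (simp add: zp_mult)
  moreover have "(?a ^ (2 ^ (m + m))) ^ (2 ^ (l + m)) = 1"
    by (subst power_mult[symmetric], subst mult.commute, subst power_mult) (simp only: kab_order power_one)
  ultimately have "?a ^ (2 ^ (m + m)) = 1" using odd_power_eq_one z(1) by blast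
  then have "a [^]\<^bsub>G\<^esub> ((2::nat) ^ (m + m)) = \<one>\<^bsub>G\<^esub>" by (simp add: cayley_eq_one flip: k.hom_pow)
  then have "(2::nat) ^ (l + m) dvd 2 ^ (m + m)" by (rule a_exact)
  then have "l + m \<le> m + m" by (rule power_dvd_imp_le) simp
  then show False using lm by simp
qed

lemma nilpotency_class_H: "nilpotency_class H = 5"
  unfolding nilpotency_class_def
proof (rule Least_equality)
  interpret H: group H by (rule group_H)
  have "lcs H 5 \<subseteq> {\<one>\<^bsub>H\<^esub>}" using H.lcs_subset_ucs[OF ucs_H, of 5] by simp
  moreover have "\<one>\<^bsub>H\<^esub> \<in> lcs H 5" unfolding numeral_eq_Suc lcs.simps by (rule generate.one)
  ultimately show "lcs H 5 = {\<one>\<^bsub>H\<^esub>}" by blast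
  fix i assume i: "lcs H i = {\<one>\<^bsub>H\<^esub>}"
  have "lcs H (i + j) = {\<one>\<^bsub>H\<^esub>}" for j
  proof (induction j)
    case (Suc j)
    have "{inv\<^bsub>H\<^esub> x \<otimes>\<^bsub>H\<^esub> inv\<^bsub>H\<^esub> y \<otimes>\<^bsub>H\<^esub> x \<otimes>\<^bsub>H\<^esub> y | x y. x \<in> lcs H (i + j) \<and> y \<in> carrier H} \<subseteq> {\<one>\<^bsub>H\<^esub>}"
    proof
      fix z assume "z \<in> {inv\<^bsub>H\<^esub> x \<otimes>\<^bsub>H\<^esub> inv\<^bsub>H\<^esub> y \<otimes>\<^bsub>H\<^esub> x \<otimes>\<^bsub>H\<^esub> y | x y. x \<in> lcs H (i + j) \<and> y \<in> carrier H}"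
      then obtain x y where z: "z = inv\<^bsub>H\<^esub> x \<otimes>\<^bsub>H\<^esub> inv\<^bsub>H\<^esub> y \<otimes>\<^bsub>H\<^esub> x \<otimes>\<^bsub>H\<^esub> y"
        and x: "x \<in> lcs H (i + j)" and y: "y \<in> carrier H" by blast
      have "x = \<one>\<^bsub>H\<^esub>" using x Suc by blast
      then show "z \<in> {\<one>\<^bsub>H\<^esub>}" using z y by simp
    qed
    then have "lcs H (i + Suc j) \<subseteq> {\<one>\<^bsub>H\<^esub>}"
      unfolding add_Suc_right lcs.simps by (rule H.generate_subgroup_incl[OF _ H.triv_subgroup])
    moreover have "\<one>\<^bsub>H\<^esub> \<in> lcs H (i + Suc j)" unfolding add_Suc_right lcs.simps by (rule generate.one)
    ultimately show ?case by blast
  qed (use i in simp)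
  then have "lcs H (i + (4 - i)) = {\<one>\<^bsub>H\<^esub>}" .
  then have "\<not> i \<le> 4" using lcs_H_4 by auto
  then show "5 \<le> i" by simp
qed

end

lemma abs_ge_two: "tv m (x - 1) \<Longrightarrow> 2 \<le> m \<Longrightarrow> \<bar>x\<bar> \<ge> (2::int)"
proof -
  assume t: "tv m (x - 1)" and m: "2 \<le> m"
  have "4 dvd x - 1" using tv_dvd[OF t m] by simp
  moreover have "x \<noteq> 1" using tv_nonzero[OF t] by simp
  ultimately show ?thesis by presburger
qed

lemma macdonald_two_exists:
  assumes va: "tv m (\<alpha> - 1)" and vb: "tv m (\<beta> - 1)" and vl: "tv l (\<alpha> - \<beta>)"
    and lm: "m < l" "l + 3 \<le> 2 * m" "2 * l + 2 \<le> 3 * m"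
  obtains K n w1 w2 cl where "macdonald_two \<alpha> \<beta> m l K n w1 w2 cl"
proof -
  interpret group "Gpres \<alpha> \<beta>" by (rule group_Gpres)
  have m2: "2 \<le> m" using lm by simp
  have ab: "\<bar>\<alpha>\<bar> \<ge> 2" "\<bar>\<beta>\<bar> \<ge> 2" using abs_ge_two[OF va m2] abs_ge_two[OF vb m2] .
  have four: "4 dvd \<alpha> - 1" "4 dvd \<beta> - 1" using tv_dvd[OF va m2] tv_dvd[OF vb m2] by simp_all
  obtain cl where cl: "ucs (Gpres \<alpha> \<beta>) cl = carrier (Gpres \<alpha> \<beta>)" using Gpres_nilpotent[OF ab four] .
  obtain N :: nat where N: "N > 0" "Aelt \<alpha> \<beta> [^]\<^bsub>Gpres \<alpha> \<beta>\<^esub> N = \<one>\<^bsub>Gpres \<alpha> \<beta>\<^esub>"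
    "Belt \<alpha> \<beta> [^]\<^bsub>Gpres \<alpha> \<beta>\<^esub> N = \<one>\<^bsub>Gpres \<alpha> \<beta>\<^esub>" using Gpres_finite_order[OF ab] .
  obtain v n where n: "N = 2 ^ v * n" "\<not> 2 dvd n" using prime_part[OF N(1) two_is_prime_nat] .
  \<comment> \<open>Enlarged by \<open>4 * m\<close> so that \<open>w1\<close> is 1 modulo
    \<open>2 ^ (4 * m)\<close>, as the model requires.\<close>
  define K where "K = v + 4 * m"
  have dv: "N dvd 2 ^ K * n" by (simp add: n K_def power_add)
  have AN: "Aelt \<alpha> \<beta> [^]\<^bsub>Gpres \<alpha> \<beta>\<^esub> (2 ^ K * n) = \<one>\<^bsub>Gpres \<alpha> \<beta>\<^esub>"
    "Belt \<alpha> \<beta> [^]\<^bsub>Gpres \<alpha> \<beta>\<^esub> (2 ^ K * n) = \<one>\<^bsub>Gpres \<alpha> \<beta>\<^esub>"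
    using N dv by (metis pow_eq_id dvd_trans Aelt_closed Belt_closed)+
  have "odd (int n)" using n(2) by simp
  then obtain y where y: "y > 0" "2 ^ K dvd int n * y - 1" using odd_inverse_mod by blast
  define w1 where "w1 = n * nat y"
  \<comment> \<open>The complement \<open>1 - w1\<close>, made natural by adding a multiple of the
    common exponent \<open>2 ^ K * n\<close>.\<close>
  define w2 where "w2 = 2 ^ K * n * w1 + 1 - w1"
  have w1: "n dvd w1" "2 ^ K dvd int w1 - 1" using y by (simp_all add: w1_def)
  have "n > 0" using n(2) by (auto intro: Nat.gr0I)
  define N' where "N' = 2 ^ K * n * w1"
  have "1 * w1 \<le> 2 ^ K * n * w1" using \<open>n > 0\<close> by (intro mult_right_mono) auto
  then have "w1 \<le> N'" by (simp only: N'_def mult_1)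
  then have "w1 + w2 = N' + 1" unfolding w2_def N'_def[symmetric] by linarith
  then have w12: "w1 + w2 = 2 ^ K * n * w1 + 1" by (simp only: N'_def)
  have "int w2 = 2 ^ K * (int n * int w1) - (int w1 - 1)" using arg_cong[OF w12, of int] by simp
  then have "2 ^ K dvd int w2" using w1(2) by simp
  then have "2 ^ K dvd w2" by (metis int_dvd_int_iff of_nat_numeral of_nat_power)
  moreover have "\<exists>q. w1 + w2 = 2 ^ K * n * q + 1" using w12 by (rule exI)
  moreover have "4 * m \<le> K" by (simp add: K_def)
  ultimately have "macdonald_two \<alpha> \<beta> m l K n w1 w2 cl"
    using va vb vl lm n(2) AN w1 cl by (intro macdonald_two.intro)
  then show thesis using that by blast
qed

theorem theorem16p5:
  fixes \<alpha> \<beta> :: int and m l :: nat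
  assumes "\<alpha> \<noteq> 1" and "\<beta> \<noteq> 1"
    and "multiplicity 2 (\<alpha> - 1) = m" and "multiplicity 2 (\<beta> - 1) = m" and "m \<ge> 3"
    and "multiplicity 2 (\<alpha> - \<beta>) = l"
    and "m < l" and "l < 2 * m" and "l \<le> 2 * m - 3" and "2 * l + 2 \<le> 3 * m"
  shows "card (syl2 (Gpres \<alpha> \<beta>)) = 2 ^ (2 * m + 3 * l)
    \<and> nilpotency_class ((Gpres \<alpha> \<beta>) \<lparr>carrier := syl2 (Gpres \<alpha> \<beta>)\<rparr>) = 5
    \<and> group.ord (Gpres \<alpha> \<beta>) (proj2 (Gpres \<alpha> \<beta>) (Aelt \<alpha> \<beta>)) = 2 ^ (l + m)
    \<and> group.ord (Gpres \<alpha> \<beta>) (proj2 (Gpres \<alpha> \<beta>) (Belt \<alpha> \<beta>)) = 2 ^ (l + m)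
    \<and> group.ord (Gpres \<alpha> \<beta>) (proj2 (Gpres \<alpha> \<beta>) (Celt \<alpha> \<beta>)) = 2 ^ (2 * l - m + 1)"
proof -
  \<comment> \<open>By convention \<open>multiplicity 2 0\<close> is 0, which \<open>m < l\<close>
    excludes.\<close>
  have "\<alpha> - \<beta> \<noteq> 0" using assms(6,7) by auto
  then have "tv m (\<alpha> - 1)" "tv m (\<beta> - 1)" "tv l (\<alpha> - \<beta>)"
    using tv_multiplicity[of "\<alpha> - 1"] tv_multiplicity[of "\<beta> - 1"] tv_multiplicity[of "\<alpha> - \<beta>"] assms by auto
  moreover have "l + 3 \<le> 2 * m" using assms by simp
  ultimately obtain K n w1 w2 cl where "macdonald_two \<alpha> \<beta> m l K n w1 w2 cl"
    using macdonald_two_exists[OF _ _ _ assms(7) _ assms(10)] by metis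
  then interpret macdonald_two \<alpha> \<beta> m l K n w1 w2 cl .
  show ?thesis
    unfolding syl2_eq proj2_A proj2_B proj2_C
    by (intro conjI card_P nilpotency_class_H[unfolded H_def] ord_a ord_b ord_c)
qed

end
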